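(* Let $\mathbf X\sim N_p(\mathbf 0,\boldsymbol\Sigma_1)$ and $\mathbf Y\sim N_p(\mathbf 0,\boldsymbol\Sigma_2)$, with independent i.i.d. samples $\mathbf X_1,\dots,\mathbf X_{n_1}$ of $\mathbf X$ and $\mathbf Y_1,\dots,\mathbf Y_{n_2}$ of $\mathbf Y$. Suppose that Assumptions 1 and 2 (stated in the context) hold and that $\log p=o(n^{1/5})$, where $n=n_1+n_2$. Let $F_{n_1,n_2}=-2\log p_T-2\log p_M$ be Fisher's combined statistic (defined in the context), and for $\alpha\in(0,1)$ let $c_\alpha$ be the upper $\alpha$ quantile of the chi-squared distribution with 4 degrees of freedom. Then, under the alternative hypothesis, $$\inf_{(\boldsymbol\Sigma_1,\boldsymbol\Sigma_2)\in\mathcal G_d\cup\mathcal G_s}P\left(F_{n_1,n_2}\ge c_\alpha\right)\to1\qquad\text{as }n_1,n_2,p\to\infty,$$ where $$\mathcal G_d=\left\{(\boldsymbol\Sigma_1,\boldsymbol\Sigma_2):\boldsymbol\Sigma_1>0,\ \boldsymbol\Sigma_2>0,\ \frac1{n_1}\mathrm{tr}(\boldsymbol\Sigma_1^2)+\frac1{n_2}\mathrm{tr}(\boldsymbol\Sigma_2^2)=o\left(\mathrm{tr}\{(\boldsymbol\Sigma_1-\boldsymbol\Sigma_2)^2\}\right)\right\},$$ $$\mathcal G_s=\left\{(\boldsymbol\Sigma_1,\boldsymbol\Sigma_2):\boldsymbol\Sigma_1>0,\ \boldsymbol\Sigma_2>0,\ \max_{1\le i\le j\le p}\frac{|\sigma_{ij1}-\sigma_{ij2}|}{\sqrt{\theta_{ij1}/n_1+\theta_{ij2}/n_2}}\ge4\sqrt{\log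 p}\right\}.$$
   Context: Setting: $n_1,n_2,p\to\infty$; the covariance matrices $\boldsymbol\Sigma_1=(\sigma_{ij1})_{p\times p}$, $\boldsymbol\Sigma_2=(\sigma_{ij2})_{p\times p}$ depend on $p,n_1,n_2$ and $\boldsymbol\Sigma>0$ means positive definite. $\mathbf X,\mathbf Y$ are Gaussian with mean zero; the two samples are independent of each other. $\lambda_i(\mathbf A)$ is the $i$-th largest eigenvalue of $\mathbf A$. The quantities $\theta_{ij1}=\mathrm{var}(X_iX_j)$ and $\theta_{ij2}=\mathrm{var}(Y_iY_j)$, where $X_i,Y_i$ are coordinates of $\mathbf X,\mathbf Y$. The $o(\cdot)$ in $\mathcal G_d$ and Assumptions 1 and 2 are asymptotic conditions on sequences of pairs $(\boldsymbol\Sigma_1,\boldsymbol\Sigma_2)$; accordingly the conclusion is read as: $P(F_{n_1,n_2}\ge c_\alpha)\to1$ along every sequence of pairs satisfying the assumptions and belonging to $\mathcal G_d\cup\mathcal G_s$. Assumption 1. As $\min\{n_1,n_2\}\to\infty$ and $p\to\infty$: (i) $n_1/(n_1+n_2)\to\gamma$ for some constant $\gamma\in(0,1)$; (ii) $\sum_{i=1}^{q}\lambda_i^2(\boldsymbol\Sigma_j)/\sum_{i=1}^{p}\lambda_i^2(\boldsymbol\Sigma_j)\to0$ for any integer $q=O(\log p)$ and $j=1,2$. Assumption 2. For $0<r<1$ let $\mathcal V_i(r)=\{1\le j\le p: |\sigma_{ij1}|/\sqrt{\sigma_{ii1}\sigma_{jj1}}\ge r \text{ or } |\sigma_{ij2}|/\sqrt{\sigma_{ii2}\sigma_{jj2}}\ge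 r\}$; for $\alpha>0$ let $s_i(\alpha)=\mathrm{card}(\mathcal V_i((\log p)^{-1-\alpha}))$; and let $\mathcal W(r)=\{1\le i\le p: \mathcal V_i(r)\setminus\{i\}\ne\varnothing\}$. There exist a subset $\Upsilon\subset\{1,\dots,p\}$ with $\mathrm{card}(\Upsilon)=o(p)$ and a constant $\alpha_0>0$ such that for all $\kappa>0$, $\max_{1\le i\le p,\,i\notin\Upsilon}s_i(\alpha_0)=o(p^\kappa)$. In addition, there exists a constant $0<r_0<1$ such that $\mathrm{card}(\mathcal W(r_0))=o(p)$. Quadratic form statistic (Li and Chen, 2012): $T_{n_1,n_2}=A_{n_1}+B_{n_2}-2C_{n_1,n_2}$, where, with $\sum^*$ denoting summation over mutually distinct indices, $$A_{n_1}=\frac{1}{n_1(n_1-1)}\sum_{u\ne v}(\mathbf X_u'\mathbf X_v)^2-\frac{2}{n_1(n_1-1)(n_1-2)}\sum^*_{u,v,w}\mathbf X_u'\mathbf X_v\mathbf X_v'\mathbf X_w+\frac{1}{n_1(n_1-1)(n_1-2)(n_1-3)}\sum^*_{u,v,w,z}\mathbf X_u'\mathbf X_v\mathbf X_w'\mathbf X_z,$$ $B_{n_2}$ is defined in the same way from $\mathbf Y_1,\dots,\mathbf Y_{n_2}$ (with $n_2$ in place of $n_1$), and $$C_{n_1,n_2}=\frac{1}{n_1n_2}\sum_{u,v}(\mathbf X_u'\mathbf Y_v)^2-\frac{1}{n_1n_2(n_1-1)}\sum_{u\ne w}\sum_v\mathbf X_u'\mathbf Y_v\mathbf Y_v'\mathbf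 X_w-\frac{1}{n_1n_2(n_2-1)}\sum_{u\ne w}\sum_v\mathbf Y_u'\mathbf X_v\mathbf X_v'\mathbf Y_w+\frac{1}{n_1n_2(n_1-1)(n_2-1)}\sum_{u\ne w}\sum_{v\ne z}\mathbf X_u'\mathbf Y_v\mathbf X_w'\mathbf Y_z.$$ The quantity $\widehat\sigma_{0,n_1,n_2}=\frac{2}{n_1}A_{n_1}+\frac{2}{n_2}B_{n_2}$ estimates the leading term $\sigma_{0,n_1,n_2}=2(n_1^{-1}+n_2^{-1})\mathrm{tr}(\boldsymbol\Sigma^2)$ of the standard deviation of $T_{n_1,n_2}$ under $H_0:\boldsymbol\Sigma_1=\boldsymbol\Sigma_2=\boldsymbol\Sigma$. Maximum form statistic (Cai, Liu and Xia, 2013): $$M_{n_1,n_2}=\max_{1\le i\le j\le p}\frac{(\widehat\sigma_{ij1}-\widehat\sigma_{ij2})^2}{\widehat\theta_{ij1}/n_1+\widehat\theta_{ij2}/n_2},$$ where, writing $X_{ki}$ for the $i$-th coordinate of $\mathbf X_k$ and $\bar X_i=n_1^{-1}\sum_kX_{ki}$, $\widehat\sigma_{ij1}=\frac1{n_1}\sum_{k=1}^{n_1}(X_{ki}-\bar X_i)(X_{kj}-\bar X_j)$, $\widehat\theta_{ij1}=\frac1{n_1}\sum_{k=1}^{n_1}\{(X_{ki}-\bar X_i)(X_{kj}-\bar X_j)-\widehat\sigma_{ij1}\}^2$, and $\widehat\sigma_{ij2},\widehat\theta_{ij2}$ are defined analogously from the $\mathbf Y$ sample. Fisher's combined statistic: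 $F_{n_1,n_2}=-2\log p_T-2\log p_M$, where $p_T=1-\Phi(T_{n_1,n_2}/\widehat\sigma_{0,n_1,n_2})$ and $p_M=1-G(M_{n_1,n_2}-4\log p+\log\log p)$, with $\Phi$ the standard normal cumulative distribution function and $G(x)=\exp\left(-\frac{1}{\sqrt{8\pi}}\exp\left(-\frac{x}{2}\right)\right)$. *)

theory Defs
  imports
    "HOL-Probability.Probability"
    "HOL-Library.Landau_Symbols"
    "Jordan_Normal_Form.Char_Poly"
begin

hide_const (open) Determinants.det Finite_Cartesian_Product.row Finite_Cartesian_Product.vec

text \<open>
  Coordinates and observations are numbered from \<open>0\<close>.  A vector in \<open>\<real>\<^sup>p\<close> is a function on
  \<open>{..<p}\<close>, and a sample \<open>x\<close> has the value \<open>x u i\<close> in coordinate \<open>i\<close> of observation \<open>u\<close>.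
\<close>

definition quad_form :: "nat \<Rightarrow> real mat \<Rightarrow> (nat \<Rightarrow> real) \<Rightarrow> real" where
  "quad_form p S a = (\<Sum>i<p. \<Sum>j<p. a i * S $$ (i, j) * a j)"

definition pos_definite :: "nat \<Rightarrow> real mat \<Rightarrow> bool" where
  "pos_definite p S \<longleftrightarrow> S \<in> carrier_mat p p \<and> transpose_mat S = S \<and>
     (\<forall>a. (\<exists>i<p. a i \<noteq> 0) \<longrightarrow> quad_form p S a > 0)"

definition mtrace :: "real mat \<Rightarrow> real" where
  "mtrace A = (\<Sum>i<dim_row A. A $$ (i, i))"

text \<open>The \<open>i\<close>-th largest eigenvalue, \<open>1 \<le> i \<le> p\<close>, counted with multiplicity.  The real roots of
  the characteristic polynomial of a symmetric \<open>p \<times> p\<close> matrix form a multiset of size \<open>p\<close>.\<close>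

definition eigval :: "nat \<Rightarrow> real mat \<Rightarrow> real" where
  "eigval i A = rev (sorted_list_of_multiset (proots (char_poly A))) ! (i - 1)"

abbreviation vec_space :: "nat \<Rightarrow> (nat \<Rightarrow> real) measure" where
  "vec_space p \<equiv> Pi\<^sub>M {..<p} (\<lambda>_. borel)"

text \<open>\<open>\<mu>\<close> is the law \<open>N\<^sub>p(0, S)\<close> for positive definite \<open>S\<close>: every nontrivial linear form
  \<open>a'x\<close> has the law \<open>N(0, a'Sa)\<close>.  Note that \<open>normal_density\<close> takes the standard deviation.\<close>

definition is_mvnormal :: "nat \<Rightarrow> real mat \<Rightarrow> (nat \<Rightarrow> real) measure \<Rightarrow> bool" where
  "is_mvnormal p S \<mu> \<longleftrightarrow> prob_space \<mu> \<and> sets \<mu> = sets (vec_space p) \<and>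
     (\<forall>a. (\<exists>i<p. a i \<noteq> 0) \<longrightarrow>
        distributed \<mu> lborel (\<lambda>x. \<Sum>i<p. a i * x i) (normal_density 0 (sqrt (quad_form p S a))))"

text \<open>\<open>\<theta>\<^sub>i\<^sub>j = var (X\<^sub>i X\<^sub>j)\<close> for a random vector \<open>X\<close> with law \<open>\<mu>\<close>.\<close>

definition theta :: "(nat \<Rightarrow> real) measure \<Rightarrow> nat \<Rightarrow> nat \<Rightarrow> real" where
  "theta \<mu> i j = prob_space.variance \<mu> (\<lambda>x. x i * x j)"

text \<open>Indexing both samples by a disjoint sum makes all \<open>n\<^sub>1 + n\<^sub>2\<close> vectors jointly independent:
  each sample is i.i.d. and the two samples are independent of each other.\<close>

definition iid_samples ::
  "'a measure \<Rightarrow> nat \<Rightarrow> nat \<Rightarrow> nat \<Rightarrow> (nat \<Rightarrow> real) measure \<Rightarrow> (nat \<Rightarrow> real) measure \<Rightarrow>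
   (nat \<Rightarrow> 'a \<Rightarrow> nat \<Rightarrow> real) \<Rightarrow> (nat \<Rightarrow> 'a \<Rightarrow> nat \<Rightarrow> real) \<Rightarrow> bool" where
  "iid_samples M p n1 n2 \<mu>1 \<mu>2 X Y \<longleftrightarrow>
     prob_space M \<and>
     prob_space.indep_vars M (\<lambda>_. vec_space p) (case_sum X Y) ({..<n1} <+> {..<n2}) \<and>
     (\<forall>u<n1. distr M (vec_space p) (X u) = \<mu>1) \<and>
     (\<forall>v<n2. distr M (vec_space p) (Y v) = \<mu>2)"

definition ip :: "nat \<Rightarrow> (nat \<Rightarrow> real) \<Rightarrow> (nat \<Rightarrow> real) \<Rightarrow> real" where
  "ip p x y = (\<Sum>i<p. x i * y i)"

definition A_stat :: "nat \<Rightarrow> nat \<Rightarrow> (nat \<Rightarrow> nat \<Rightarrow> real) \<Rightarrow> real" where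
  "A_stat p n x =
     1 / (real n * (real n - 1)) *
       (\<Sum>(u, v) | u < n \<and> v < n \<and> u \<noteq> v. (ip p (x u) (x v))\<^sup>2)
   - 2 / (real n * (real n - 1) * (real n - 2)) *
       (\<Sum>(u, v, w) | u < n \<and> v < n \<and> w < n \<and> distinct [u, v, w].
          ip p (x u) (x v) * ip p (x v) (x w))
   + 1 / (real n * (real n - 1) * (real n - 2) * (real n - 3)) *
       (\<Sum>(u, v, w, z) | u < n \<and> v < n \<and> w < n \<and> z < n \<and> distinct [u, v, w, z].
          ip p (x u) (x v) * ip p (x w) (x z))"

definition C_stat ::
  "nat \<Rightarrow> nat \<Rightarrow> nat \<Rightarrow> (nat \<Rightarrow> nat \<Rightarrow> real) \<Rightarrow> (nat \<Rightarrow> nat \<Rightarrow> real) \<Rightarrow> real" where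
  "C_stat p n1 n2 x y =
     1 / (real n1 * real n2) * (\<Sum>u<n1. \<Sum>v<n2. (ip p (x u) (y v))\<^sup>2)
   - 1 / (real n1 * real n2 * (real n1 - 1)) *
       (\<Sum>(u, w) | u < n1 \<and> w < n1 \<and> u \<noteq> w. \<Sum>v<n2. ip p (x u) (y v) * ip p (y v) (x w))
   - 1 / (real n1 * real n2 * (real n2 - 1)) *
       (\<Sum>(u, w) | u < n2 \<and> w < n2 \<and> u \<noteq> w. \<Sum>v<n1. ip p (y u) (x v) * ip p (x v) (y w))
   + 1 / (real n1 * real n2 * (real n1 - 1) * (real n2 - 1)) *
       (\<Sum>(u, w) | u < n1 \<and> w < n1 \<and> u \<noteq> w. \<Sum>(v, z) | v < n2 \<and> z < n2 \<and> v \<noteq> z.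
          ip p (x u) (y v) * ip p (x w) (y z))"

definition T_stat ::
  "nat \<Rightarrow> nat \<Rightarrow> nat \<Rightarrow> (nat \<Rightarrow> nat \<Rightarrow> real) \<Rightarrow> (nat \<Rightarrow> nat \<Rightarrow> real) \<Rightarrow> real" where
  "T_stat p n1 n2 x y = A_stat p n1 x + A_stat p n2 y - 2 * C_stat p n1 n2 x y"

definition sigma0_hat ::
  "nat \<Rightarrow> nat \<Rightarrow> nat \<Rightarrow> (nat \<Rightarrow> nat \<Rightarrow> real) \<Rightarrow> (nat \<Rightarrow> nat \<Rightarrow> real) \<Rightarrow> real" where
  "sigma0_hat p n1 n2 x y = 2 / real n1 * A_stat p n1 x + 2 / real n2 * A_stat p n2 y"

definition sample_mean :: "nat \<Rightarrow> (nat \<Rightarrow> nat \<Rightarrow> real) \<Rightarrow> nat \<Rightarrow> real" where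
  "sample_mean n x i = 1 / real n * (\<Sum>k<n. x k i)"

definition sigma_hat :: "nat \<Rightarrow> (nat \<Rightarrow> nat \<Rightarrow> real) \<Rightarrow> nat \<Rightarrow> nat \<Rightarrow> real" where
  "sigma_hat n x i j =
     1 / real n * (\<Sum>k<n. (x k i - sample_mean n x i) * (x k j - sample_mean n x j))"

definition theta_hat :: "nat \<Rightarrow> (nat \<Rightarrow> nat \<Rightarrow> real) \<Rightarrow> nat \<Rightarrow> nat \<Rightarrow> real" where
  "theta_hat n x i j =
     1 / real n * (\<Sum>k<n. ((x k i - sample_mean n x i) * (x k j - sample_mean n x j)
                           - sigma_hat n x i j)\<^sup>2)"

definition M_stat ::
  "nat \<Rightarrow> nat \<Rightarrow> nat \<Rightarrow> (nat \<Rightarrow> nat \<Rightarrow> real) \<Rightarrow> (nat \<Rightarrow> nat \<Rightarrow> real) \<Rightarrow> real" where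
  "M_stat p n1 n2 x y =
     Max {(sigma_hat n1 x i j - sigma_hat n2 y i j)\<^sup>2 /
            (theta_hat n1 x i j / real n1 + theta_hat n2 y i j / real n2) | i j. i \<le> j \<and> j < p}"

definition gumbel_cdf :: "real \<Rightarrow> real" where
  "gumbel_cdf x = exp (- (1 / sqrt (8 * pi)) * exp (- x / 2))"

definition p_T ::
  "nat \<Rightarrow> nat \<Rightarrow> nat \<Rightarrow> (nat \<Rightarrow> nat \<Rightarrow> real) \<Rightarrow> (nat \<Rightarrow> nat \<Rightarrow> real) \<Rightarrow> real" where
  "p_T p n1 n2 x y =
     1 - cdf std_normal_distribution (T_stat p n1 n2 x y / sigma0_hat p n1 n2 x y)"

definition p_M ::
  "nat \<Rightarrow> nat \<Rightarrow> nat \<Rightarrow> (nat \<Rightarrow> nat \<Rightarrow> real) \<Rightarrow> (nat \<Rightarrow> nat \<Rightarrow> real) \<Rightarrow> real" where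
  "p_M p n1 n2 x y =
     1 - gumbel_cdf (M_stat p n1 n2 x y - 4 * ln (real p) + ln (ln (real p)))"

definition F_stat ::
  "nat \<Rightarrow> nat \<Rightarrow> nat \<Rightarrow> (nat \<Rightarrow> nat \<Rightarrow> real) \<Rightarrow> (nat \<Rightarrow> nat \<Rightarrow> real) \<Rightarrow> real" where
  "F_stat p n1 n2 x y = - 2 * ln (p_T p n1 n2 x y) - 2 * ln (p_M p n1 n2 x y)"

definition chi_squared :: "nat \<Rightarrow> real measure" where
  "chi_squared d =
     distr (Pi\<^sub>M {..<d} (\<lambda>_. std_normal_distribution)) borel (\<lambda>z. \<Sum>i<d. (z i)\<^sup>2)"

definition upper_quantile :: "real measure \<Rightarrow> real \<Rightarrow> real" where
  "upper_quantile \<nu> \<alpha> = Inf {c. 1 - cdf \<nu> c \<le> \<alpha>}"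

text \<open>All parameters are sequences in \<open>k\<close>.  The constraint \<open>q k \<le> p k\<close> keeps the eigenvalue indices
  in range.\<close>

definition assumption1 ::
  "(nat \<Rightarrow> nat) \<Rightarrow> (nat \<Rightarrow> nat) \<Rightarrow> (nat \<Rightarrow> nat) \<Rightarrow> (nat \<Rightarrow> real mat) \<Rightarrow> (nat \<Rightarrow> real mat) \<Rightarrow> bool" where
  "assumption1 p n1 n2 S1 S2 \<longleftrightarrow>
     (\<exists>\<gamma>. 0 < \<gamma> \<and> \<gamma> < 1 \<and> (\<lambda>k. real (n1 k) / real (n1 k + n2 k)) \<longlonglongrightarrow> \<gamma>) \<and>
     (\<forall>q :: nat \<Rightarrow> nat.
        (\<forall>k. q k \<le> p k) \<and> (\<lambda>k. real (q k)) \<in> O(\<lambda>k. ln (real (p k))) \<longrightarrow>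
        (\<forall>S\<in>{S1, S2}.
          (\<lambda>k. (\<Sum>i=1..q k. (eigval i (S k))\<^sup>2) / (\<Sum>i=1..p k. (eigval i (S k))\<^sup>2)) \<longlonglongrightarrow> 0))"

definition V_set :: "nat \<Rightarrow> real mat \<Rightarrow> real mat \<Rightarrow> nat \<Rightarrow> real \<Rightarrow> nat set" where
  "V_set p S1 S2 i r =
     {j. j < p \<and>
        (\<bar>S1 $$ (i, j)\<bar> / sqrt (S1 $$ (i, i) * S1 $$ (j, j)) \<ge> r \<or>
         \<bar>S2 $$ (i, j)\<bar> / sqrt (S2 $$ (i, i) * S2 $$ (j, j)) \<ge> r)}"

definition s_card :: "nat \<Rightarrow> real mat \<Rightarrow> real mat \<Rightarrow> nat \<Rightarrow> real \<Rightarrow> nat" where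
  "s_card p S1 S2 i \<alpha> = card (V_set p S1 S2 i (ln (real p) powr (- 1 - \<alpha>)))"

definition W_set :: "nat \<Rightarrow> real mat \<Rightarrow> real mat \<Rightarrow> real \<Rightarrow> nat set" where
  "W_set p S1 S2 r = {i. i < p \<and> V_set p S1 S2 i r - {i} \<noteq> {}}"

definition assumption2 ::
  "(nat \<Rightarrow> nat) \<Rightarrow> (nat \<Rightarrow> real mat) \<Rightarrow> (nat \<Rightarrow> real mat) \<Rightarrow> bool" where
  "assumption2 p S1 S2 \<longleftrightarrow>
     (\<exists>\<Upsilon> \<alpha>0. (\<forall>k. \<Upsilon> k \<subseteq> {..<p k}) \<and> (\<lambda>k. real (card (\<Upsilon> k))) \<in> o(\<lambda>k. real (p k)) \<and> \<alpha>0 > 0 \<and>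
        (\<forall>\<kappa>>0. (\<lambda>k. real (Max {s_card (p k) (S1 k) (S2 k) i \<alpha>0 | i. i < p k \<and> i \<notin> \<Upsilon> k}))
                  \<in> o(\<lambda>k. real (p k) powr \<kappa>))) \<and>
     (\<exists>r0. 0 < r0 \<and> r0 < 1 \<and>
        (\<lambda>k. real (card (W_set (p k) (S1 k) (S2 k) r0))) \<in> o(\<lambda>k. real (p k)))"

text \<open>The dense class is an asymptotic condition, hence a set of sequences of pairs; the \<open>o\<close> is
  taken along the filter \<open>F\<close>.\<close>

definition G_dense ::
  "nat filter \<Rightarrow> (nat \<Rightarrow> nat) \<Rightarrow> (nat \<Rightarrow> nat) \<Rightarrow> (nat \<Rightarrow> nat) \<Rightarrow> (nat \<Rightarrow> real mat \<times> real mat) set" where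
  "G_dense F p n1 n2 =
     {SS. (\<forall>\<^sub>F k in F. pos_definite (p k) (fst (SS k)) \<and> pos_definite (p k) (snd (SS k))) \<and>
        (\<lambda>k. 1 / real (n1 k) * mtrace (fst (SS k) * fst (SS k))
              + 1 / real (n2 k) * mtrace (snd (SS k) * snd (SS k)))
          \<in> o[F](\<lambda>k. mtrace ((fst (SS k) - snd (SS k)) * (fst (SS k) - snd (SS k))))}"

text \<open>The sparse class is defined for each fixed \<open>p\<close>, \<open>n\<^sub>1\<close>, \<open>n\<^sub>2\<close>.  The arguments \<open>\<mu>1\<close>, \<open>\<mu>2\<close> are
  the laws \<open>N\<^sub>p(0, S1)\<close>, \<open>N\<^sub>p(0, S2)\<close>, through which \<open>theta\<close> depends on the covariance matrices.\<close>

definition G_sparse ::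
  "nat \<Rightarrow> nat \<Rightarrow> nat \<Rightarrow> (nat \<Rightarrow> real) measure \<Rightarrow> (nat \<Rightarrow> real) measure \<Rightarrow>
   (real mat \<times> real mat) set" where
  "G_sparse p n1 n2 \<mu>1 \<mu>2 =
     {(S1, S2). pos_definite p S1 \<and> pos_definite p S2 \<and>
        Max {\<bar>S1 $$ (i, j) - S2 $$ (i, j)\<bar> / sqrt (theta \<mu>1 i j / real n1 + theta \<mu>2 i j / real n2)
              | i j. i \<le> j \<and> j < p}
          \<ge> 4 * sqrt (ln (real p))}"

text \<open>A sequence of pairs lies in the union of the two classes if it is dense along some index set
  \<open>D\<close> and sparse at every index outside \<open>D\<close>.  The cases \<open>D = UNIV\<close> and \<open>D = {}\<close> are the dense and
  the sparse class; other \<open>D\<close> cover sequences that alternate between the classes.\<close>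

definition dense_or_sparse ::
  "(nat \<Rightarrow> nat) \<Rightarrow> (nat \<Rightarrow> nat) \<Rightarrow> (nat \<Rightarrow> nat) \<Rightarrow>
   (nat \<Rightarrow> (nat \<Rightarrow> real) measure) \<Rightarrow> (nat \<Rightarrow> (nat \<Rightarrow> real) measure) \<Rightarrow>
   (nat \<Rightarrow> real mat \<times> real mat) \<Rightarrow> bool" where
  "dense_or_sparse p n1 n2 \<mu>1 \<mu>2 SS \<longleftrightarrow>
     (\<exists>D. SS \<in> G_dense (inf sequentially (principal D)) p n1 n2 \<and>
          (\<forall>k. k \<notin> D \<longrightarrow> SS k \<in> G_sparse (p k) (n1 k) (n2 k) (\<mu>1 k) (\<mu>2 k)))"

end

theory Submission
  imports Defs "HOL-Real_Asymp.Real_Asymp"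
begin

text \<open>
  Both \<open>p\<^sub>T\<close> and \<open>p\<^sub>M\<close> lie strictly between \<open>0\<close> and \<open>1\<close>, so it is enough that one of the two
  standardised statistics tends to infinity in probability, and Chebyshev's inequality suffices for that.

  Dense class.  Write \<open>X\<^sub>uX\<^sub>u' = \<Sigma>\<^sub>1 + E\<^sub>u\<close>, \<open>Y\<^sub>vY\<^sub>v' = \<Sigma>\<^sub>2 + F\<^sub>v\<close> and \<open>D = \<Sigma>\<^sub>1 - \<Sigma>\<^sub>2\<close>, with the
  Frobenius inner product on matrices.  Then \<open>T = |D|\<^sup>2 + 2\<langle>mean E, D\<rangle> - 2\<langle>mean F, D\<rangle>\<close> plus degenerate
  sums whose summands are uncorrelated unless they share the relevant indices.  The covariance tensor
  of \<open>E\<^sub>u\<close> has Frobenius norm at most \<open>2|\<Sigma>\<^sub>1|\<^sup>2\<close>, so by Cauchy-Schwarz every term has a second moment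
  of order \<open>N\<^sup>2 + N|D|\<^sup>2\<close> with \<open>N = |\<Sigma>\<^sub>1|\<^sup>2/n\<^sub>1 + |\<Sigma>\<^sub>2|\<^sup>2/n\<^sub>2\<close>, which is \<open>o(|D|\<^sup>4)\<close>; similarly the
  estimate of the standard deviation is of order \<open>N\<close>.

  Sparse class.  At the entry \<open>(i, j)\<close> attaining the maximum, the signal is \<open>4\<surd>(log p)\<close>
  standard deviations, the error of \<open>\<sigma>\<^sub>i\<^sub>j\<close> is \<open>O(1)\<close> standard deviations and the variance estimate is at
  most twice its target, so \<open>M \<ge> (9/2) log p\<close> with probability tending to \<open>1\<close>.
\<close>

subsection \<open>Moments of the normal law\<close>

text \<open>All bounds must be free of \<open>p\<close>, so second moments are expressed through
  |\<Sigma>1|^2, |\<Sigma>2|^2 and |D|^2 alone. The obstacle is the mixed terms of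
  \<open>C_stat\<close>, such as |\<Sigma>1|^2 |\<Sigma>2|^2 / n1^2: one norm is divided by the
  sample size of the other sample, so \<open>N^2\<close> does not visibly dominate the term. The
  inequality |\<Sigma>2|^2 \<le> 2 |\<Sigma>1|^2 + 2 |D|^2 turns it into a multiple of
  \<open>N^2 + N |D|^2\<close>.

  In the sparse class a single entry is enough because \<open>M_stat\<close> is a maximum, so no
  union bound over entries occurs and the Chebyshev level \<open>b\<close> can stay fixed while
  \<open>p\<close> grows. The errors of both samples cost at most \<open>4 sqrt b\<close> standard
  deviations, eventually less than \<open>sqrt (log p)\<close>. What survives is (4 - 1)^2 / 2 =
  9/2, where the 2 is the loss in the variance estimate, and 9/2 exceeds the 4 in the centring
  \<open>4 log p\<close> of the Gumbel law.\<close>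

lemma quad_form_two:
  assumes "a < p" "b < p"
  shows "quad_form p S (\<lambda>i. s * of_bool (i = a) + t * of_bool (i = b)) =
    s\<^sup>2 * S $$ (a, a) + s * t * (S $$ (a, b) + S $$ (b, a)) + t\<^sup>2 * S $$ (b, b)"
proof -
  have *: "(\<Sum>j<p. f j * (s * of_bool (j = a) + t * of_bool (j = b))) = s * f a + t * f b" for f :: "nat \<Rightarrow> real"
  proof -
    have "(\<Sum>j<p. f j * (s * of_bool (j = a) + t * of_bool (j = b))) =
      (\<Sum>j<p. (if j = a then s * f a else 0)) + (\<Sum>j<p. (if j = b then t * f b else 0))"
      unfolding sum.distrib[symmetric] by (intro sum.cong) (auto simp: of_bool_def algebra_simps)
    then show ?thesis using assms by (simp add: sum.delta)
  qed
  have "quad_form p S (\<lambda>i. s * of_bool (i = a) + t * of_bool (i = b)) =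
    (\<Sum>i<p. (s * S $$ (i,a) + t * S $$ (i,b)) * (s * of_bool (i = a) + t * of_bool (i = b)))"
    unfolding quad_form_def
    by (intro sum.cong refl, subst *[symmetric]) (simp add: sum_distrib_left algebra_simps)
  also have "\<dots> = s * (s * S $$ (a,a) + t * S $$ (a,b)) + t * (s * S $$ (b,a) + t * S $$ (b,b))"
    by (rule *)
  finally show ?thesis by (simp add: algebra_simps power2_eq_square)
qed

lemma pos_definite_sym: "pos_definite p S \<Longrightarrow> a < p \<Longrightarrow> b < p \<Longrightarrow> S $$ (a, b) = S $$ (b, a)"
  unfolding pos_definite_def by (metis carrier_matD index_transpose_mat(1))

lemma pos_definite_diag:
  assumes "pos_definite p S" "a < p" shows "S $$ (a, a) > 0"
proof -
  have "quad_form p S (\<lambda>i. 1 * of_bool (i = a) + 0 * of_bool (i = a)) > 0"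
    using assms unfolding pos_definite_def by (metis (mono_tags, lifting) add_0_right mult_cancel_right1 mult_zero_left of_bool_eq(2) zero_neq_one)
  then show ?thesis using assms by (subst (asm) quad_form_two) auto
qed

text \<open>The form with all weights \<open>0\<close> is split off because
  \<open>is_mvnormal\<close> says nothing about it. The factor in the even moments is the double
  factorial (2k-1)!!, that is 1, 3 and 105 for \<open>k\<close> = 1, 2, 4.\<close>

lemma linear_form_moments:
  assumes N: "is_mvnormal p S \<mu>" and P: "pos_definite p S"
  shows "integrable \<mu> (\<lambda>x. (\<Sum>i<p. a i * x i) ^ m)"
    and "(\<integral>x. (\<Sum>i<p. a i * x i) \<partial>\<mu>) = 0"
    and "(\<integral>x. (\<Sum>i<p. a i * x i) ^ (2 * k) \<partial>\<mu>) = fact (2 * k) / (2 ^ k * fact k) * quad_form p S a ^ k"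
proof -
  interpret prob_space \<mu> using N by (simp add: is_mvnormal_def)
  have "integrable \<mu> (\<lambda>x. (\<Sum>i<p. a i * x i) ^ m) \<and> (\<integral>x. (\<Sum>i<p. a i * x i) \<partial>\<mu>) = 0 \<and>
    (\<integral>x. (\<Sum>i<p. a i * x i) ^ (2 * k) \<partial>\<mu>) = fact (2 * k) / (2 ^ k * fact k) * quad_form p S a ^ k"
  proof (cases "\<exists>i<p. a i \<noteq> 0")
    case False
    then have [simp]: "(\<Sum>i<p. a i * x i) = 0" for x :: "nat \<Rightarrow> real" by (intro sum.neutral) auto
    have "quad_form p S a = 0" unfolding quad_form_def using False by (intro sum.neutral) auto
    then show ?thesis by (cases k) (auto simp: power_0_left prob_space)
  next
    case True
    define q where "q = quad_form p S a"
    have q: "q > 0" using P True by (auto simp: pos_definite_def q_def)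
    then have sq: "sqrt q > 0" by simp
    have D: "distributed \<mu> lborel (\<lambda>x. \<Sum>i<p. a i * x i) (normal_density 0 (sqrt q))"
      using N True by (auto simp: is_mvnormal_def q_def)
    have 1: "integrable \<mu> (\<lambda>x. (\<Sum>i<p. a i * x i) ^ m)"
      by (subst distributed_integrable[OF D, symmetric]) (use integrable_normal_moment[OF sq, of 0 m] in auto)
    have 2: "(\<integral>x. (\<Sum>i<p. a i * x i) \<partial>\<mu>) = 0"
      by (subst distributed_integral[OF D, symmetric]) (use integral_normal_moment_nz_1[OF sq, of 0] in auto)
    have 3: "(\<integral>x. (\<Sum>i<p. a i * x i) ^ (2 * k) \<partial>\<mu>) = fact (2 * k) / (2 ^ k * fact k) * q ^ k"
      by (subst distributed_integral[OF D, symmetric])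
        (use integral_normal_moment_even[OF sq, of 0 k] q in \<open>auto simp: field_simps power_divide\<close>)
    show ?thesis using 1 2 3 by (simp add: q_def)
  qed
  then show "integrable \<mu> (\<lambda>x. (\<Sum>i<p. a i * x i) ^ m)"
    and "(\<integral>x. (\<Sum>i<p. a i * x i) \<partial>\<mu>) = 0"
    and "(\<integral>x. (\<Sum>i<p. a i * x i) ^ (2 * k) \<partial>\<mu>) = fact (2 * k) / (2 ^ k * fact k) * quad_form p S a ^ k"
    by auto
qed

text \<open>The bound \<open>|f g|^m \<le> f^(2m) + g^(2m)\<close>. Asking for all powers instead of
  one makes the class of functions with all moments closed under products, so that no exponents have
  to be tracked later.\<close>

lemma integrable_mult_of_powers:
  fixes f g :: "'a \<Rightarrow> real"
  assumes [measurable]: "f \<in> borel_measurable M" "g \<in> borel_measurable M"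
    and "\<And>m. integrable M (\<lambda>x. f x ^ m)" "\<And>m. integrable M (\<lambda>x. g x ^ m)"
  shows "integrable M (\<lambda>x. (f x * g x) ^ m)"
proof (rule Bochner_Integration.integrable_bound)
  show "integrable M (\<lambda>x. f x ^ (2 * m) + g x ^ (2 * m))" using assms by auto
  have "\<bar>u * v\<bar> \<le> u ^ 2 + v ^ 2" for u v :: real
  proof -
    have "0 \<le> (\<bar>u\<bar> - \<bar>v\<bar>)^2" by simp
    then have "2 * (\<bar>u\<bar> * \<bar>v\<bar>) \<le> u\<^sup>2 + v\<^sup>2" unfolding power2_diff by simp
    moreover have "0 \<le> \<bar>u\<bar> * \<bar>v\<bar>" by simp
    ultimately show ?thesis unfolding abs_mult by linarith
  qed
  from this[of "f x ^ m" "g x ^ m" for x]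
  show "AE x in M. norm ((f x * g x) ^ m) \<le> norm (f x ^ (2 * m) + g x ^ (2 * m))"
    by (intro AE_I2) (auto simp: power_mult_distrib power_mult[symmetric] mult.commute intro: order_trans[OF _ abs_ge_self])
qed measurable

text \<open>Binomial expansion; the mixed products come from the product lemma applied to powers of
  \<open>f\<close> and \<open>g\<close>.\<close>

lemma integrable_add_of_powers:
  fixes f g :: "'a \<Rightarrow> real"
  assumes [measurable]: "f \<in> borel_measurable M" "g \<in> borel_measurable M"
    and "\<And>m. integrable M (\<lambda>x. f x ^ m)" "\<And>m. integrable M (\<lambda>x. g x ^ m)"
  shows "integrable M (\<lambda>x. (f x + g x) ^ m)"
proof -
  have 1: "integrable M (\<lambda>x. (f x ^ a * g x ^ b))" for a b
    using integrable_mult_of_powers[of "\<lambda>x. f x ^ a" M "\<lambda>x. g x ^ b" 1] assms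
    by (simp add: power_mult[symmetric])
  then have "integrable M (\<lambda>x. \<Sum>k\<le>m. of_nat (m choose k) * (f x ^ k * g x ^ (m - k)))" by auto
  then show ?thesis unfolding binomial_ring by (simp add: mult.assoc)
qed

text \<open>The mixed fourth moments come from those of the \<open>8\<close> linear forms \<open>x\<^sub>a \<plusminus> x\<^sub>b \<plusminus> x\<^sub>c \<plusminus> x\<^sub>d\<close> by
  polarization.\<close>

lemma mvnormal_moments:
  assumes N: "is_mvnormal p S \<mu>" and P: "pos_definite p S" and a: "a < p"
  shows "integrable \<mu> (\<lambda>x. x a ^ m)"
    and "(\<integral>x. x a \<partial>\<mu>) = 0"
    and "(\<integral>x. x a ^ 8 \<partial>\<mu>) = 105 * (S $$ (a, a)) ^ 4"
    and "b < p \<Longrightarrow> (\<integral>x. x a * x b \<partial>\<mu>) = S $$ (a, b)"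
    and "b < p \<Longrightarrow> c < p \<Longrightarrow> d < p \<Longrightarrow> (\<integral>x. x a * x b * (x c * x d) \<partial>\<mu>) =
      S $$ (a, b) * S $$ (c, d) + S $$ (a, c) * S $$ (b, d) + S $$ (a, d) * S $$ (b, c)"
proof -
  interpret prob_space \<mu> using N by (simp add: is_mvnormal_def)
  have sets: "sets \<mu> = sets (vec_space p)" using N by (simp add: is_mvnormal_def)
  have meas: "(\<lambda>x. x a) \<in> borel_measurable \<mu>" if "a < p" for a
    using that by (simp add: measurable_cong_sets[OF sets refl])
  have delta: "(\<Sum>i<p. of_bool (i = a) * x i) = x a" if "a < p" for x :: "nat \<Rightarrow> real" and a
    using that by (simp add: of_bool_def if_distrib[of "\<lambda>c. c * _"] cong: if_cong)
  have qd: "quad_form p S (\<lambda>i. of_bool (i = a)) = S $$ (a, a)" if "a < p" for a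
    using quad_form_two[of a p a S 1 0] that by simp
  have int: "integrable \<mu> (\<lambda>x. x a ^ m)" if "a < p" for a m
    using linear_form_moments(1)[OF N P, of "\<lambda>i. of_bool (i = a)" m] by (simp add: delta that)
  have var: "(\<integral>x. (x a)^2 \<partial>\<mu>) = S $$ (a, a)" if "a < p" for a
    using linear_form_moments(3)[OF N P, of "\<lambda>i. of_bool (i = a)" 1] by (simp add: delta qd that fact_numeral)
  show "integrable \<mu> (\<lambda>x. x a ^ m)" using int a by simp
  show "(\<integral>x. x a \<partial>\<mu>) = 0"
    using linear_form_moments(2)[OF N P, of "\<lambda>i. of_bool (i = a)"] by (simp add: delta a)
  show "(\<integral>x. x a ^ 8 \<partial>\<mu>) = 105 * (S $$ (a, a)) ^ 4"
    using linear_form_moments(3)[OF N P, of "\<lambda>i. of_bool (i = a)" 4] by (simp add: delta qd a fact_numeral)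
  have int2: "integrable \<mu> (\<lambda>x. x a * x b)" if "a < p" "b < p" for a b
    using integrable_mult_of_powers[where f = "\<lambda>x. x a" and g = "\<lambda>x. x b" and m = 1, OF meas meas int int] that
    by simp
  have cov: "(\<integral>x. x a * x b \<partial>\<mu>) = S $$ (a, b)" if ab: "a < p" "b < p" for a b
  proof -
    have "(\<Sum>i<p. (1 * of_bool (i = a) + 1 * of_bool (i = b)) * x i) = x a + x b" for x :: "nat \<Rightarrow> real"
      using delta[OF ab(1), of x] delta[OF ab(2), of x] by (simp add: algebra_simps sum.distrib)
    with linear_form_moments(3)[OF N P, of "\<lambda>i. 1 * of_bool (i = a) + 1 * of_bool (i = b)" 1]
    have "(\<integral>x. (x a + x b)^2 \<partial>\<mu>) = S $$ (a, a) + (S $$ (a, b) + S $$ (b, a)) + S $$ (b, b)"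
      using quad_form_two[OF ab, of S 1 1] by (simp add: fact_numeral)
    moreover have "(\<integral>x. (x a + x b)^2 \<partial>\<mu>) = (\<integral>x. (x a)^2 + (x b)^2 + 2 * (x a * x b) \<partial>\<mu>)"
      by (simp add: power2_sum mult.assoc)
    moreover have "\<dots> = S $$ (a, a) + S $$ (b, b) + 2 * (\<integral>x. x a * x b \<partial>\<mu>)"
      using int ab int2[OF ab] by (simp add: var)
    ultimately show ?thesis using pos_definite_sym[OF P ab] by simp
  qed
  then show "b < p \<Longrightarrow> (\<integral>x. x a * x b \<partial>\<mu>) = S $$ (a, b)" using a by simp
  assume bcd: "b < p" "c < p" "d < p"
  \<comment> \<open>The variance of the form is computed as its second moment, by bilinearity; the
    normal fourth moment is three times its square.\<close>
  have fourth: "(\<integral>x. (x a + r * x b + s * x c + t * x d) ^ 4 \<partial>\<mu>) =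
      3 * (S $$ (a, a) + r\<^sup>2 * S $$ (b, b) + s\<^sup>2 * S $$ (c, c) + t\<^sup>2 * S $$ (d, d)
        + 2 * (r * S $$ (a, b) + s * S $$ (a, c) + t * S $$ (a, d)
        + r * s * S $$ (b, c) + r * t * S $$ (b, d) + s * t * S $$ (c, d)))\<^sup>2" for r s t
  proof -
    define w where "w = (\<lambda>i. of_bool (i = a) + r * of_bool (i = b) + s * of_bool (i = c) + t * of_bool (i = d) :: real)"
    have w: "(\<Sum>i<p. w i * x i) = x a + r * x b + s * x c + t * x d" for x
      using delta[OF a, of x] delta[OF bcd(1), of x] delta[OF bcd(2), of x] delta[OF bcd(3), of x]
      by (simp add: w_def algebra_simps sum.distrib sum_distrib_left[symmetric])
    have "quad_form p S w = (\<integral>x. (x a + r * x b + s * x c + t * x d)^2 \<partial>\<mu>)"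
      using linear_form_moments(3)[OF N P, of w 1] by (simp add: fact_numeral w)
    also have "\<dots> = (\<integral>x. (x a)^2 + r\<^sup>2 * (x b)^2 + s\<^sup>2 * (x c)^2 + t\<^sup>2 * (x d)^2
        + 2 * (r * (x a * x b) + s * (x a * x c) + t * (x a * x d)
        + r * s * (x b * x c) + r * t * (x b * x d) + s * t * (x c * x d)) \<partial>\<mu>)"
      by (intro Bochner_Integration.integral_cong refl) (simp add: power2_eq_square algebra_simps)
    also have "\<dots> = S $$ (a, a) + r\<^sup>2 * S $$ (b, b) + s\<^sup>2 * S $$ (c, c) + t\<^sup>2 * S $$ (d, d)
        + 2 * (r * S $$ (a, b) + s * S $$ (a, c) + t * S $$ (a, d)
        + r * s * S $$ (b, c) + r * t * S $$ (b, d) + s * t * S $$ (c, d))"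
      using int int2 a bcd by (simp add: var cov)
    finally show ?thesis
      using linear_form_moments(3)[OF N P, of w 2] by (simp add: fact_numeral w)
  qed
  have int4: "integrable \<mu> (\<lambda>x. (x a + r * x b + s * x c + t * x d) ^ 4)" for r s t
  proof -
    have c: "integrable \<mu> (\<lambda>x. (r * x i) ^ m)" if "i < p" for i r m
      using int[OF that] by (simp add: power_mult_distrib)
    have "integrable \<mu> (\<lambda>x. (((1 * x a + r * x b) + s * x c) + t * x d) ^ 4)"
      using a bcd by (intro integrable_add_of_powers c borel_measurable_add borel_measurable_times
        borel_measurable_const meas)
    then show ?thesis by simp
  qed
  \<comment> \<open>The sign of each power is the product of its three coefficients, so every
    monomial except the product of all four coordinates cancels. That one has coefficient 24 in each
    fourth power, and 8 * 24 = 192.\<close>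
  have eq: "x a * x b * (x c * x d) = (1/192) *
    ((x a + 1 * x b + 1 * x c + 1 * x d) ^ 4 - (x a + 1 * x b + 1 * x c + (-1) * x d) ^ 4
    - (x a + 1 * x b + (-1) * x c + 1 * x d) ^ 4 + (x a + 1 * x b + (-1) * x c + (-1) * x d) ^ 4
    - (x a + (-1) * x b + 1 * x c + 1 * x d) ^ 4 + (x a + (-1) * x b + 1 * x c + (-1) * x d) ^ 4
    + (x a + (-1) * x b + (-1) * x c + 1 * x d) ^ 4 - (x a + (-1) * x b + (-1) * x c + (-1) * x d) ^ 4)" for x :: "nat \<Rightarrow> real"
    by (simp add: power4_eq_xxxx algebra_simps)
  show "(\<integral>x. x a * x b * (x c * x d) \<partial>\<mu>) =
      S $$ (a, b) * S $$ (c, d) + S $$ (a, c) * S $$ (b, d) + S $$ (a, d) * S $$ (b, c)"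
    unfolding eq using int4
    by (simp only: Bochner_Integration.integral_mult_right_zero Bochner_Integration.integral_diff
      Bochner_Integration.integral_add Bochner_Integration.integrable_diff Bochner_Integration.integrable_add fourth)
      (simp add: power2_eq_square algebra_simps)
qed

subsection \<open>Functions of independent vectors\<close>

lemma le_half_sum_squares: "x * y \<le> (x\<^sup>2 + y\<^sup>2) / 2" for x y :: real
  using sum_squares_bound[of x y] by simp

text \<open>Both samples form one family indexed by \<open>I\<close>. Only independence and moments
  of all orders are assumed here; the Gaussian moment formulas enter in a later extension.\<close>

locale independent_vectors = prob_space M for M :: "'a measure" +
  fixes I :: "'i set" and Z :: "'i \<Rightarrow> 'a \<Rightarrow> nat \<Rightarrow> real" and p :: nat
  assumes indep: "indep_vars (\<lambda>_. vec_space p) Z I"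
    and moments: "u \<in> I \<Longrightarrow> a < p \<Longrightarrow> integrable M (\<lambda>\<omega>. Z u \<omega> a ^ m)"
begin

text \<open>\<open>J\<close> records on which vectors \<open>f\<close> depends, which is what
  independence needs; integrability of all powers makes products of such functions integrable
  without further conditions. The factorisation through \<open>g\<close> is required on the space of
  \<open>M\<close> only.\<close>

definition rv :: "'i set \<Rightarrow> ('a \<Rightarrow> real) \<Rightarrow> bool" where
  "rv J f \<longleftrightarrow> J \<subseteq> I \<and>
     (\<exists>g \<in> borel_measurable (PiM J (\<lambda>_. vec_space p)). \<forall>\<omega>\<in>space M. f \<omega> = g (restrict (\<lambda>i. Z i \<omega>) J)) \<and>
     (\<forall>m. integrable M (\<lambda>\<omega>. f \<omega> ^ m))"

lemma rvE:
  assumes "rv J f"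
  obtains g where "g \<in> borel_measurable (PiM J (\<lambda>_. vec_space p))"
    "\<And>\<omega>. \<omega> \<in> space M \<Longrightarrow> f \<omega> = g (restrict (\<lambda>i. Z i \<omega>) J)"
  using assms unfolding rv_def by blast

section \<open>Closure properties of functions of a subfamily\<close>

lemma rv_powers: "rv J f \<Longrightarrow> integrable M (\<lambda>\<omega>. f \<omega> ^ m)"
  by (simp add: rv_def)

lemma rv_integrable: "rv J f \<Longrightarrow> integrable M f"
  using rv_powers[of J f 1] by simp

lemma rv_measurable: "rv J f \<Longrightarrow> f \<in> borel_measurable M"
  using rv_integrable by blast

lemma rv_const: "J \<subseteq> I \<Longrightarrow> rv J (\<lambda>\<omega>. c)"
  by (auto simp: rv_def intro!: bexI[of _ "\<lambda>_. c"])

lemma rv_coord: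
  assumes "u \<in> J" "J \<subseteq> I" "a < p" shows "rv J (\<lambda>\<omega>. Z u \<omega> a)"
proof -
  have "(\<lambda>x. x u a) \<in> borel_measurable (PiM J (\<lambda>_. vec_space p))"
    using assms by (intro measurable_compose[of "\<lambda>x. x u" _ "vec_space p" "\<lambda>y. y a"] measurable_component_singleton[of u J] measurable_component_singleton[of a "{..<p}"]) auto
  then show ?thesis using assms moments by (auto simp: rv_def intro!: bexI[of _ "\<lambda>x. x u a"])
qed

lemma rv_mono:
  assumes f: "rv J f" and JK: "J \<subseteq> K" "K \<subseteq> I" shows "rv K f"
proof -
  obtain g where g: "g \<in> borel_measurable (PiM J (\<lambda>_. vec_space p))"
    and fg: "\<And>\<omega>. \<omega> \<in> space M \<Longrightarrow> f \<omega> = g (restrict (\<lambda>i. Z i \<omega>) J)"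
    by (rule rvE[OF f]) blast
  have "(\<lambda>x. g (restrict x J)) \<in> borel_measurable (PiM K (\<lambda>_. vec_space p))"
    using measurable_compose[OF measurable_restrict_subset[OF JK(1)] g] .
  moreover have "restrict (restrict (\<lambda>i. Z i \<omega>) K) J = restrict (\<lambda>i. Z i \<omega>) J" for \<omega>
    using JK by (simp add: Int_absorb1)
  ultimately show ?thesis
    using f JK by (auto simp: rv_def fg intro!: bexI[of _ "\<lambda>x. g (restrict x J)"])
qed

lemma rv_mult:
  assumes f: "rv J f" and g: "rv J g" shows "rv J (\<lambda>\<omega>. f \<omega> * g \<omega>)"
proof -
  obtain f' where f': "f' \<in> borel_measurable (PiM J (\<lambda>_. vec_space p))"
    "\<And>\<omega>. \<omega> \<in> space M \<Longrightarrow> f \<omega> = f' (restrict (\<lambda>i. Z i \<omega>) J)"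
    by (rule rvE[OF f]) blast
  obtain g' where g': "g' \<in> borel_measurable (PiM J (\<lambda>_. vec_space p))"
    "\<And>\<omega>. \<omega> \<in> space M \<Longrightarrow> g \<omega> = g' (restrict (\<lambda>i. Z i \<omega>) J)"
    by (rule rvE[OF g]) blast
  have "integrable M (\<lambda>\<omega>. (f \<omega> * g \<omega>) ^ m)" for m
    by (rule integrable_mult_of_powers) (use f g in \<open>auto intro: rv_measurable rv_powers\<close>)
  then show ?thesis using f f' g' by (auto simp: rv_def intro!: bexI[of _ "\<lambda>x. f' x * g' x"])
qed

lemma rv_add:
  assumes f: "rv J f" and g: "rv J g" shows "rv J (\<lambda>\<omega>. f \<omega> + g \<omega>)"
proof -
  obtain f' where f': "f' \<in> borel_measurable (PiM J (\<lambda>_. vec_space p))"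
    "\<And>\<omega>. \<omega> \<in> space M \<Longrightarrow> f \<omega> = f' (restrict (\<lambda>i. Z i \<omega>) J)"
    by (rule rvE[OF f]) blast
  obtain g' where g': "g' \<in> borel_measurable (PiM J (\<lambda>_. vec_space p))"
    "\<And>\<omega>. \<omega> \<in> space M \<Longrightarrow> g \<omega> = g' (restrict (\<lambda>i. Z i \<omega>) J)"
    by (rule rvE[OF g]) blast
  have "integrable M (\<lambda>\<omega>. (f \<omega> + g \<omega>) ^ m)" for m
    by (rule integrable_add_of_powers) (use f g in \<open>auto intro: rv_measurable rv_powers\<close>)
  then show ?thesis using f f' g' by (auto simp: rv_def intro!: bexI[of _ "\<lambda>x. f' x + g' x"])
qed

lemma rv_cmult: "rv J f \<Longrightarrow> rv J (\<lambda>\<omega>. c * f \<omega>)"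
  using rv_mult[OF rv_const] rv_def by blast

lemma rv_diff:
  assumes "rv J f" "rv J g" shows "rv J (\<lambda>\<omega>. f \<omega> - g \<omega>)"
  using rv_add[OF assms(1) rv_cmult[OF assms(2), of "-1"]] by simp

lemma rv_power: "rv J f \<Longrightarrow> rv J (\<lambda>\<omega>. f \<omega> ^ m)"
proof (induction m)
  case 0 then show ?case using rv_const[of J 1] by (auto simp: rv_def)
next
  case (Suc m) then show ?case by (auto intro: rv_mult)
qed

lemma rv_sum:
  assumes "J \<subseteq> I" "\<And>t. t \<in> T \<Longrightarrow> rv J (f t)" shows "rv J (\<lambda>\<omega>. \<Sum>t\<in>T. f t \<omega>)"
proof (cases "finite T")
  case True
  then show ?thesis using assms
    by (induction T rule: finite_induct) (auto intro: rv_add rv_const)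
qed (use assms(1) in \<open>simp add: rv_const\<close>)

lemma rv_ip:
  assumes "J \<subseteq> I" "u \<in> J" "v \<in> J" shows "rv J (\<lambda>\<omega>. ip p (Z u \<omega>) (Z v \<omega>))"
  unfolding ip_def using assms by (intro rv_sum rv_mult rv_coord) auto

section \<open>Expectations of products over disjoint index sets\<close>

lemma expectation_mult:
  assumes f: "rv J f" and g: "rv K g" and "J \<inter> K = {}"
  shows "expectation (\<lambda>\<omega>. f \<omega> * g \<omega>) = expectation f * expectation g"
proof -
  obtain f' where f': "f' \<in> borel_measurable (PiM J (\<lambda>_. vec_space p))"
    "\<And>\<omega>. \<omega> \<in> space M \<Longrightarrow> f \<omega> = f' (restrict (\<lambda>i. Z i \<omega>) J)"
    by (rule rvE[OF f]) blast
  obtain g' where g': "g' \<in> borel_measurable (PiM K (\<lambda>_. vec_space p))"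
    "\<And>\<omega>. \<omega> \<in> space M \<Longrightarrow> g \<omega> = g' (restrict (\<lambda>i. Z i \<omega>) K)"
    by (rule rvE[OF g]) blast
  \<comment> \<open>\<open>f\<close> and \<open>g\<close> agree with their factorisations only on
    the space of \<open>M\<close>. Independence is shown for the compositions, and the integrals are
    then transferred back.\<close>
  let ?f = "f' \<circ> (\<lambda>\<omega>. restrict (\<lambda>i. Z i \<omega>) J)" and ?g = "g' \<circ> (\<lambda>\<omega>. restrict (\<lambda>i. Z i \<omega>) K)"
  have "J \<subseteq> I" "K \<subseteq> I" using f g by (simp_all add: rv_def)
  then have "indep_var borel ?f borel ?g"
    using indep_var_compose[OF indep_var_restrict[OF indep assms(3)] f'(1) g'(1)] by simp
  moreover have "integrable M ?f \<longleftrightarrow> integrable M f" "integrable M ?g \<longleftrightarrow> integrable M g"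
    using f'(2) g'(2) by (auto intro!: Bochner_Integration.integrable_cong)
  then have "integrable M ?f" "integrable M ?g"
    using rv_integrable[OF f] rv_integrable[OF g] by simp_all
  ultimately have "expectation (\<lambda>\<omega>. ?f \<omega> * ?g \<omega>) = expectation ?f * expectation ?g"
    by (intro indep_var_lebesgue_integral)
  moreover have "expectation (\<lambda>\<omega>. ?f \<omega> * ?g \<omega>) = expectation (\<lambda>\<omega>. f \<omega> * g \<omega>)"
    "expectation ?f = expectation f" "expectation ?g = expectation g"
    using f'(2) g'(2) by (auto intro!: Bochner_Integration.integral_cong)
  ultimately show ?thesis by simp
qed

text \<open>Independence of \<open>J\<close> and \<open>K\<close> separates each centred
  \<open>U a\<close> from everything that multiplies it. The correlations that have to vanish are
  brought to this form with \<open>J\<close> a single index that occurs only once in the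
  product.\<close>

lemma expectation_inner_zero:
  assumes "J \<inter> K = {}" "\<And>a. a \<in> A \<Longrightarrow> rv J (U a)" "\<And>a. a \<in> A \<Longrightarrow> expectation (U a) = 0"
    and "\<And>a. a \<in> A \<Longrightarrow> rv K (V a)" and "rv K G"
  shows "expectation (\<lambda>\<omega>. (\<Sum>a\<in>A. U a \<omega> * V a \<omega>) * G \<omega>) = 0"
proof -
  have JK: "J \<subseteq> I" "K \<subseteq> I" if "a \<in> A" for a using assms(2,4)[OF that] by (auto simp: rv_def)
  have "expectation (\<lambda>\<omega>. (\<Sum>a\<in>A. U a \<omega> * V a \<omega>) * G \<omega>) = expectation (\<lambda>\<omega>. (\<Sum>a\<in>A. U a \<omega> * (V a \<omega> * G \<omega>)))"
    by (simp add: sum_distrib_right mult.assoc)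
  also have "\<dots> = (\<Sum>a\<in>A. expectation (\<lambda>\<omega>. U a \<omega> * (V a \<omega> * G \<omega>)))"
  proof (rule Bochner_Integration.integral_sum)
    fix a assume a: "a \<in> A"
    show "integrable M (\<lambda>\<omega>. U a \<omega> * (V a \<omega> * G \<omega>))"
    proof -
      have "rv (J \<union> K) (U a)" "rv (J \<union> K) (V a)" "rv (J \<union> K) G"
        using rv_mono[OF assms(2)[OF a], of "J \<union> K"] rv_mono[OF assms(4)[OF a], of "J \<union> K"]
          rv_mono[OF assms(5), of "J \<union> K"] JK[OF a] by auto
      note this(1) rv_mult[OF this(2,3)]
      from rv_mult[OF this] show ?thesis by (rule rv_integrable)
    qed
  qed
  also have "\<dots> = 0"
  proof (intro sum.neutral ballI)
    fix a assume a: "a \<in> A"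
    show "expectation (\<lambda>\<omega>. U a \<omega> * (V a \<omega> * G \<omega>)) = 0"
      unfolding expectation_mult[OF assms(2)[OF a] rv_mult[OF assms(4)[OF a] assms(5)] assms(1)]
      by (simp add: assms(3)[OF a])
  qed
  finally show ?thesis .
qed

text \<open>The squared Frobenius norm of the matrix of second moments of the family
  \<open>U\<close>. It is not centred, so that constants may be taken for \<open>U\<close>
  too.\<close>

definition gram :: "'b set \<Rightarrow> ('b \<Rightarrow> 'a \<Rightarrow> real) \<Rightarrow> real" where
  "gram A U = (\<Sum>a\<in>A. \<Sum>b\<in>A. (expectation (\<lambda>\<omega>. U a \<omega> * U b \<omega>))\<^sup>2)"

text \<open>By independence the expectation is the entrywise inner product of the two second moment
  matrices, to which Cauchy-Schwarz applies. The Gram bounds are given as squares so that the result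
  contains no roots.\<close>

lemma second_moment_inner_le:
  assumes JK: "J \<inter> K = {}" and U: "\<And>a. a \<in> A \<Longrightarrow> rv J (U a)" and V: "\<And>a. a \<in> A \<Longrightarrow> rv K (V a)"
    and gU: "gram A U \<le> \<kappa>\<^sup>2" and gV: "gram A V \<le> l\<^sup>2" and nn: "0 \<le> \<kappa>" "0 \<le> l"
  shows "expectation (\<lambda>\<omega>. (\<Sum>a\<in>A. U a \<omega> * V a \<omega>)\<^sup>2) \<le> \<kappa> * l"
proof -
  have sub: "J \<union> K \<subseteq> I" if "a \<in> A" for a using U[OF that] V[OF that] by (auto simp: rv_def)
  let ?u = "\<lambda>(a, b). expectation (\<lambda>\<omega>. U a \<omega> * U b \<omega>)" and ?v = "\<lambda>(a, b). expectation (\<lambda>\<omega>. V a \<omega> * V b \<omega>)"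
  have "expectation (\<lambda>\<omega>. (\<Sum>a\<in>A. U a \<omega> * V a \<omega>)\<^sup>2) =
      expectation (\<lambda>\<omega>. \<Sum>a\<in>A. \<Sum>b\<in>A. (U a \<omega> * U b \<omega>) * (V a \<omega> * V b \<omega>))"
    by (simp add: power2_eq_square sum_product ac_simps)
  also have "\<dots> = (\<Sum>a\<in>A. \<Sum>b\<in>A. expectation (\<lambda>\<omega>. (U a \<omega> * U b \<omega>) * (V a \<omega> * V b \<omega>)))"
  proof -
    have "integrable M (\<lambda>\<omega>. (U a \<omega> * U b \<omega>) * (V a \<omega> * V b \<omega>))" if "a \<in> A" "b \<in> A" for a b
    proof -
      have "rv (J \<union> K) (U a)" "rv (J \<union> K) (U b)" "rv (J \<union> K) (V a)" "rv (J \<union> K) (V b)"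
        using rv_mono[OF U[OF that(1)], of "J \<union> K"] rv_mono[OF U[OF that(2)], of "J \<union> K"]
          rv_mono[OF V[OF that(1)], of "J \<union> K"] rv_mono[OF V[OF that(2)], of "J \<union> K"] sub[OF that(1)] by auto
      note rv_mult[OF this(1,2)] rv_mult[OF this(3,4)]
      from rv_mult[OF this] show ?thesis by (rule rv_integrable)
    qed
    then show ?thesis by (subst Bochner_Integration.integral_sum) auto
  qed
  also have "\<dots> = (\<Sum>a\<in>A. \<Sum>b\<in>A. ?u (a, b) * ?v (a, b))"
    unfolding prod.case
    by (intro sum.cong refl expectation_mult[where J = J and K = K] rv_mult U V JK)
  also have "\<dots> = (\<Sum>x\<in>A\<times>A. ?u x * ?v x)" by (simp add: sum.cartesian_product split_def)
  finally have eq: "expectation (\<lambda>\<omega>. (\<Sum>a\<in>A. U a \<omega> * V a \<omega>)\<^sup>2) = \<dots>" .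
  have "(\<Sum>x\<in>A\<times>A. ?u x * ?v x)\<^sup>2 \<le> (\<Sum>x\<in>A\<times>A. (?u x)\<^sup>2) * (\<Sum>x\<in>A\<times>A. (?v x)\<^sup>2)"
    by (rule Cauchy_Schwarz_ineq_sum)
  also have "\<dots> = gram A U * gram A V"
    by (simp add: gram_def sum.cartesian_product split_def)
  also have "\<dots> \<le> \<kappa>\<^sup>2 * l\<^sup>2"
    by (intro mult_mono gU gV) (auto simp: gram_def intro!: sum_nonneg)
  finally have "(\<Sum>x\<in>A\<times>A. ?u x * ?v x)\<^sup>2 \<le> (\<kappa> * l)\<^sup>2" by (simp add: power_mult_distrib)
  then show ?thesis unfolding eq by (rule power2_le_imp_le) (use nn in simp)
qed

text \<open>\<open>B t\<close> contains the indices \<open>t'\<close> for which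
  \<open>h t\<close> and \<open>h t'\<close> may be correlated.\<close>

lemma second_moment_sum_le:
  assumes T: "finite T" and h: "\<And>t. t \<in> T \<Longrightarrow> rv J (h t)"
    and V: "\<And>t. t \<in> T \<Longrightarrow> expectation (\<lambda>\<omega>. (h t \<omega>)\<^sup>2) \<le> V"
    and B: "\<And>t. t \<in> T \<Longrightarrow> finite (B t)" "\<And>t. t \<in> T \<Longrightarrow> real (card (B t)) \<le> N"
    and zero: "\<And>t t'. t \<in> T \<Longrightarrow> t' \<in> T \<Longrightarrow> t' \<notin> B t \<Longrightarrow> expectation (\<lambda>\<omega>. h t \<omega> * h t' \<omega>) = 0"
    and c: "real (card T) \<le> c" and N0: "0 \<le> N" and V0: "0 \<le> V"
  shows "expectation (\<lambda>\<omega>. (\<Sum>t\<in>T. h t \<omega>)\<^sup>2) \<le> c * N * V"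
proof -
  have int: "integrable M (\<lambda>\<omega>. h t \<omega> * h t' \<omega>)" if "t \<in> T" "t' \<in> T" for t t'
    using rv_integrable[OF rv_mult[OF h[OF that(1)] h[OF that(2)]]] .
  have "expectation (\<lambda>\<omega>. (\<Sum>t\<in>T. h t \<omega>)\<^sup>2) = expectation (\<lambda>\<omega>. \<Sum>t\<in>T. \<Sum>t'\<in>T. h t \<omega> * h t' \<omega>)"
    by (simp add: power2_eq_square sum_product)
  also have "\<dots> = (\<Sum>t\<in>T. \<Sum>t'\<in>T. expectation (\<lambda>\<omega>. h t \<omega> * h t' \<omega>))"
    using int by (subst Bochner_Integration.integral_sum) auto
  also have "\<dots> \<le> (\<Sum>t\<in>T. N * V)"
  proof (rule sum_mono)
    fix t assume t: "t \<in> T"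
    have "(\<Sum>t'\<in>T. expectation (\<lambda>\<omega>. h t \<omega> * h t' \<omega>)) = (\<Sum>t'\<in>T \<inter> B t. expectation (\<lambda>\<omega>. h t \<omega> * h t' \<omega>))"
      using T zero t by (intro sum.mono_neutral_right) auto
    also have "\<dots> \<le> (\<Sum>t'\<in>T \<inter> B t. V)"
    proof (rule sum_mono)
      fix t' assume t': "t' \<in> T \<inter> B t"
      have i: "integrable M (\<lambda>\<omega>. (h s \<omega>)\<^sup>2)" if "s \<in> T" for s using rv_powers[OF h[OF that]] .
      have "expectation (\<lambda>\<omega>. h t \<omega> * h t' \<omega>) \<le> expectation (\<lambda>\<omega>. ((h t \<omega>)\<^sup>2 + (h t' \<omega>)\<^sup>2) / 2)"
        using t t' i int by (intro integral_mono le_half_sum_squares) auto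
      also have "\<dots> = (expectation (\<lambda>\<omega>. (h t \<omega>)\<^sup>2) + expectation (\<lambda>\<omega>. (h t' \<omega>)\<^sup>2)) / 2"
        using t t' i by simp
      also have "\<dots> \<le> V" using V[OF t] V[of t'] t' by auto
      finally show "expectation (\<lambda>\<omega>. h t \<omega> * h t' \<omega>) \<le> V" .
    qed
    also have "\<dots> = real (card (T \<inter> B t)) * V" by simp
    also have "\<dots> \<le> N * V"
      using card_mono[of "B t" "T \<inter> B t"] B[OF t] V0 by (intro mult_right_mono) auto
    finally show "(\<Sum>t'\<in>T. expectation (\<lambda>\<omega>. h t \<omega> * h t' \<omega>)) \<le> N * V" .
  qed
  also have "\<dots> = real (card T) * (N * V)" by simp
  also have "\<dots> \<le> c * (N * V)" using c V0 N0 by (intro mult_right_mono) auto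
  finally show ?thesis by (simp add: mult.assoc)
qed

lemma markov:
  assumes f: "rv J f" and nn: "\<And>\<omega>. 0 \<le> f \<omega>" and E: "expectation f \<le> e" and c: "0 < c"
  shows "prob {\<omega> \<in> space M. c < f \<omega>} \<le> e / c"
proof -
  have [measurable]: "f \<in> borel_measurable M" using f by (rule rv_measurable)
  have "prob {\<omega> \<in> space M. c < f \<omega>} \<le> prob {\<omega> \<in> space M. c \<le> f \<omega>}"
    by (intro finite_measure_mono) auto
  moreover have "prob {\<omega> \<in> space M. c \<le> f \<omega>} \<le> expectation f / c"
    using rv_integrable[OF f] nn c by (intro integral_Markov_inequality_measure[of _ _ "space M"]) auto
  moreover have "expectation f / c \<le> e / c" using E c by (simp add: divide_right_mono)
  ultimately show ?thesis by linarith
qed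

end

subsection \<open>Second moments of degenerate sums\<close>

definition frob_sq :: "nat \<Rightarrow> (nat \<Rightarrow> nat \<Rightarrow> real) \<Rightarrow> real" where
  "frob_sq p s = (\<Sum>(a, b)\<in>{..<p} \<times> {..<p}. (s a b)\<^sup>2)"

lemma frob_sq_nonneg: "0 \<le> frob_sq p s"
  by (auto simp: frob_sq_def intro!: sum_nonneg)

lemma sum_pairs_mult:
  "(\<Sum>x\<in>{..<p} \<times> {..<p}. \<Sum>y\<in>{..<p} \<times> {..<p}. (s (fst x) (snd x) * s (fst y) (snd y))\<^sup>2) = (frob_sq p s)\<^sup>2"
  by (simp add: frob_sq_def power2_eq_square sum_product split_def ac_simps)

text \<open>The three terms of the Gaussian fourth moment formula are one tensor
  \<open>s \<otimes> s\<close> with its four indices permuted, hence they have equal sums of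
  squares.\<close>

lemma sum_pairs_swap:
  fixes s :: "nat \<Rightarrow> nat \<Rightarrow> real"
  shows "(\<Sum>x\<in>{..<p} \<times> {..<p}. \<Sum>y\<in>{..<p} \<times> {..<p}. (s (fst x) (fst y) * s (snd x) (snd y))\<^sup>2) = (frob_sq p s)\<^sup>2"
    and "(\<Sum>x\<in>{..<p} \<times> {..<p}. \<Sum>y\<in>{..<p} \<times> {..<p}. (s (fst x) (snd y) * s (snd x) (fst y))\<^sup>2) = (frob_sq p s)\<^sup>2"
proof -
  show "(\<Sum>x\<in>{..<p} \<times> {..<p}. \<Sum>y\<in>{..<p} \<times> {..<p}. (s (fst x) (fst y) * s (snd x) (snd y))\<^sup>2) = (frob_sq p s)\<^sup>2"
    unfolding sum_pairs_mult[symmetric] sum.cartesian_product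
    by (rule sum.reindex_bij_witness[where i = "\<lambda>(x, y). ((fst x, fst y), (snd x, snd y))"
      and j = "\<lambda>(x, y). ((fst x, fst y), (snd x, snd y))"]) auto
  show "(\<Sum>x\<in>{..<p} \<times> {..<p}. \<Sum>y\<in>{..<p} \<times> {..<p}. (s (fst x) (snd y) * s (snd x) (fst y))\<^sup>2) = (frob_sq p s)\<^sup>2"
    unfolding sum_pairs_mult[symmetric] sum.cartesian_product
    by (rule sum.reindex_bij_witness[where i = "\<lambda>(x, y). ((fst x, fst y), (snd y, snd x))"
      and j = "\<lambda>(x, y). ((fst x, snd y), (snd x, fst y))"]) auto
qed

lemma ip_commute: "ip p x y = ip p y x"
  by (simp add: ip_def mult.commute)

text \<open>\<open>S\<close> depends on the index of the vector, so one family can hold both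
  covariance matrices. The moments recorded are those the estimates use: orders one, two and four,
  the last by the Wick formula, and order eight for single coordinates.\<close>

locale gaussian_vectors = independent_vectors M I Z p
  for M :: "'a measure" and I :: "'i set" and Z :: "'i \<Rightarrow> 'a \<Rightarrow> nat \<Rightarrow> real" and p :: nat +
  fixes S :: "'i \<Rightarrow> nat \<Rightarrow> nat \<Rightarrow> real"
  assumes mean: "u \<in> I \<Longrightarrow> a < p \<Longrightarrow> expectation (\<lambda>\<omega>. Z u \<omega> a) = 0"
    and cov: "u \<in> I \<Longrightarrow> a < p \<Longrightarrow> b < p \<Longrightarrow> expectation (\<lambda>\<omega>. Z u \<omega> a * Z u \<omega> b) = S u a b"
    and fourth: "u \<in> I \<Longrightarrow> a < p \<Longrightarrow> b < p \<Longrightarrow> c < p \<Longrightarrow> d < p \<Longrightarrow>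
      expectation (\<lambda>\<omega>. Z u \<omega> a * Z u \<omega> b * (Z u \<omega> c * Z u \<omega> d)) =
        S u a b * S u c d + S u a c * S u b d + S u a d * S u b c"
    and eighth: "u \<in> I \<Longrightarrow> a < p \<Longrightarrow> expectation (\<lambda>\<omega>. Z u \<omega> a ^ 8) = 105 * S u a a ^ 4"
begin

abbreviation pairs :: "(nat \<times> nat) set" where "pairs \<equiv> {..<p} \<times> {..<p}"

definition W :: "'i \<Rightarrow> nat \<times> nat \<Rightarrow> 'a \<Rightarrow> real" where
  "W u x \<omega> = Z u \<omega> (fst x) * Z u \<omega> (snd x)"

text \<open>One definition serves the centred matrices of both samples, since both belong to the
  same family. Matrix entries are addressed by pairs.\<close>

definition E :: "'i \<Rightarrow> nat \<times> nat \<Rightarrow> 'a \<Rightarrow> real" where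
  "E u x \<omega> = W u x \<omega> - S u (fst x) (snd x)"

section \<open>Second moments of the matrices \<open>W\<close> and \<open>E\<close>\<close>

lemma rv_W: "u \<in> J \<Longrightarrow> J \<subseteq> I \<Longrightarrow> x \<in> pairs \<Longrightarrow> rv J (W u x)"
  unfolding W_def by (intro rv_mult rv_coord) auto

lemma rv_E: "u \<in> J \<Longrightarrow> J \<subseteq> I \<Longrightarrow> x \<in> pairs \<Longrightarrow> rv J (E u x)"
  unfolding E_def using rv_diff[OF rv_W rv_const] by blast

lemma mean_W:
  assumes "u \<in> I" "x \<in> pairs" shows "expectation (W u x) = S u (fst x) (snd x)"
  unfolding W_def[abs_def] using cov[of u "fst x" "snd x"] assms by auto

lemma mean_E:
  assumes "u \<in> I" "x \<in> pairs" shows "expectation (E u x) = 0"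
proof -
  have "integrable M (W u x)" using rv_W[of u I x] assms by (auto intro: rv_integrable)
  then show ?thesis unfolding E_def[abs_def] using mean_W[OF assms] by (simp add: prob_space)
qed

lemma expectation_WW:
  assumes "u \<in> I" "x \<in> pairs" "y \<in> pairs"
  shows "expectation (\<lambda>\<omega>. W u x \<omega> * W u y \<omega>) = S u (fst x) (snd x) * S u (fst y) (snd y)
    + S u (fst x) (fst y) * S u (snd x) (snd y) + S u (fst x) (snd y) * S u (snd x) (fst y)"
  using assms fourth[of u "fst x" "snd x" "fst y" "snd y"] by (auto simp: W_def)

text \<open>Centring removes the Wick pairing inside \<open>x\<close> and inside \<open>y\<close>;
  the two crossing pairings remain.\<close>

lemma expectation_EE:
  assumes u: "u \<in> I" and x: "x \<in> pairs" and y: "y \<in> pairs"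
  shows "expectation (\<lambda>\<omega>. E u x \<omega> * E u y \<omega>) =
    S u (fst x) (fst y) * S u (snd x) (snd y) + S u (fst x) (snd y) * S u (snd x) (fst y)"
proof -
  let ?s = "\<lambda>x. S u (fst x) (snd x)"
  have i: "integrable M (W u z)" if "z \<in> pairs" for z
    using rv_W[of u I z] u that by (auto intro: rv_integrable)
  note e = mean_W[OF u]
  have i2: "integrable M (\<lambda>\<omega>. W u x \<omega> * W u y \<omega>)"
    using rv_integrable[OF rv_mult[OF rv_W[of u I x] rv_W[of u I y]]] u x y by auto
  have "expectation (\<lambda>\<omega>. E u x \<omega> * E u y \<omega>) =
      expectation (\<lambda>\<omega>. W u x \<omega> * W u y \<omega> - ?s y * W u x \<omega> - ?s x * W u y \<omega> + ?s x * ?s y)"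
    by (simp add: E_def algebra_simps)
  also have "\<dots> = expectation (\<lambda>\<omega>. W u x \<omega> * W u y \<omega>) - ?s y * ?s x - ?s x * ?s y + ?s x * ?s y"
    using i[OF x] i[OF y] i2 e[OF x] e[OF y] by (simp add: prob_space)
  finally show ?thesis using expectation_WW[OF u x y] by simp
qed

text \<open>Each of the three pairings contributes \<open>(frob_sq p (S u))^2\<close> with weight 3,
  which makes 9. With two pairings for \<open>E\<close> the same argument gives 4.\<close>

lemma gram_W: assumes "u \<in> I" shows "gram pairs (W u) \<le> (3 * frob_sq p (S u))\<^sup>2"
proof -
  let ?s = "S u"
  have sq: "(a + b + c)\<^sup>2 \<le> 3 * (a\<^sup>2 + b\<^sup>2 + c\<^sup>2)" for a b c :: real
    using sum_squares_bound[of a b] sum_squares_bound[of a c] sum_squares_bound[of b c]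
    by (simp add: power2_eq_square algebra_simps)
  have "gram pairs (W u) \<le> (\<Sum>x\<in>pairs. \<Sum>y\<in>pairs. 3 * ((?s (fst x) (snd x) * ?s (fst y) (snd y))\<^sup>2
    + (?s (fst x) (fst y) * ?s (snd x) (snd y))\<^sup>2 + (?s (fst x) (snd y) * ?s (snd x) (fst y))\<^sup>2))"
    unfolding gram_def
  proof (intro sum_mono)
    fix x y assume "x \<in> pairs" "y \<in> pairs"
    then show "(expectation (\<lambda>\<omega>. W u x \<omega> * W u y \<omega>))\<^sup>2 \<le> 3 * ((?s (fst x) (snd x) * ?s (fst y) (snd y))\<^sup>2
      + (?s (fst x) (fst y) * ?s (snd x) (snd y))\<^sup>2 + (?s (fst x) (snd y) * ?s (snd x) (fst y))\<^sup>2)"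
      unfolding expectation_WW[OF assms \<open>x \<in> pairs\<close> \<open>y \<in> pairs\<close>] by (intro sq)
  qed
  also have "\<dots> = 3 * ((frob_sq p ?s)\<^sup>2 + (frob_sq p ?s)\<^sup>2 + (frob_sq p ?s)\<^sup>2)"
    unfolding sum_distrib_left[symmetric] sum.distrib sum_pairs_mult sum_pairs_swap ..
  finally show ?thesis by (simp add: power_mult_distrib)
qed

lemma gram_E: assumes "u \<in> I" shows "gram pairs (E u) \<le> (2 * frob_sq p (S u))\<^sup>2"
proof -
  let ?s = "S u"
  have sq: "(a + b)\<^sup>2 \<le> 2 * (a\<^sup>2 + b\<^sup>2)" for a b :: real
    using sum_squares_bound[of a b] by (simp add: power2_eq_square algebra_simps)
  have "gram pairs (E u) \<le> (\<Sum>x\<in>pairs. \<Sum>y\<in>pairs. 2 * (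
    (?s (fst x) (fst y) * ?s (snd x) (snd y))\<^sup>2 + (?s (fst x) (snd y) * ?s (snd x) (fst y))\<^sup>2))"
    unfolding gram_def
  proof (intro sum_mono)
    fix x y assume "x \<in> pairs" "y \<in> pairs"
    then show "(expectation (\<lambda>\<omega>. E u x \<omega> * E u y \<omega>))\<^sup>2 \<le> 2 * (
      (?s (fst x) (fst y) * ?s (snd x) (snd y))\<^sup>2 + (?s (fst x) (snd y) * ?s (snd x) (fst y))\<^sup>2)"
      unfolding expectation_EE[OF assms \<open>x \<in> pairs\<close> \<open>y \<in> pairs\<close>] by (intro sq)
  qed
  also have "\<dots> = 2 * ((frob_sq p ?s)\<^sup>2 + (frob_sq p ?s)\<^sup>2)"
    unfolding sum_distrib_left[symmetric] sum.distrib sum_pairs_swap ..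
  finally show ?thesis by (simp add: power_mult_distrib)
qed

text \<open>A deterministic matrix regarded as a constant family, so that the inner product bound
  also covers the terms linear in \<open>E\<close>, with an empty index set.\<close>

lemma gram_const: "gram pairs (\<lambda>x \<omega>. D (fst x) (snd x)) = (frob_sq p D)\<^sup>2"
  unfolding gram_def using sum_pairs_mult[where s = D and p = p] by (simp add: prob_space)

lemma ip_sq: "(ip p (Z u \<omega>) (Z v \<omega>))\<^sup>2 = (\<Sum>x\<in>pairs. W u x \<omega> * W v x \<omega>)"
  by (simp add: ip_def power2_eq_square sum_product sum.cartesian_product split_def W_def ac_simps)

text \<open>The square \<open>(x'y)^2\<close> is the inner product of \<open>xx'\<close> and
  \<open>yy'\<close>, so its second moment falls under the bound for independent matrices; each
  matrix brings a factor 3 from its Gram bound.\<close>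

lemma ip_fourth_moment:
  assumes "u \<in> I" "v \<in> I" "u \<noteq> v"
  shows "expectation (\<lambda>\<omega>. ((ip p (Z u \<omega>) (Z v \<omega>))\<^sup>2)\<^sup>2) \<le> 9 * (frob_sq p (S u) * frob_sq p (S v))"
proof -
  have "expectation (\<lambda>\<omega>. (\<Sum>x\<in>pairs. W u x \<omega> * W v x \<omega>)\<^sup>2) \<le> (3 * frob_sq p (S u)) * (3 * frob_sq p (S v))"
    using assms
    by (intro second_moment_inner_le[where J = "{u}" and K = "{v}"] gram_W rv_W) (auto simp: frob_sq_nonneg)
  then show ?thesis by (simp add: ip_sq)
qed

lemma second_moment_EE:
  assumes "u \<in> I" "v \<in> I" "u \<noteq> v"
  shows "expectation (\<lambda>\<omega>. (\<Sum>x\<in>pairs. E u x \<omega> * E v x \<omega>)\<^sup>2) \<le> 4 * (frob_sq p (S u) * frob_sq p (S v))"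
proof -
  have "expectation (\<lambda>\<omega>. (\<Sum>x\<in>pairs. E u x \<omega> * E v x \<omega>)\<^sup>2) \<le> (2 * frob_sq p (S u)) * (2 * frob_sq p (S v))"
    using assms
    by (intro second_moment_inner_le[where J = "{u}" and K = "{v}"] gram_E rv_E) (auto simp: frob_sq_nonneg)
  then show ?thesis by simp
qed

lemma second_moment_ED:
  assumes "u \<in> I"
  shows "expectation (\<lambda>\<omega>. (\<Sum>x\<in>pairs. E u x \<omega> * D (fst x) (snd x))\<^sup>2) \<le> 2 * (frob_sq p (S u) * frob_sq p D)"
proof -
  have "expectation (\<lambda>\<omega>. (\<Sum>x\<in>pairs. E u x \<omega> * D (fst x) (snd x))\<^sup>2) \<le> (2 * frob_sq p (S u)) * frob_sq p D"
    using assms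
    by (intro second_moment_inner_le[where J = "{u}" and K = "{}" and V = "\<lambda>x \<omega>. D (fst x) (snd x)"] gram_E rv_E rv_const)
      (auto simp: frob_sq_nonneg gram_const)
  then show ?thesis by simp
qed

text \<open>The two inner products may share vectors, as in the triple sums, so they are separated
  by \<open>f g \<le> (f^2 + g^2) / 2\<close> and not by independence.\<close>

lemma second_moment_ip_ip:
  assumes "u \<in> I" "v \<in> I" "u \<noteq> v" "w \<in> I" "z \<in> I" "w \<noteq> z"
    and c: "frob_sq p (S u) * frob_sq p (S v) \<le> c" "frob_sq p (S w) * frob_sq p (S z) \<le> c"
  shows "expectation (\<lambda>\<omega>. (ip p (Z u \<omega>) (Z v \<omega>) * ip p (Z w \<omega>) (Z z \<omega>))\<^sup>2) \<le> 9 * c"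
proof -
  let ?f = "\<lambda>\<omega>. (ip p (Z u \<omega>) (Z v \<omega>))\<^sup>2" and ?g = "\<lambda>\<omega>. (ip p (Z w \<omega>) (Z z \<omega>))\<^sup>2"
  have f: "rv I ?f" and g: "rv I ?g" using assms by (auto intro!: rv_power rv_ip)
  note i = rv_integrable[OF rv_mult[OF f g]] rv_integrable[OF rv_power[OF f, of 2]] rv_integrable[OF rv_power[OF g, of 2]]
  have "expectation (\<lambda>\<omega>. ?f \<omega> * ?g \<omega>) \<le> expectation (\<lambda>\<omega>. ((?f \<omega>)\<^sup>2 + (?g \<omega>)\<^sup>2) / 2)"
    by (rule integral_mono[OF i(1) _ le_half_sum_squares]) (use i(2,3) in simp)
  also have "\<dots> = (expectation (\<lambda>\<omega>. (?f \<omega>)\<^sup>2) + expectation (\<lambda>\<omega>. (?g \<omega>)\<^sup>2)) / 2"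
    using i(2,3) by simp
  also have "\<dots> \<le> 9 * c"
    using ip_fourth_moment[OF assms(1-3)] ip_fourth_moment[OF assms(4-6)] c by argo
  finally show ?thesis by (simp add: power_mult_distrib)
qed

section \<open>Products that vanish because an index occurs once\<close>

lemma ip_zero:
  assumes "x \<in> I" "x \<notin> K" "y \<in> K" "rv K G"
  shows "expectation (\<lambda>\<omega>. ip p (Z x \<omega>) (Z y \<omega>) * G \<omega>) = 0"
proof -
  have "K \<subseteq> I" using assms(4) by (simp add: rv_def)
  with assms show ?thesis unfolding ip_def
    by (intro expectation_inner_zero[where J = "{x}" and K = K] rv_coord) (auto simp: mean)
qed

text \<open>The vector with index \<open>x\<close> occurs once in a product of four inner products
  and has mean zero. The four claims are the four places in the second pair of factors where
  \<open>x\<close> may stand.\<close>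

lemma quartic_zero:
  assumes "x \<in> I" "{a, b, c, d, y, w, z} \<subseteq> I - {x}"
  shows "expectation (\<lambda>\<omega>. (ip p (Z a \<omega>) (Z b \<omega>) * ip p (Z c \<omega>) (Z d \<omega>)) * (ip p (Z x \<omega>) (Z y \<omega>) * ip p (Z w \<omega>) (Z z \<omega>))) = 0"
    and "expectation (\<lambda>\<omega>. (ip p (Z a \<omega>) (Z b \<omega>) * ip p (Z c \<omega>) (Z d \<omega>)) * (ip p (Z y \<omega>) (Z x \<omega>) * ip p (Z w \<omega>) (Z z \<omega>))) = 0"
    and "expectation (\<lambda>\<omega>. (ip p (Z a \<omega>) (Z b \<omega>) * ip p (Z c \<omega>) (Z d \<omega>)) * (ip p (Z w \<omega>) (Z z \<omega>) * ip p (Z x \<omega>) (Z y \<omega>))) = 0"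
    and "expectation (\<lambda>\<omega>. (ip p (Z a \<omega>) (Z b \<omega>) * ip p (Z c \<omega>) (Z d \<omega>)) * (ip p (Z w \<omega>) (Z z \<omega>) * ip p (Z y \<omega>) (Z x \<omega>))) = 0"
proof -
  have "rv (I - {x}) (\<lambda>\<omega>. ip p (Z a \<omega>) (Z b \<omega>) * ip p (Z c \<omega>) (Z d \<omega>) * ip p (Z w \<omega>) (Z z \<omega>))"
    using assms by (intro rv_mult rv_ip) auto
  from ip_zero[OF assms(1) _ _ this, of y] assms(2)
  have *: "expectation (\<lambda>\<omega>. ip p (Z x \<omega>) (Z y \<omega>) * (ip p (Z a \<omega>) (Z b \<omega>) * ip p (Z c \<omega>) (Z d \<omega>) * ip p (Z w \<omega>) (Z z \<omega>))) = 0"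
    by auto
  show "expectation (\<lambda>\<omega>. (ip p (Z a \<omega>) (Z b \<omega>) * ip p (Z c \<omega>) (Z d \<omega>)) * (ip p (Z x \<omega>) (Z y \<omega>) * ip p (Z w \<omega>) (Z z \<omega>))) = 0"
    using * by (simp add: ac_simps)
  then show "expectation (\<lambda>\<omega>. (ip p (Z a \<omega>) (Z b \<omega>) * ip p (Z c \<omega>) (Z d \<omega>)) * (ip p (Z y \<omega>) (Z x \<omega>) * ip p (Z w \<omega>) (Z z \<omega>))) = 0"
    by (simp add: ip_commute[of p "Z y _"])
  show "expectation (\<lambda>\<omega>. (ip p (Z a \<omega>) (Z b \<omega>) * ip p (Z c \<omega>) (Z d \<omega>)) * (ip p (Z w \<omega>) (Z z \<omega>) * ip p (Z x \<omega>) (Z y \<omega>))) = 0"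
    using * by (simp add: ac_simps)
  then show "expectation (\<lambda>\<omega>. (ip p (Z a \<omega>) (Z b \<omega>) * ip p (Z c \<omega>) (Z d \<omega>)) * (ip p (Z w \<omega>) (Z z \<omega>) * ip p (Z y \<omega>) (Z x \<omega>))) = 0"
    by (simp add: ip_commute[of p "Z y _"])
qed


text \<open>The map \<open>e\<close> embeds one sample into the family; with \<open>Inl\<close> and
  \<open>Inr\<close> the same lemmas serve both samples, in either order.\<close>

definition sample :: "(nat \<Rightarrow> 'i) \<Rightarrow> nat \<Rightarrow> (nat \<Rightarrow> nat \<Rightarrow> real) \<Rightarrow> bool" where
  "sample e n s \<longleftrightarrow> inj_on e {..<n} \<and> e ` {..<n} \<subseteq> I \<and> (\<forall>u<n. S (e u) = s)"

lemma sample_in: "sample e n s \<Longrightarrow> u < n \<Longrightarrow> e u \<in> I"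
  by (auto simp: sample_def)

lemma sample_S: "sample e n s \<Longrightarrow> u < n \<Longrightarrow> S (e u) = s"
  by (auto simp: sample_def)

lemma sample_neq: "sample e n s \<Longrightarrow> u < n \<Longrightarrow> v < n \<Longrightarrow> e u = e v \<longleftrightarrow> u = v"
  by (auto simp: sample_def inj_on_def)

lemma second_moment_sum_ED:
  assumes e: "sample e n s"
  shows "expectation (\<lambda>\<omega>. (\<Sum>u<n. \<Sum>x\<in>pairs. E (e u) x \<omega> * D (fst x) (snd x))\<^sup>2)
    \<le> real n * 1 * (2 * (frob_sq p s * frob_sq p D))"
proof (rule second_moment_sum_le[where J = I and B = "\<lambda>u. {u}"])
  fix u assume "u \<in> {..<n}"
  then show "rv I (\<lambda>\<omega>. \<Sum>x\<in>pairs. E (e u) x \<omega> * D (fst x) (snd x))"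
    using sample_in[OF e] by (intro rv_sum rv_mult rv_E rv_const) auto
  show "expectation (\<lambda>\<omega>. (\<Sum>x\<in>pairs. E (e u) x \<omega> * D (fst x) (snd x))\<^sup>2) \<le> 2 * (frob_sq p s * frob_sq p D)"
    using second_moment_ED[of "e u" D] sample_in[OF e] sample_S[OF e] \<open>u \<in> _\<close> by simp
  fix v assume "v \<in> {..<n}" "v \<notin> {u}"
  then show "expectation (\<lambda>\<omega>. (\<Sum>x\<in>pairs. E (e u) x \<omega> * D (fst x) (snd x)) * (\<Sum>x\<in>pairs. E (e v) x \<omega> * D (fst x) (snd x))) = 0"
    using \<open>u \<in> _\<close> sample_in[OF e] sample_neq[OF e, of u v]
    by (intro expectation_inner_zero[where J = "{e u}" and K = "{e v}"] rv_E rv_sum rv_mult rv_const mean_E) auto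
qed (auto simp: frob_sq_nonneg)

text \<open>An index outside \<open>{u, v}\<close> in the second pair occurs once and makes the
  expectation vanish, so at most the 4 pairs over \<open>{u, v}\<close> are correlated with
  \<open>(u, v)\<close>.\<close>

lemma second_moment_sum_EE:
  assumes e: "sample e n s"
  shows "expectation (\<lambda>\<omega>. (\<Sum>(u, v) | u < n \<and> v < n \<and> u \<noteq> v. \<Sum>x\<in>pairs. E (e u) x \<omega> * E (e v) x \<omega>)\<^sup>2)
    \<le> (real n * real n) * 4 * (4 * (frob_sq p s * frob_sq p s))"
proof (rule second_moment_sum_le[where J = I and B = "\<lambda>(u, v). {u, v} \<times> {u, v}"])
  let ?T = "{(u, v). u < n \<and> v < n \<and> u \<noteq> v}"
  have sub: "?T \<subseteq> {..<n} \<times> {..<n}" by auto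
  then show "finite ?T" by (rule finite_subset) simp
  show "real (card ?T) \<le> real n * real n"
    using card_mono[OF _ sub] by (simp flip: of_nat_mult)
  fix t assume "t \<in> ?T"
  then obtain u v where t: "t = (u, v)" and uv: "u < n" "v < n" "u \<noteq> v" by auto
  note I = sample_in[OF e] and neq = sample_neq[OF e]
  show "rv I (\<lambda>\<omega>. case t of (u, v) \<Rightarrow> \<Sum>x\<in>pairs. E (e u) x \<omega> * E (e v) x \<omega>)"
    unfolding t prod.case using uv I by (intro rv_sum rv_mult rv_E) auto
  show "expectation (\<lambda>\<omega>. (case t of (u, v) \<Rightarrow> \<Sum>x\<in>pairs. E (e u) x \<omega> * E (e v) x \<omega>)\<^sup>2) \<le> 4 * (frob_sq p s * frob_sq p s)"
    unfolding t prod.case using second_moment_EE[of "e u" "e v"] uv I neq[of u v] sample_S[OF e] by simp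
  show "finite (case t of (u, v) \<Rightarrow> {u, v} \<times> {u, v})" by (simp add: t)
  show "real (card (case t of (u, v) \<Rightarrow> {u, v} \<times> {u, v})) \<le> 4"
    using uv by (simp add: t card_cartesian_product)
  fix t' assume T': "t' \<in> ?T" and nB: "t' \<notin> (case t of (u, v) \<Rightarrow> {u, v} \<times> {u, v})"
  from T' obtain u' v' where t': "t' = (u', v')" and uv': "u' < n" "v' < n" "u' \<noteq> v'" by auto
  have *: "expectation (\<lambda>\<omega>. (\<Sum>x\<in>pairs. E (e a) x \<omega> * E (e b) x \<omega>) * (\<Sum>x\<in>pairs. E (e u) x \<omega> * E (e v) x \<omega>)) = 0"
    if "a \<noteq> u" "a \<noteq> v" "a \<noteq> b" "a < n" "b < n" for a b
    using that uv I neq[of a u] neq[of a v] neq[of a b]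
    by (intro expectation_inner_zero[where J = "{e a}" and K = "{e u, e v, e b}"] rv_E rv_sum rv_mult mean_E) auto
  have "expectation (\<lambda>\<omega>. (\<Sum>x\<in>pairs. E (e u') x \<omega> * E (e v') x \<omega>) * (\<Sum>x\<in>pairs. E (e u) x \<omega> * E (e v) x \<omega>)) = 0"
  proof (cases "u' = u \<or> u' = v")
    case True
    then have "v' \<noteq> u" "v' \<noteq> v" using nB by (auto simp: t t')
    then show ?thesis using *[of v' u'] uv' by (simp add: mult.commute[of "E (e v') _ _"])
  qed (use *[of u' v'] uv' in simp)
  then show "expectation (\<lambda>\<omega>. (case t of (u, v) \<Rightarrow> \<Sum>x\<in>pairs. E (e u) x \<omega> * E (e v) x \<omega>) *
      (case t' of (u, v) \<Rightarrow> \<Sum>x\<in>pairs. E (e u) x \<omega> * E (e v) x \<omega>)) = 0"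
    unfolding t t' prod.case by (subst mult.commute)
qed (auto simp: frob_sq_nonneg)

text \<open>The two indices come from disjoint samples, so there is no transposed pair and each
  summand is correlated with itself only.\<close>

lemma second_moment_sum_EF:
  assumes e: "sample e n s" and f: "sample f m r" and ef: "\<And>u v. u < n \<Longrightarrow> v < m \<Longrightarrow> e u \<noteq> f v"
  shows "expectation (\<lambda>\<omega>. (\<Sum>(u, v)\<in>{..<n} \<times> {..<m}. \<Sum>x\<in>pairs. E (e u) x \<omega> * E (f v) x \<omega>)\<^sup>2)
    \<le> (real n * real m) * 1 * (4 * (frob_sq p s * frob_sq p r))"
proof (rule second_moment_sum_le[where J = I and B = "\<lambda>t. {t}"])
  fix t assume "t \<in> {..<n} \<times> {..<m}"
  then obtain u v where t: "t = (u, v)" and uv: "u < n" "v < m" by auto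
  note I = sample_in[OF e] sample_in[OF f] and neq = sample_neq[OF e] sample_neq[OF f]
  show "rv I (\<lambda>\<omega>. case t of (u, v) \<Rightarrow> \<Sum>x\<in>pairs. E (e u) x \<omega> * E (f v) x \<omega>)"
    unfolding t prod.case using uv I by (intro rv_sum rv_mult rv_E) auto
  show "expectation (\<lambda>\<omega>. (case t of (u, v) \<Rightarrow> \<Sum>x\<in>pairs. E (e u) x \<omega> * E (f v) x \<omega>)\<^sup>2) \<le> 4 * (frob_sq p s * frob_sq p r)"
    unfolding t prod.case using second_moment_EE[of "e u" "f v"] uv I ef[of u v] sample_S[OF e] sample_S[OF f] by simp
  fix t' assume T': "t' \<in> {..<n} \<times> {..<m}" and nB: "t' \<notin> {t}"
  from T' obtain u' v' where t': "t' = (u', v')" and uv': "u' < n" "v' < m" by auto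
  have "expectation (\<lambda>\<omega>. (\<Sum>x\<in>pairs. E (e u) x \<omega> * E (f v) x \<omega>) * (\<Sum>x\<in>pairs. E (e u') x \<omega> * E (f v') x \<omega>)) = 0"
  proof (cases "u' = u")
    case False
    then show ?thesis
      using uv uv' I neq ef[of u v] ef[of u' v'] ef[of u v'] ef[of u' v]
      by (intro expectation_inner_zero[where J = "{e u}" and K = "{f v, e u', f v'}"] rv_E rv_sum rv_mult mean_E) auto
  next
    case True
    then have "v' \<noteq> v" using nB by (auto simp: t t')
    then have "expectation (\<lambda>\<omega>. (\<Sum>x\<in>pairs. E (f v) x \<omega> * E (e u) x \<omega>) * (\<Sum>x\<in>pairs. E (e u') x \<omega> * E (f v') x \<omega>)) = 0"
      using uv uv' I neq ef[of u v] ef[of u' v'] ef[of u v'] ef[of u' v]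
      by (intro expectation_inner_zero[where J = "{f v}" and K = "{e u, e u', f v'}"] rv_E rv_sum rv_mult mean_E) auto
    then show ?thesis by (simp add: mult.commute[of "E (f v) _ _"])
  qed
  then show "expectation (\<lambda>\<omega>. (case t of (u, v) \<Rightarrow> \<Sum>x\<in>pairs. E (e u) x \<omega> * E (f v) x \<omega>) *
      (case t' of (u, v) \<Rightarrow> \<Sum>x\<in>pairs. E (e u) x \<omega> * E (f v) x \<omega>)) = 0"
    unfolding t t' prod.case .
qed (auto simp: frob_sq_nonneg card_cartesian_product)

text \<open>In \<open>t'\<close> the outer indices occur once and the middle one twice. Only a new
  outer index forces the expectation to vanish; the middle index stays free in \<open>B\<close>,
  hence \<open>9 n\<close> partners. The resulting order \<open>n^4\<close> becomes
  \<open>1 / n^2\<close> after normalisation by \<open>n^6\<close>.\<close>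

lemma second_moment_sum_three:
  assumes e: "sample e n s"
  shows "expectation (\<lambda>\<omega>. (\<Sum>(u, v, w) | u < n \<and> v < n \<and> w < n \<and> distinct [u, v, w].
      ip p (Z (e u) \<omega>) (Z (e v) \<omega>) * ip p (Z (e v) \<omega>) (Z (e w) \<omega>))\<^sup>2)
    \<le> (real n * real n * real n) * (9 * real n) * (9 * (frob_sq p s * frob_sq p s))"
    (is "expectation (\<lambda>\<omega>. (\<Sum>t\<in>?T. (case t of (u, v, w) \<Rightarrow> ?h u v w \<omega>))\<^sup>2) \<le> _")
proof (rule second_moment_sum_le[where J = I and B = "\<lambda>(u, v, w). {u, v, w} \<times> {..<n} \<times> {u, v, w}"])
  have sub: "?T \<subseteq> {..<n} \<times> {..<n} \<times> {..<n}" by auto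
  then show "finite ?T" by (rule finite_subset) simp
  show "real (card ?T) \<le> real n * real n * real n"
    using card_mono[OF _ sub] by (simp add: card_cartesian_product flip: of_nat_mult)
  fix t assume "t \<in> ?T"
  then obtain u v w where t: "t = (u, v, w)" and uv: "u < n" "v < n" "w < n" "distinct [u, v, w]" by auto
  note I = sample_in[OF e] and neq = sample_neq[OF e]
  show "rv I (\<lambda>\<omega>. case t of (u, v, w) \<Rightarrow> ?h u v w \<omega>)"
    unfolding t prod.case using uv I by (intro rv_mult rv_ip) auto
  show "expectation (\<lambda>\<omega>. (case t of (u, v, w) \<Rightarrow> ?h u v w \<omega>)\<^sup>2) \<le> 9 * (frob_sq p s * frob_sq p s)"
    unfolding t prod.case using uv I neq sample_S[OF e] by (intro second_moment_ip_ip) auto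
  show "finite (case t of (u, v, w) \<Rightarrow> {u, v, w} \<times> {..<n} \<times> {u, v, w})" by (simp add: t)
  show "real (card (case t of (u, v, w) \<Rightarrow> {u, v, w} \<times> {..<n} \<times> {u, v, w})) \<le> 9 * real n"
  proof -
    have "card {u, v, w} = 3" using distinct_card[OF uv(4)] by (simp only: list.set) simp
    then show ?thesis unfolding t prod.case card_cartesian_product by simp
  qed
  fix t' assume T': "t' \<in> ?T" and nB: "t' \<notin> (case t of (u, v, w) \<Rightarrow> {u, v, w} \<times> {..<n} \<times> {u, v, w})"
  from T' obtain u' v' w' where t': "t' = (u', v', w')" and uv': "u' < n" "v' < n" "w' < n" "distinct [u', v', w']" by auto
  show "expectation (\<lambda>\<omega>. (case t of (u, v, w) \<Rightarrow> ?h u v w \<omega>) * (case t' of (u, v, w) \<Rightarrow> ?h u v w \<omega>)) = 0"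
  proof (cases "u' \<in> {u, v, w}")
    case False
    then show ?thesis unfolding t t' prod.case by (intro quartic_zero(1)) (use uv uv' in \<open>auto simp: I neq\<close>)
  next
    case True
    then have "w' \<notin> {u, v, w}" using nB uv' by (auto simp: t t')
    then show ?thesis unfolding t t' prod.case by (intro quartic_zero(4)) (use uv uv' in \<open>auto simp: I neq\<close>)
  qed
qed (auto simp: frob_sq_nonneg)

text \<open>All four indices occur once, so any new index in \<open>t'\<close> forces zero and
  \<open>B\<close> has 4^4 = 256 elements.\<close>

lemma second_moment_sum_four:
  assumes e: "sample e n s"
  shows "expectation (\<lambda>\<omega>. (\<Sum>(u, v, w, z) | u < n \<and> v < n \<and> w < n \<and> z < n \<and> distinct [u, v, w, z].
      ip p (Z (e u) \<omega>) (Z (e v) \<omega>) * ip p (Z (e w) \<omega>) (Z (e z) \<omega>))\<^sup>2)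
    \<le> (real n * real n * real n * real n) * 256 * (9 * (frob_sq p s * frob_sq p s))"
    (is "expectation (\<lambda>\<omega>. (\<Sum>t\<in>?T. (case t of (u, v, w, z) \<Rightarrow> ?h u v w z \<omega>))\<^sup>2) \<le> _")
proof (rule second_moment_sum_le[where J = I and B = "\<lambda>(u, v, w, z). {u, v, w, z} \<times> {u, v, w, z} \<times> {u, v, w, z} \<times> {u, v, w, z}"])
  have sub: "?T \<subseteq> {..<n} \<times> {..<n} \<times> {..<n} \<times> {..<n}" by auto
  then show "finite ?T" by (rule finite_subset) simp
  show "real (card ?T) \<le> real n * real n * real n * real n"
    using card_mono[OF _ sub] by (simp add: card_cartesian_product flip: of_nat_mult)
  fix t assume "t \<in> ?T"
  then obtain u v w z where t: "t = (u, v, w, z)" and uv: "u < n" "v < n" "w < n" "z < n" "distinct [u, v, w, z]" by auto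
  let ?s = "{u, v, w, z}"
  note I = sample_in[OF e] and neq = sample_neq[OF e]
  show "rv I (\<lambda>\<omega>. case t of (u, v, w, z) \<Rightarrow> ?h u v w z \<omega>)"
    unfolding t prod.case using uv I by (intro rv_mult rv_ip) auto
  show "expectation (\<lambda>\<omega>. (case t of (u, v, w, z) \<Rightarrow> ?h u v w z \<omega>)\<^sup>2) \<le> 9 * (frob_sq p s * frob_sq p s)"
    unfolding t prod.case using uv I neq sample_S[OF e] by (intro second_moment_ip_ip) auto
  show "finite (case t of (u, v, w, z) \<Rightarrow> {u, v, w, z} \<times> {u, v, w, z} \<times> {u, v, w, z} \<times> {u, v, w, z})" by (simp add: t)
  show "real (card (case t of (u, v, w, z) \<Rightarrow> {u, v, w, z} \<times> {u, v, w, z} \<times> {u, v, w, z} \<times> {u, v, w, z})) \<le> 256"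
  proof -
    have "card ?s = 4" using distinct_card[OF uv(5)] by (simp only: list.set) simp
    then show ?thesis unfolding t prod.case card_cartesian_product by simp
  qed
  fix t' assume T': "t' \<in> ?T" and nB: "t' \<notin> (case t of (u, v, w, z) \<Rightarrow> {u, v, w, z} \<times> {u, v, w, z} \<times> {u, v, w, z} \<times> {u, v, w, z})"
  from T' obtain u' v' w' z' where t': "t' = (u', v', w', z')"
    and uv': "u' < n" "v' < n" "w' < n" "z' < n" "distinct [u', v', w', z']" by auto
  have d: "u' \<noteq> v'" "u' \<noteq> w'" "u' \<noteq> z'" "v' \<noteq> w'" "v' \<noteq> z'" "w' \<noteq> z'" using uv' by auto
  consider "u' \<notin> ?s" | "v' \<notin> ?s" | "w' \<notin> ?s" | "z' \<notin> ?s" using nB unfolding t t' prod.case mem_Times_iff fst_conv snd_conv by blast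
  then show "expectation (\<lambda>\<omega>. (case t of (u, v, w, z) \<Rightarrow> ?h u v w z \<omega>) * (case t' of (u, v, w, z) \<Rightarrow> ?h u v w z \<omega>)) = 0"
  proof cases
    case 1 then show ?thesis unfolding t t' prod.case by (intro quartic_zero(1)) (use uv(1-4) uv'(1-4) d in \<open>auto simp: I neq\<close>)
  next
    case 2 then show ?thesis unfolding t t' prod.case by (intro quartic_zero(2)) (use uv(1-4) uv'(1-4) d in \<open>auto simp: I neq\<close>)
  next
    case 3 then show ?thesis unfolding t t' prod.case by (intro quartic_zero(3)) (use uv(1-4) uv'(1-4) d in \<open>auto simp: I neq\<close>)
  next
    case 4 then show ?thesis unfolding t t' prod.case by (intro quartic_zero(4)) (use uv(1-4) uv'(1-4) d in \<open>auto simp: I neq\<close>)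
  qed
qed (auto simp: frob_sq_nonneg)

text \<open>The index \<open>v\<close> of the other sample occurs twice and stays free, while the
  outer indices must both be shared, hence \<open>4 m\<close> partners.\<close>

lemma second_moment_sum_cross_three:
  assumes e: "sample e n s" and f: "sample f m r" and ef: "\<And>u v. u < n \<Longrightarrow> v < m \<Longrightarrow> e u \<noteq> f v"
  shows "expectation (\<lambda>\<omega>. (\<Sum>((u, w), v)\<in>{(u, w). u < n \<and> w < n \<and> u \<noteq> w} \<times> {..<m}.
      ip p (Z (e u) \<omega>) (Z (f v) \<omega>) * ip p (Z (f v) \<omega>) (Z (e w) \<omega>))\<^sup>2)
    \<le> (real n * real n * real m) * (4 * real m) * (9 * (frob_sq p s * frob_sq p r))"
    (is "expectation (\<lambda>\<omega>. (\<Sum>t\<in>?T. ((\<lambda>((u, w), v). ?h u w v \<omega>) t))\<^sup>2) \<le> _")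
proof (rule second_moment_sum_le[where J = I and B = "\<lambda>((u, w), v). ({u, w} \<times> {u, w}) \<times> {..<m}"])
  have sub: "?T \<subseteq> ({..<n} \<times> {..<n}) \<times> {..<m}" by auto
  then show "finite ?T" by (rule finite_subset) simp
  show "real (card ?T) \<le> real n * real n * real m"
  proof -
    have "card ?T \<le> n * n * m"
      using card_mono[OF _ sub] by (simp only: card_cartesian_product card_lessThan finite_cartesian_product finite_lessThan)
    from of_nat_mono[OF this] show ?thesis by (simp only: of_nat_mult)
  qed
  fix t assume "t \<in> ?T"
  then obtain u w v where t: "t = ((u, w), v)" and uv: "u < n" "v < m" "w < n" "u \<noteq> w" by auto
  note I = sample_in[OF e] sample_in[OF f] and neq = sample_neq[OF e] sample_neq[OF f] ef
  show "rv I (\<lambda>\<omega>. (\<lambda>((u, w), v). ?h u w v \<omega>) t)"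
    unfolding t prod.case using uv I by (intro rv_mult rv_ip) auto
  show "expectation (\<lambda>\<omega>. ((\<lambda>((u, w), v). ?h u w v \<omega>) t)\<^sup>2) \<le> 9 * (frob_sq p s * frob_sq p r)"
    unfolding t prod.case using uv I neq ef[THEN not_sym] sample_S[OF e] sample_S[OF f] by (intro second_moment_ip_ip) (auto simp: mult.commute)
  show "finite ((\<lambda>((u, w), v). ({u, w} \<times> {u, w}) \<times> {..<m}) t)" by (simp add: t)
  show "real (card ((\<lambda>((u, w), v). ({u, w} \<times> {u, w}) \<times> {..<m}) t)) \<le> 4 * real m"
  proof -
    have "card {u, w} = 2" using uv by simp
    then show ?thesis unfolding t prod.case card_cartesian_product by simp
  qed
  fix t' assume T': "t' \<in> ?T" and nB: "t' \<notin> ((\<lambda>((u, w), v). ({u, w} \<times> {u, w}) \<times> {..<m}) t)"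
  from T' obtain u' v' w' where t': "t' = ((u', w'), v')" and uv': "u' < n" "v' < m" "w' < n" "u' \<noteq> w'" by auto
  show "expectation (\<lambda>\<omega>. ((\<lambda>((u, w), v). ?h u w v \<omega>) t) * ((\<lambda>((u, w), v). ?h u w v \<omega>) t')) = 0"
  proof (cases "u' \<in> {u, w}")
    case False
    then show ?thesis unfolding t t' prod.case by (intro quartic_zero(1)) (use uv uv' in \<open>auto simp: I neq ef[THEN not_sym]\<close>)
  next
    case True
    then have "w' \<notin> {u, w}" using nB uv' by (auto simp: t t')
    then show ?thesis unfolding t t' prod.case by (intro quartic_zero(4)) (use uv uv' in \<open>auto simp: I neq ef[THEN not_sym]\<close>)
  qed
qed (auto simp: frob_sq_nonneg)

text \<open>Each index occurs once and can be shared only within its own sample: two choices for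
  each of the four, hence 16.\<close>

lemma second_moment_sum_cross_four:
  assumes e: "sample e n s" and f: "sample f m r" and ef: "\<And>u v. u < n \<Longrightarrow> v < m \<Longrightarrow> e u \<noteq> f v"
  shows "expectation (\<lambda>\<omega>. (\<Sum>((u, w), (v, z))\<in>{(u, w). u < n \<and> w < n \<and> u \<noteq> w} \<times> {(v, z). v < m \<and> z < m \<and> v \<noteq> z}.
      ip p (Z (e u) \<omega>) (Z (f v) \<omega>) * ip p (Z (e w) \<omega>) (Z (f z) \<omega>))\<^sup>2)
    \<le> (real n * real n * (real m * real m)) * 16 * (9 * (frob_sq p s * frob_sq p r))"
    (is "expectation (\<lambda>\<omega>. (\<Sum>t\<in>?T. ((\<lambda>((u, w), (v, z)). ?h u w v z \<omega>) t))\<^sup>2) \<le> _")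
proof (rule second_moment_sum_le[where J = I and B = "\<lambda>((u, w), (v, z)). ({u, w} \<times> {u, w}) \<times> ({v, z} \<times> {v, z})"])
  have sub: "?T \<subseteq> ({..<n} \<times> {..<n}) \<times> ({..<m} \<times> {..<m})" by auto
  then show "finite ?T" by (rule finite_subset) simp
  show "real (card ?T) \<le> real n * real n * (real m * real m)"
  proof -
    have "card ?T \<le> n * n * (m * m)"
      using card_mono[OF _ sub] by (simp only: card_cartesian_product card_lessThan finite_cartesian_product finite_lessThan)
    from of_nat_mono[OF this] show ?thesis by (simp only: of_nat_mult)
  qed
  fix t assume "t \<in> ?T"
  then obtain u w v z where t: "t = ((u, w), (v, z))" and uv: "u < n" "v < m" "w < n" "z < m" "u \<noteq> w" "v \<noteq> z" by auto
  note I = sample_in[OF e] sample_in[OF f] and neq = sample_neq[OF e] sample_neq[OF f] ef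
  show "rv I (\<lambda>\<omega>. (\<lambda>((u, w), (v, z)). ?h u w v z \<omega>) t)"
    unfolding t prod.case using uv I by (intro rv_mult rv_ip) auto
  show "expectation (\<lambda>\<omega>. ((\<lambda>((u, w), (v, z)). ?h u w v z \<omega>) t)\<^sup>2) \<le> 9 * (frob_sq p s * frob_sq p r)"
    unfolding t prod.case using uv I neq ef[THEN not_sym] sample_S[OF e] sample_S[OF f] by (intro second_moment_ip_ip) auto
  show "finite ((\<lambda>((u, w), (v, z)). ({u, w} \<times> {u, w}) \<times> ({v, z} \<times> {v, z})) t)" by (simp add: t)
  show "real (card ((\<lambda>((u, w), (v, z)). ({u, w} \<times> {u, w}) \<times> ({v, z} \<times> {v, z})) t)) \<le> 16"
  proof -
    have "card {u, w} = 2" "card {v, z} = 2" using uv by simp_all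
    then show ?thesis unfolding t prod.case card_cartesian_product by simp
  qed
  fix t' assume T': "t' \<in> ?T" and nB: "t' \<notin> ((\<lambda>((u, w), (v, z)). ({u, w} \<times> {u, w}) \<times> ({v, z} \<times> {v, z})) t)"
  from T' obtain u' v' w' z' where t': "t' = ((u', w'), (v', z'))"
    and uv': "u' < n" "v' < m" "w' < n" "z' < m" "u' \<noteq> w'" "v' \<noteq> z'" by auto
  consider "u' \<notin> {u, w}" | "v' \<notin> {v, z}" | "w' \<notin> {u, w}" | "z' \<notin> {v, z}" using nB unfolding t t' prod.case mem_Times_iff fst_conv snd_conv by blast
  then show "expectation (\<lambda>\<omega>. ((\<lambda>((u, w), (v, z)). ?h u w v z \<omega>) t) * ((\<lambda>((u, w), (v, z)). ?h u w v z \<omega>) t')) = 0"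
  proof cases
    case 1 then show ?thesis unfolding t t' prod.case by (intro quartic_zero(1)) (use uv uv' in \<open>auto simp: I neq ef[THEN not_sym]\<close>)
  next
    case 2 then show ?thesis unfolding t t' prod.case by (intro quartic_zero(2)) (use uv uv' in \<open>auto simp: I neq ef[THEN not_sym]\<close>)
  next
    case 3 then show ?thesis unfolding t t' prod.case by (intro quartic_zero(3)) (use uv uv' in \<open>auto simp: I neq ef[THEN not_sym]\<close>)
  next
    case 4 then show ?thesis unfolding t t' prod.case by (intro quartic_zero(4)) (use uv uv' in \<open>auto simp: I neq ef[THEN not_sym]\<close>)
  qed
qed (auto simp: frob_sq_nonneg)

end

subsection \<open>The quadratic form statistic\<close>

lemma sum_offdiag_left: "(\<Sum>(u, v) | u < n \<and> v < n \<and> u \<noteq> v. g u) = (real n - 1) * (\<Sum>u<n. g u)"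
proof -
  have "(\<Sum>(u, v) | u < n \<and> v < n \<and> u \<noteq> v. g u) = (\<Sum>(u, v)\<in>(SIGMA u:{..<n}. {..<n} - {u}). g u)"
    by (intro sum.cong) auto
  also have "\<dots> = (\<Sum>u<n. \<Sum>v\<in>{..<n} - {u}. g u)"
    by (rule sum.Sigma[symmetric]) auto
  also have "\<dots> = (\<Sum>u<n. (real n - 1) * g u)"
    by (intro sum.cong) (auto simp: card_Diff_singleton of_nat_diff)
  finally show ?thesis by (simp add: sum_distrib_left)
qed

lemma sum_offdiag_right: "(\<Sum>(u, v) | u < n \<and> v < n \<and> u \<noteq> v. g v) = (real n - 1) * (\<Sum>u<n. g u)"
  unfolding sum_offdiag_left[symmetric]
  by (rule sum.reindex_bij_witness[where i = prod.swap and j = prod.swap]) auto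

context independent_vectors
begin

definition m2 :: "('a \<Rightarrow> real) \<Rightarrow> real" where "m2 f = expectation (\<lambda>\<omega>. (f \<omega>)\<^sup>2)"

lemma m2_cmult: "m2 (\<lambda>\<omega>. c * f \<omega>) = c\<^sup>2 * m2 f"
  by (simp add: m2_def power_mult_distrib)

lemma m2_nonneg: "0 \<le> m2 f"
  by (simp add: m2_def)

text \<open>Cauchy-Schwarz against the constant 1. The terms may be dependent, at the price of the
  factor \<open>card T\<close>.\<close>

lemma m2_sum_le:
  assumes T: "finite T" and f: "\<And>t. t \<in> T \<Longrightarrow> rv J (f t)"
  shows "m2 (\<lambda>\<omega>. \<Sum>t\<in>T. f t \<omega>) \<le> real (card T) * (\<Sum>t\<in>T. m2 (f t))"
proof (cases "T = {}")
  case False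
  then have "J \<subseteq> I" using f by (auto simp: rv_def)
  then have "rv J (\<lambda>\<omega>. \<Sum>t\<in>T. f t \<omega>)" using f by (rule rv_sum)
  then have 1: "integrable M (\<lambda>\<omega>. (\<Sum>t\<in>T. f t \<omega>)\<^sup>2)" by (rule rv_powers)
  have 2: "integrable M (\<lambda>\<omega>. (f t \<omega>)\<^sup>2)" if "t \<in> T" for t using rv_powers[OF f[OF that]] .
  have "m2 (\<lambda>\<omega>. \<Sum>t\<in>T. f t \<omega>) \<le> expectation (\<lambda>\<omega>. real (card T) * (\<Sum>t\<in>T. (f t \<omega>)\<^sup>2))"
    unfolding m2_def
  proof (rule integral_mono[OF 1])
    show "integrable M (\<lambda>\<omega>. real (card T) * (\<Sum>t\<in>T. (f t \<omega>)\<^sup>2))" using 2 by simp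
    show "(\<Sum>t\<in>T. f t \<omega>)\<^sup>2 \<le> real (card T) * (\<Sum>t\<in>T. (f t \<omega>)\<^sup>2)" for \<omega>
      using Cauchy_Schwarz_ineq_sum[of "\<lambda>_. 1" "\<lambda>t. f t \<omega>" T] by simp
  qed
  also have "\<dots> = real (card T) * (\<Sum>t\<in>T. m2 (f t))"
    using 2 by (simp add: m2_def)
  finally show ?thesis .
qed (simp add: m2_def)

end

context gaussian_vectors
begin

text \<open>The linear part in the Hoeffding decomposition of the U-statistics; \<open>D\<close>
  will be a covariance matrix or the difference of two.\<close>

definition lin :: "(nat \<Rightarrow> 'i) \<Rightarrow> nat \<Rightarrow> (nat \<Rightarrow> nat \<Rightarrow> real) \<Rightarrow> 'a \<Rightarrow> real" where
  "lin e n D \<omega> = (\<Sum>u<n. \<Sum>x\<in>pairs. E (e u) x \<omega> * D (fst x) (snd x))"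

definition frob_inner :: "(nat \<Rightarrow> nat \<Rightarrow> real) \<Rightarrow> (nat \<Rightarrow> nat \<Rightarrow> real) \<Rightarrow> real" where
  "frob_inner s r = (\<Sum>x\<in>pairs. s (fst x) (snd x) * r (fst x) (snd x))"

lemma frob_inner_self: "frob_inner s s = frob_sq p s"
  by (simp add: frob_inner_def frob_sq_def power2_eq_square split_def)

lemma ip_sq_expand:
  assumes "S u = s" "S v = r"
  shows "(ip p (Z u \<omega>) (Z v \<omega>))\<^sup>2 = frob_inner s r + (\<Sum>x\<in>pairs. E u x \<omega> * r (fst x) (snd x))
    + (\<Sum>x\<in>pairs. E v x \<omega> * s (fst x) (snd x)) + (\<Sum>x\<in>pairs. E u x \<omega> * E v x \<omega>)"
  unfolding ip_sq frob_inner_def sum.distrib[symmetric]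
  by (intro sum.cong refl) (simp add: E_def assms algebra_simps)

text \<open>Together with the five definitions that follow, these are the sums without their
  normalising factors; \<open>quad\<close> and \<open>cross_quad\<close> are what remains of the
  squared inner products after removal of the constant and linear parts.\<close>

definition quad :: "(nat \<Rightarrow> 'i) \<Rightarrow> nat \<Rightarrow> 'a \<Rightarrow> real" where
  "quad e n \<omega> = (\<Sum>(u, v) | u < n \<and> v < n \<and> u \<noteq> v. \<Sum>x\<in>pairs. E (e u) x \<omega> * E (e v) x \<omega>)"

definition three :: "(nat \<Rightarrow> 'i) \<Rightarrow> nat \<Rightarrow> 'a \<Rightarrow> real" where
  "three e n \<omega> = (\<Sum>(u, v, w) | u < n \<and> v < n \<and> w < n \<and> distinct [u, v, w].
      ip p (Z (e u) \<omega>) (Z (e v) \<omega>) * ip p (Z (e v) \<omega>) (Z (e w) \<omega>))"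

definition four :: "(nat \<Rightarrow> 'i) \<Rightarrow> nat \<Rightarrow> 'a \<Rightarrow> real" where
  "four e n \<omega> = (\<Sum>(u, v, w, z) | u < n \<and> v < n \<and> w < n \<and> z < n \<and> distinct [u, v, w, z].
      ip p (Z (e u) \<omega>) (Z (e v) \<omega>) * ip p (Z (e w) \<omega>) (Z (e z) \<omega>))"

definition cross_quad :: "(nat \<Rightarrow> 'i) \<Rightarrow> nat \<Rightarrow> (nat \<Rightarrow> 'i) \<Rightarrow> nat \<Rightarrow> 'a \<Rightarrow> real" where
  "cross_quad e n f m \<omega> = (\<Sum>(u, v)\<in>{..<n} \<times> {..<m}. \<Sum>x\<in>pairs. E (e u) x \<omega> * E (f v) x \<omega>)"

definition cross_three :: "(nat \<Rightarrow> 'i) \<Rightarrow> nat \<Rightarrow> (nat \<Rightarrow> 'i) \<Rightarrow> nat \<Rightarrow> 'a \<Rightarrow> real" where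
  "cross_three e n f m \<omega> = (\<Sum>((u, w), v)\<in>{(u, w). u < n \<and> w < n \<and> u \<noteq> w} \<times> {..<m}.
      ip p (Z (e u) \<omega>) (Z (f v) \<omega>) * ip p (Z (f v) \<omega>) (Z (e w) \<omega>))"

definition cross_four :: "(nat \<Rightarrow> 'i) \<Rightarrow> nat \<Rightarrow> (nat \<Rightarrow> 'i) \<Rightarrow> nat \<Rightarrow> 'a \<Rightarrow> real" where
  "cross_four e n f m \<omega> = (\<Sum>((u, w), (v, z))\<in>{(u, w). u < n \<and> w < n \<and> u \<noteq> w} \<times> {(v, z). v < m \<and> z < m \<and> v \<noteq> z}.
      ip p (Z (e u) \<omega>) (Z (f v) \<omega>) * ip p (Z (e w) \<omega>) (Z (f z) \<omega>))"

lemmas stat_defs = lin_def quad_def three_def four_def cross_quad_def cross_three_def cross_four_def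

section \<open>Second moments of the sums and of \<open>A_stat\<close>\<close>

lemma rv_stats:
  assumes e: "sample e n s" and f: "sample f m r"
  shows "rv I (lin e n D)" "rv I (quad e n)" "rv I (three e n)" "rv I (four e n)"
    "rv I (cross_quad e n f m)" "rv I (cross_three e n f m)" "rv I (cross_four e n f m)"
  unfolding stat_defs[abs_def]
  using sample_in[OF e] sample_in[OF f]
  by (auto simp: split_def intro!: rv_sum rv_mult rv_E rv_const rv_ip)

lemma m2_stats:
  assumes e: "sample e n s"
  shows "m2 (lin e n D) \<le> 2 * real n * (frob_sq p s * frob_sq p D)"
    and "m2 (quad e n) \<le> 16 * real n ^ 2 * (frob_sq p s)\<^sup>2"
    and "m2 (three e n) \<le> 81 * real n ^ 4 * (frob_sq p s)\<^sup>2"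
    and "m2 (four e n) \<le> 2304 * real n ^ 4 * (frob_sq p s)\<^sup>2"
  unfolding m2_def stat_defs
  using second_moment_sum_ED[OF e, of D] second_moment_sum_EE[OF e] second_moment_sum_three[OF e]
    second_moment_sum_four[OF e]
  by (simp_all add: power2_eq_square power4_eq_xxxx mult_ac)

lemma m2_cross_stats:
  assumes e: "sample e n s" and f: "sample f m r" and ef: "\<And>u v. u < n \<Longrightarrow> v < m \<Longrightarrow> e u \<noteq> f v"
  shows "m2 (cross_quad e n f m) \<le> 4 * (real n * real m) * (frob_sq p s * frob_sq p r)"
    and "m2 (cross_three e n f m) \<le> 36 * (real n ^ 2 * real m ^ 2) * (frob_sq p s * frob_sq p r)"
    and "m2 (cross_four e n f m) \<le> 144 * (real n ^ 2 * real m ^ 2) * (frob_sq p s * frob_sq p r)"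
  unfolding m2_def stat_defs
  using second_moment_sum_EF[OF e f ef] second_moment_sum_cross_three[OF e f ef] second_moment_sum_cross_four[OF e f ef]
  by (simp_all add: power2_eq_square mult_ac)

text \<open>What remains of \<open>A_stat\<close> without its mean and its linear part. The minus
  sign sits in the coefficient so that the bound for linear combinations applies directly.\<close>

definition A_rest :: "(nat \<Rightarrow> 'i) \<Rightarrow> nat \<Rightarrow> 'a \<Rightarrow> real" where
  "A_rest e n \<omega> = 1 / (real n * (real n - 1)) * quad e n \<omega>
    + (- (2 / (real n * (real n - 1) * (real n - 2)))) * three e n \<omega>
    + 1 / (real n * (real n - 1) * (real n - 2) * (real n - 3)) * four e n \<omega>"

text \<open>Every \<open>u\<close> stands in \<open>n - 1\<close> ordered pairs on either side, so
  after division by \<open>n (n - 1)\<close> the linear part has coefficient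
  \<open>2 / n\<close>.\<close>

lemma A_stat_expand:
  assumes e: "sample e n s" and n: "2 \<le> n"
  shows "A_stat p n (\<lambda>u. Z (e u) \<omega>) = frob_sq p s + 2 / real n * lin e n s \<omega> + A_rest e n \<omega>"
proof -
  let ?T = "{(u, v). u < n \<and> v < n \<and> u \<noteq> v}"
  let ?g = "\<lambda>u. \<Sum>x\<in>pairs. E (e u) x \<omega> * s (fst x) (snd x)"
  have "(\<Sum>(u, v)\<in>?T. (ip p (Z (e u) \<omega>) (Z (e v) \<omega>))\<^sup>2) =
      (\<Sum>(u, v)\<in>?T. frob_sq p s + ?g u + ?g v + (\<Sum>x\<in>pairs. E (e u) x \<omega> * E (e v) x \<omega>))"
    by (intro sum.cong refl) (auto simp: ip_sq_expand[OF sample_S[OF e] sample_S[OF e]] frob_inner_self)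
  also have "\<dots> = (\<Sum>(u, v)\<in>?T. frob_sq p s) + (\<Sum>(u, v)\<in>?T. ?g u) + (\<Sum>(u, v)\<in>?T. ?g v) + quad e n \<omega>"
    by (simp add: quad_def split_def sum.distrib)
  also have "\<dots> = (real n - 1) * (real n * frob_sq p s) + (real n - 1) * lin e n s \<omega> + (real n - 1) * lin e n s \<omega> + quad e n \<omega>"
  proof -
    have "(\<Sum>(u, v)\<in>?T. frob_sq p s) = (real n - 1) * (real n * frob_sq p s)"
      using sum_offdiag_left[where g = "\<lambda>_. frob_sq p s" and n = n] by simp
    moreover have "(\<Sum>(u, v)\<in>?T. ?g u) = (real n - 1) * lin e n s \<omega>"
      unfolding lin_def by (rule sum_offdiag_left)
    moreover have "(\<Sum>(u, v)\<in>?T. ?g v) = (real n - 1) * lin e n s \<omega>"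
      unfolding lin_def by (rule sum_offdiag_right)
    ultimately show ?thesis by (simp only:)
  qed
  finally have *: "(\<Sum>(u, v)\<in>?T. (ip p (Z (e u) \<omega>) (Z (e v) \<omega>))\<^sup>2) = \<dots>" .
  have "1 / (real n * (real n - 1)) * \<dots> = frob_sq p s + 2 / real n * lin e n s \<omega> + 1 / (real n * (real n - 1)) * quad e n \<omega>"
    using n by (simp add: field_simps)
  with * have eq: "1 / (real n * (real n - 1)) * (\<Sum>(u, v)\<in>?T. (ip p (Z (e u) \<omega>) (Z (e v) \<omega>))\<^sup>2) =
    frob_sq p s + 2 / real n * lin e n s \<omega> + 1 / (real n * (real n - 1)) * quad e n \<omega>" by (simp only:)
  show ?thesis unfolding A_stat_def A_rest_def eq three_def four_def
    by (simp only: mult_minus_left)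
qed

lemma rv_A_rest:
  assumes e: "sample e n s" shows "rv I (A_rest e n)"
  unfolding A_rest_def[abs_def] by (intro rv_add rv_cmult rv_stats[OF e e])

lemma m2_lincomb2_le:
  assumes "rv I f" "rv I g"
  shows "m2 (\<lambda>\<omega>. a * f \<omega> + g \<omega>) \<le> 2 * (a\<^sup>2 * m2 f + m2 g)"
  using m2_sum_le[of "{0, 1::nat}" I "\<lambda>t. if t = 0 then (\<lambda>\<omega>. a * f \<omega>) else g"]
    rv_cmult[OF assms(1), of a] assms(2) by (simp add: m2_cmult)

lemma m2_lincomb3_le:
  assumes "rv I f" "rv I g" "rv I h"
  shows "m2 (\<lambda>\<omega>. a * f \<omega> + b * g \<omega> + c * h \<omega>) \<le> 3 * (a\<^sup>2 * m2 f + b\<^sup>2 * m2 g + c\<^sup>2 * m2 h)"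
  using m2_sum_le[of "{0, 1, 2::nat}" I "\<lambda>t. if t = 0 then (\<lambda>\<omega>. a * f \<omega>) else if t = 1 then (\<lambda>\<omega>. b * g \<omega>) else (\<lambda>\<omega>. c * h \<omega>)"]
    rv_cmult[OF assms(1), of a] rv_cmult[OF assms(2), of b] rv_cmult[OF assms(3), of c]
  by (simp add: m2_cmult add.assoc)

lemma m2_lincomb4_le:
  assumes "rv I f" "rv I g" "rv I h" "rv I k"
  shows "m2 (\<lambda>\<omega>. a * f \<omega> + b * g \<omega> + c * h \<omega> + d * k \<omega>) \<le> 4 * (a\<^sup>2 * m2 f + b\<^sup>2 * m2 g + c\<^sup>2 * m2 h + d\<^sup>2 * m2 k)"
  using m2_sum_le[of "{0, 1, 2, 3::nat}" I "\<lambda>t. if t = 0 then (\<lambda>\<omega>. a * f \<omega>) else if t = 1 then (\<lambda>\<omega>. b * g \<omega>)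
      else if t = 2 then (\<lambda>\<omega>. c * h \<omega>) else (\<lambda>\<omega>. d * k \<omega>)"]
    rv_cmult[OF assms(1), of a] rv_cmult[OF assms(2), of b] rv_cmult[OF assms(3), of c] rv_cmult[OF assms(4), of d]
  by (simp add: m2_cmult add.assoc)

text \<open>Two terms carry no coefficient because this is the shape of the error of
  \<open>T_stat\<close>: two linear parts, the remainders of the two \<open>A_stat\<close> terms,
  and the remainder of \<open>C_stat\<close>.\<close>

lemma m2_lincomb5_le:
  assumes "rv I f" "rv I g" "rv I h" "rv I k" "rv I l"
  shows "m2 (\<lambda>\<omega>. a * f \<omega> + b * g \<omega> + h \<omega> + k \<omega> + c * l \<omega>) \<le> 5 * (a\<^sup>2 * m2 f + b\<^sup>2 * m2 g + m2 h + m2 k + c\<^sup>2 * m2 l)"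
  using m2_sum_le[of "{0, 1, 2, 3, 4::nat}" I "\<lambda>t. if t = 0 then (\<lambda>\<omega>. a * f \<omega>) else if t = 1 then (\<lambda>\<omega>. b * g \<omega>)
      else if t = 2 then h else if t = 3 then k else (\<lambda>\<omega>. c * l \<omega>)"]
    rv_cmult[OF assms(1), of a] rv_cmult[OF assms(2), of b] rv_cmult[OF assms(5), of c] assms(3,4)
  by (simp add: m2_cmult add.assoc)

text \<open>For \<open>6 \<le> n\<close> the smallest factor \<open>n - 3\<close> is at least
  \<open>n / 2\<close>. This is the origin of the lower bound 6 on the sample sizes.\<close>

lemma inverse_bounds:
  assumes "6 \<le> n"
  shows "(1 / (real n * (real n - 1)))\<^sup>2 \<le> 4 / real n ^ 4"
    and "(2 / (real n * (real n - 1) * (real n - 2)))\<^sup>2 \<le> 64 / real n ^ 6"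
    and "(1 / (real n * (real n - 1) * (real n - 2) * (real n - 3)))\<^sup>2 \<le> 64 / real n ^ 8"
proof -
  have n: "0 < real n" "real n / 2 \<le> real n - 1" "real n / 2 \<le> real n - 2" "real n / 2 \<le> real n - 3" using assms by auto
  have a: "real n * (real n / 2) \<le> real n * (real n - 1)" using n by (intro mult_left_mono) auto
  have b: "real n * (real n / 2) * (real n / 2) \<le> real n * (real n - 1) * (real n - 2)"
    using n by (intro mult_mono a) auto
  have c: "real n * (real n / 2) * (real n / 2) * (real n / 2) \<le> real n * (real n - 1) * (real n - 2) * (real n - 3)"
    using n by (intro mult_mono b) auto
  have "1 / (real n * (real n - 1)) \<le> 1 / (real n * (real n / 2))"
    using n by (intro divide_left_mono a) auto
  then have "(1 / (real n * (real n - 1)))\<^sup>2 \<le> (1 / (real n * (real n / 2)))\<^sup>2"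
    using n by (intro power_mono) auto
  then show "(1 / (real n * (real n - 1)))\<^sup>2 \<le> 4 / real n ^ 4"
    by (simp add: power2_eq_square power4_eq_xxxx mult_ac)
  have "2 / (real n * (real n - 1) * (real n - 2)) \<le> 2 / (real n * (real n / 2) * (real n / 2))"
    using n by (intro divide_left_mono b) auto
  then have "(2 / (real n * (real n - 1) * (real n - 2)))\<^sup>2 \<le> (2 / (real n * (real n / 2) * (real n / 2)))\<^sup>2"
    using n by (intro power_mono) auto
  then show "(2 / (real n * (real n - 1) * (real n - 2)))\<^sup>2 \<le> 64 / real n ^ 6"
    by (simp add: power2_eq_square power_numeral_reduce mult_ac)
  have "1 / (real n * (real n - 1) * (real n - 2) * (real n - 3)) \<le> 1 / (real n * (real n / 2) * (real n / 2) * (real n / 2))"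
    using n by (intro divide_left_mono c) auto
  then have "(1 / (real n * (real n - 1) * (real n - 2) * (real n - 3)))\<^sup>2 \<le> (1 / (real n * (real n / 2) * (real n / 2) * (real n / 2)))\<^sup>2"
    using n by (intro power_mono) auto
  then show "(1 / (real n * (real n - 1) * (real n - 2) * (real n - 3)))\<^sup>2 \<le> 64 / real n ^ 8"
    by (simp add: power2_eq_square power_numeral_reduce mult_ac)
qed

text \<open>Pair and triple sums contribute order \<open>1 / n^2\<close>, the quadruple sum order
  \<open>1 / n^4\<close>. Constants are rounded up generously, since only their existence
  matters.\<close>

lemma m2_A_rest:
  assumes e: "sample e n s" and n: "6 \<le> n"
  shows "m2 (A_rest e n) \<le> 1000000 * (frob_sq p s)\<^sup>2 / (real n)\<^sup>2"
proof -
  let ?N = "(frob_sq p s)\<^sup>2"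
  have n0: "0 < real n" using n by simp
  have "m2 (A_rest e n) \<le> 3 * ((1 / (real n * (real n - 1)))\<^sup>2 * m2 (quad e n)
    + (2 / (real n * (real n - 1) * (real n - 2)))\<^sup>2 * m2 (three e n)
    + (1 / (real n * (real n - 1) * (real n - 2) * (real n - 3)))\<^sup>2 * m2 (four e n))"
    using m2_lincomb3_le[OF rv_stats(2-4)[OF e e], of "1 / (real n * (real n - 1))"
      "- (2 / (real n * (real n - 1) * (real n - 2)))" "1 / (real n * (real n - 1) * (real n - 2) * (real n - 3))"]
    unfolding A_rest_def[abs_def] power2_minus .
  also have "\<dots> \<le> 3 * (4 / real n ^ 4 * (16 * real n ^ 2 * ?N) + 64 / real n ^ 6 * (81 * real n ^ 4 * ?N)
    + 64 / real n ^ 8 * (2304 * real n ^ 4 * ?N))"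
    using m2_stats[OF e] n0 by (intro mult_left_mono add_mono mult_mono inverse_bounds[OF n]) (auto simp: m2_nonneg)
  also have "\<dots> = 15744 * (?N / (real n)\<^sup>2) + 442368 * (?N / real n ^ 4)"
    using n0 by (simp add: field_simps power2_eq_square power_numeral_reduce)
  also have "\<dots> \<le> 15744 * (?N / (real n)\<^sup>2) + 442368 * (?N / (real n)\<^sup>2)"
    using n by (intro add_left_mono mult_left_mono divide_left_mono power_increasing) auto
  also have "\<dots> \<le> 1000000 * (?N / (real n)\<^sup>2)"
  proof -
    have "0 \<le> ?N / (real n)\<^sup>2" by simp
    then show ?thesis by linarith
  qed
  finally show ?thesis by simp
qed

text \<open>The linear part dominates with order \<open>1 / n\<close>. The bound is proportional to
  the squared target, so Chebyshev's inequality determines \<open>A_stat\<close> up to a constant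
  factor.\<close>

lemma m2_A_stat:
  assumes e: "sample e n s" and n: "6 \<le> n"
  shows "m2 (\<lambda>\<omega>. A_stat p n (\<lambda>u. Z (e u) \<omega>) - frob_sq p s) \<le> 10000000 * (frob_sq p s)\<^sup>2 / real n"
proof -
  let ?N = "(frob_sq p s)\<^sup>2"
  have n0: "0 < real n" using n by simp
  have "m2 (\<lambda>\<omega>. A_stat p n (\<lambda>u. Z (e u) \<omega>) - frob_sq p s) = m2 (\<lambda>\<omega>. 2 / real n * lin e n s \<omega> + A_rest e n \<omega>)"
    using A_stat_expand[OF e] n by simp
  also have "\<dots> \<le> 2 * ((2 / real n)\<^sup>2 * m2 (lin e n s) + m2 (A_rest e n))"
    by (rule m2_lincomb2_le[OF rv_stats(1)[OF e e] rv_A_rest[OF e]])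
  also have "\<dots> \<le> 2 * ((2 / real n)\<^sup>2 * (2 * real n * (frob_sq p s * frob_sq p s)) + 1000000 * ?N / (real n)\<^sup>2)"
    by (intro mult_left_mono add_mono m2_A_rest[OF e n] m2_stats[OF e]) auto
  also have "\<dots> = 16 * (?N / real n) + 2 * 1000000 * (?N / (real n)\<^sup>2)"
    using n0 by (simp add: field_simps power2_eq_square)
  also have "?N / (real n)\<^sup>2 \<le> ?N / real n"
    using n by (intro divide_left_mono self_le_power) auto
  also have "16 * (?N / real n) + 2 * 1000000 * (?N / real n) \<le> 10000000 * (?N / real n)"
  proof -
    have "0 \<le> ?N / real n" by simp
    then show ?thesis by linarith
  qed
  finally show ?thesis by simp
qed

section \<open>Expansion and second moment of \<open>C_stat\<close>\<close>

definition C_rest :: "(nat \<Rightarrow> 'i) \<Rightarrow> nat \<Rightarrow> (nat \<Rightarrow> 'i) \<Rightarrow> nat \<Rightarrow> 'a \<Rightarrow> real" where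
  "C_rest e n f m \<omega> = 1 / (real n * real m) * cross_quad e n f m \<omega>
    + (- (1 / (real n * real m * (real n - 1)))) * cross_three e n f m \<omega>
    + (- (1 / (real n * real m * (real m - 1)))) * cross_three f m e n \<omega>
    + 1 / (real n * real m * (real n - 1) * (real m - 1)) * cross_four e n f m \<omega>"

lemma C_stat_expand:
  assumes e: "sample e n s" and f: "sample f m r" and nm: "0 < n" "0 < m"
  shows "C_stat p n m (\<lambda>u. Z (e u) \<omega>) (\<lambda>v. Z (f v) \<omega>) = frob_inner s r
    + 1 / real n * lin e n r \<omega> + 1 / real m * lin f m s \<omega> + C_rest e n f m \<omega>"
proof -
  let ?g = "\<lambda>u. \<Sum>x\<in>pairs. E (e u) x \<omega> * r (fst x) (snd x)"
  let ?k = "\<lambda>v. \<Sum>x\<in>pairs. E (f v) x \<omega> * s (fst x) (snd x)"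
  have "(\<Sum>u<n. \<Sum>v<m. (ip p (Z (e u) \<omega>) (Z (f v) \<omega>))\<^sup>2) =
      (\<Sum>u<n. \<Sum>v<m. frob_inner s r + ?g u + ?k v + (\<Sum>x\<in>pairs. E (e u) x \<omega> * E (f v) x \<omega>))"
    by (intro sum.cong refl) (auto simp: ip_sq_expand[OF sample_S[OF e] sample_S[OF f]])
  also have "\<dots> = real n * real m * frob_inner s r + real m * lin e n r \<omega> + real n * lin f m s \<omega> + cross_quad e n f m \<omega>"
    unfolding cross_quad_def lin_def sum.cartesian_product[symmetric]
    by (simp add: sum.distrib sum_distrib_left[symmetric] algebra_simps)
  finally have *: "(\<Sum>u<n. \<Sum>v<m. (ip p (Z (e u) \<omega>) (Z (f v) \<omega>))\<^sup>2) = \<dots>" .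
  have **: "1 / (real n * real m) * \<dots> = frob_inner s r
    + 1 / real n * lin e n r \<omega> + 1 / real m * lin f m s \<omega> + 1 / (real n * real m) * cross_quad e n f m \<omega>"
    using nm by (simp add: field_simps)
  \<comment> \<open>Stated for arbitrary samples, since the two triple sums of \<open>C_stat\<close>
    differ by an exchange of the samples.\<close>
  have c3: "(\<Sum>(u, w) | u < n \<and> w < n \<and> u \<noteq> w. \<Sum>v<m. ip p (Z (e u) \<omega>) (Z (f v) \<omega>) * ip p (Z (f v) \<omega>) (Z (e w) \<omega>))
      = cross_three e n f m \<omega>" for e f :: "nat \<Rightarrow> 'i" and n m
    by (simp add: cross_three_def sum.cartesian_product split_def)
  have c4: "(\<Sum>(u, w) | u < n \<and> w < n \<and> u \<noteq> w. \<Sum>(v, z) | v < m \<and> z < m \<and> v \<noteq> z.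
      ip p (Z (e u) \<omega>) (Z (f v) \<omega>) * ip p (Z (e w) \<omega>) (Z (f z) \<omega>)) = cross_four e n f m \<omega>"
    by (simp add: cross_four_def sum.cartesian_product split_def)
  show ?thesis unfolding C_stat_def C_rest_def * ** c3 c4 by (simp only: mult_minus_left)
qed

lemma rv_C_rest:
  assumes e: "sample e n s" and f: "sample f m r" shows "rv I (C_rest e n f m)"
  unfolding C_rest_def[abs_def] by (intro rv_add rv_cmult rv_stats[OF e f] rv_stats[OF f e])

text \<open>The pair sum gives \<open>1 / (n m)\<close>, the triple sums \<open>1 / n^2\<close> and
  \<open>1 / m^2\<close>, and the quadruple sum \<open>1 / (n m)^2\<close>, which is at most
  \<open>1 / (n m)\<close>. The product is absorbed by
  \<open>1 / (n m) \<le> (1 / n^2 + 1 / m^2) / 2\<close>.\<close>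

lemma m2_C_rest:
  assumes e: "sample e n s" and f: "sample f m r" and ef: "\<And>u v. u < n \<Longrightarrow> v < m \<Longrightarrow> e u \<noteq> f v"
    and n: "6 \<le> n" and m: "6 \<le> m"
  shows "m2 (C_rest e n f m) \<le> 100000 * (frob_sq p s * frob_sq p r) * (1 / (real n)\<^sup>2 + 1 / (real m)\<^sup>2)"
proof -
  let ?N = "frob_sq p s * frob_sq p r" and ?i = "1 / real n" and ?j = "1 / real m"
  have n0: "0 < real n" "0 < real m" using n m by simp_all
  have h2: "(1 / (real n - 1))\<^sup>2 \<le> 4 * (1 / real n)\<^sup>2" if "6 \<le> n" for n
  proof -
    have "1 / (real n - 1) \<le> 1 / (real n / 2)" using that by (intro divide_left_mono) auto
    then have "(1 / (real n - 1))\<^sup>2 \<le> (1 / (real n / 2))\<^sup>2" using that by (intro power_mono) auto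
    then show ?thesis by (simp add: power_divide)
  qed
  have cancel3: "(1 / (x * y * k))\<^sup>2 * (c * (x\<^sup>2 * y\<^sup>2) * N) = (1 / k)\<^sup>2 * (c * N)"
    and cancel4: "(1 / (x * y * k * l))\<^sup>2 * (c * (x\<^sup>2 * y\<^sup>2) * N) = (1 / k)\<^sup>2 * (1 / l)\<^sup>2 * (c * N)"
    if "0 < x" "0 < y" for x y k l c N :: real
    using that by (simp_all add: power_mult_distrib power_divide)
  have N0: "0 \<le> ?N" by (simp add: frob_sq_nonneg)
  have 1: "(1 / (real n * real m))\<^sup>2 * m2 (cross_quad e n f m) \<le> 4 * (?i * ?j) * ?N"
  proof -
    have "(1 / (real n * real m))\<^sup>2 * m2 (cross_quad e n f m) \<le> (1 / (real n * real m))\<^sup>2 * (4 * (real n * real m) * ?N)"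
      by (intro mult_left_mono m2_cross_stats[OF e f ef]) auto
    also have "\<dots> = 4 * (?i * ?j) * ?N" using n0 by (simp add: field_simps power2_eq_square)
    finally show ?thesis .
  qed
  have three: "(1 / (real n * real m * (real n - 1)))\<^sup>2 * m2 (cross_three e n f m) \<le> 144 * (1 / real n)\<^sup>2 * (frob_sq p s * frob_sq p r)"
    if e: "sample e n s" and f: "sample f m r" and ef: "\<And>u v. u < n \<Longrightarrow> v < m \<Longrightarrow> e u \<noteq> f v"
    and n: "6 \<le> n" "6 \<le> m" for e f n m s r
  proof -
    let ?N = "frob_sq p s * frob_sq p r"
    have "(1 / (real n * real m * (real n - 1)))\<^sup>2 * m2 (cross_three e n f m)
      \<le> (1 / (real n * real m * (real n - 1)))\<^sup>2 * (36 * (real n ^ 2 * real m ^ 2) * ?N)"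
      by (intro mult_left_mono m2_cross_stats[OF e f ef]) auto
    also have "\<dots> = (1 / (real n - 1))\<^sup>2 * (36 * ?N)" using n by (intro cancel3) auto
    also have "\<dots> \<le> 4 * (1 / real n)\<^sup>2 * (36 * ?N)"
      by (intro mult_right_mono h2 n) (simp add: frob_sq_nonneg)
    finally show ?thesis by (simp add: mult_ac)
  qed
  have 4: "(1 / (real n * real m * (real n - 1) * (real m - 1)))\<^sup>2 * m2 (cross_four e n f m) \<le> 2304 * (?i * ?j) * ?N"
  proof -
    have "(1 / (real n * real m * (real n - 1) * (real m - 1)))\<^sup>2 * m2 (cross_four e n f m)
      \<le> (1 / (real n * real m * (real n - 1) * (real m - 1)))\<^sup>2 * (144 * (real n ^ 2 * real m ^ 2) * ?N)"
      by (intro mult_left_mono m2_cross_stats[OF e f ef]) auto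
    also have "\<dots> = (1 / (real n - 1))\<^sup>2 * (1 / (real m - 1))\<^sup>2 * (144 * ?N)"
      using n m by (intro cancel4) auto
    also have "\<dots> \<le> (4 * ?i\<^sup>2) * (4 * ?j\<^sup>2) * (144 * ?N)"
      using N0 by (intro mult_right_mono mult_mono h2 n m) auto
    also have "\<dots> = 2304 * ((?i * ?j) * (?i * ?j)) * ?N" by (simp add: power2_eq_square)
    also have "\<dots> \<le> 2304 * ((?i * ?j) * (1 * 1)) * ?N"
      using N0 n m by (intro mult_right_mono mult_left_mono mult_mono) auto
    finally show ?thesis by simp
  qed
  have "m2 (C_rest e n f m) \<le> 4 * ((1 / (real n * real m))\<^sup>2 * m2 (cross_quad e n f m)
    + (1 / (real n * real m * (real n - 1)))\<^sup>2 * m2 (cross_three e n f m)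
    + (1 / (real n * real m * (real m - 1)))\<^sup>2 * m2 (cross_three f m e n)
    + (1 / (real n * real m * (real n - 1) * (real m - 1)))\<^sup>2 * m2 (cross_four e n f m))"
    using m2_lincomb4_le[OF rv_stats(5)[OF e f] rv_stats(6)[OF e f] rv_stats(6)[OF f e] rv_stats(7)[OF e f],
      of "1 / (real n * real m)" "- (1 / (real n * real m * (real n - 1)))" "- (1 / (real n * real m * (real m - 1)))"
        "1 / (real n * real m * (real n - 1) * (real m - 1))"]
    unfolding C_rest_def[abs_def] power2_minus .
  also have "\<dots> \<le> 4 * (4 * (?i * ?j) * ?N + 144 * ?i\<^sup>2 * ?N + 144 * ?j\<^sup>2 * ?N + 2304 * (?i * ?j) * ?N)"
  proof (intro mult_left_mono add_mono 1 4 three[OF e f ef n m])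
    have "(1 / (real m * real n * (real m - 1)))\<^sup>2 * m2 (cross_three f m e n) \<le> 144 * ?j\<^sup>2 * (frob_sq p r * frob_sq p s)"
      by (rule three[OF f e _ m n]) (use ef in metis)
    then show "(1 / (real n * real m * (real m - 1)))\<^sup>2 * m2 (cross_three f m e n) \<le> 144 * ?j\<^sup>2 * ?N"
      by (simp only: mult.commute[of "real m" "real n"] mult.commute[of "frob_sq p r"])
  qed auto
  also have "\<dots> = (576 * (?i\<^sup>2 + ?j\<^sup>2) + 9232 * (?i * ?j)) * ?N" by (simp add: algebra_simps)
  also have "\<dots> \<le> (100000 * (?i\<^sup>2 + ?j\<^sup>2)) * ?N"
  proof (intro mult_right_mono N0)
    show "576 * (?i\<^sup>2 + ?j\<^sup>2) + 9232 * (?i * ?j) \<le> 100000 * (?i\<^sup>2 + ?j\<^sup>2)"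
      using le_half_sum_squares[of ?i ?j] zero_le_power2[of ?i] zero_le_power2[of ?j] by argo
  qed
  finally show ?thesis by (simp add: power_divide algebra_simps)
qed

section \<open>Combination into \<open>T_stat\<close>\<close>

lemma lin_diff: "lin e n (\<lambda>a b. s a b - r a b) \<omega> = lin e n s \<omega> - lin e n r \<omega>"
  by (simp add: lin_def sum_subtractf[symmetric] algebra_simps)

lemma frob_sq_diff: "frob_sq p (\<lambda>a b. s a b - r a b) = frob_sq p s + frob_sq p r - 2 * frob_inner s r"
  unfolding frob_inner_self[symmetric] frob_inner_def sum_distrib_left sum.distrib[symmetric] sum_subtractf[symmetric]
  by (intro sum.cong refl) (simp add: algebra_simps)

text \<open>Entrywise this is \<open>(2 x - y)^2 \<ge> 0\<close>. It exchanges the norm of one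
  matrix for that of the other where norm and sample size do not match.\<close>

lemma frob_sq_le_diff: "frob_sq p r \<le> 2 * frob_sq p s + 2 * frob_sq p (\<lambda>a b. s a b - r a b)"
proof -
  have *: "y\<^sup>2 \<le> 2 * x\<^sup>2 + 2 * (x - y)\<^sup>2" for x y :: real
    using zero_le_power2[of "2 * x - y"] by (simp add: power2_eq_square algebra_simps)
  show ?thesis unfolding frob_sq_def sum_distrib_left sum.distrib[symmetric]
    by (intro sum_mono) (auto intro!: *)
qed

lemma frob_sq_minus: "frob_sq p (\<lambda>a b. s a b - r a b) = frob_sq p (\<lambda>a b. r a b - s a b)"
  by (simp add: frob_sq_def power2_commute)

text \<open>The linear parts of \<open>A_stat\<close> and of \<open>- 2 C_stat\<close> combine to a
  linear part against the difference \<open>s - r\<close>. They therefore contribute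
  \<open>N d\<close> and not a term such as \<open>(frob_sq p s)^2 / n\<close>, which need not be
  small compared with \<open>d^2\<close>.\<close>

lemma m2_T_stat:
  assumes e: "sample e n s" and f: "sample f m r" and ef: "\<And>u v. u < n \<Longrightarrow> v < m \<Longrightarrow> e u \<noteq> f v"
    and n: "6 \<le> n" and m: "6 \<le> m"
    and d: "d = frob_sq p (\<lambda>a b. s a b - r a b)" and N: "N = frob_sq p s / real n + frob_sq p r / real m"
  shows "m2 (\<lambda>\<omega>. T_stat p n m (\<lambda>u. Z (e u) \<omega>) (\<lambda>v. Z (f v) \<omega>) - d) \<le> 100000000 * (N\<^sup>2 + N * d)"
proof -
  let ?D = "\<lambda>a b. s a b - r a b" and ?Ns = "frob_sq p s" and ?Nr = "frob_sq p r"
  let ?x = "?Ns / real n" and ?y = "?Nr / real m"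
  have n0: "0 < real n" "0 < real m" using n m by simp_all
  have nn: "0 \<le> ?Ns" "0 \<le> ?Nr" "0 \<le> d" "0 \<le> ?x" "0 \<le> ?y" by (simp_all add: frob_sq_nonneg d)
  have eq: "T_stat p n m (\<lambda>u. Z (e u) \<omega>) (\<lambda>v. Z (f v) \<omega>) - d = 2 / real n * lin e n ?D \<omega>
      + (- (2 / real m)) * lin f m ?D \<omega> + A_rest e n \<omega> + A_rest f m \<omega> + (- 2) * C_rest e n f m \<omega>" for \<omega>
    unfolding T_stat_def d frob_sq_diff
    using A_stat_expand[OF e, of \<omega>] A_stat_expand[OF f, of \<omega>] C_stat_expand[OF e f, of \<omega>] n m
    by (simp add: lin_diff algebra_simps)
  have "m2 (\<lambda>\<omega>. T_stat p n m (\<lambda>u. Z (e u) \<omega>) (\<lambda>v. Z (f v) \<omega>) - d)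
    \<le> 5 * ((2 / real n)\<^sup>2 * m2 (lin e n ?D) + (2 / real m)\<^sup>2 * m2 (lin f m ?D) + m2 (A_rest e n)
      + m2 (A_rest f m) + 2\<^sup>2 * m2 (C_rest e n f m))"
    using m2_lincomb5_le[OF rv_stats(1)[OF e f] rv_stats(1)[OF f e] rv_A_rest[OF e] rv_A_rest[OF f] rv_C_rest[OF e f],
      of "2 / real n" ?D "- (2 / real m)" ?D "- 2"]
    unfolding eq power2_minus .
  then have "m2 (\<lambda>\<omega>. T_stat p n m (\<lambda>u. Z (e u) \<omega>) (\<lambda>v. Z (f v) \<omega>) - d)
    \<le> 5 * ((2 / real n)\<^sup>2 * m2 (lin e n ?D) + (2 / real m)\<^sup>2 * m2 (lin f m ?D) + m2 (A_rest e n)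
      + m2 (A_rest f m) + 4 * m2 (C_rest e n f m))" by simp
  also have "\<dots> \<le> 5 * ((2 / real n)\<^sup>2 * (2 * real n * (?Ns * d)) + (2 / real m)\<^sup>2 * (2 * real m * (?Nr * d))
      + 1000000 * ?Ns\<^sup>2 / (real n)\<^sup>2 + 1000000 * ?Nr\<^sup>2 / (real m)\<^sup>2
      + 4 * (100000 * (?Ns * ?Nr) * (1 / (real n)\<^sup>2 + 1 / (real m)\<^sup>2)))"
    unfolding d
    by (intro mult_left_mono add_mono m2_A_rest[OF e n] m2_A_rest[OF f m] m2_stats(1)[OF e] m2_stats(1)[OF f] m2_C_rest[OF e f ef n m]) auto
  also have "\<dots> = 40 * (N * d) + 5 * 1000000 * (?x\<^sup>2 + ?y\<^sup>2) + 2 * 1000000 * (?Ns * ?Nr / (real n)\<^sup>2 + ?Ns * ?Nr / (real m)\<^sup>2)"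
    using n0 unfolding N by (simp add: field_simps power2_eq_square)
  also have "\<dots> \<le> 40 * (N * d) + 5 * 1000000 * N\<^sup>2 + 2 * 1000000 * ((2 * N\<^sup>2 + 2 * (N * d)) + (2 * N\<^sup>2 + 2 * (N * d)))"
  proof -
    have xN: "?x \<le> N" "?y \<le> N" using nn by (simp_all add: N)
    then have N0: "0 \<le> N" using nn by linarith
    \<comment> \<open>One factor is divided by its own sample size and bounded by \<open>N\<close>;
      the other is exchanged for \<open>2 a + 2 d\<close>, and \<open>d / k \<le> d\<close>.\<close>
    have one: "a * b / (real k)\<^sup>2 \<le> 2 * N\<^sup>2 + 2 * (N * d)"
      if a: "a / real k \<le> N" "0 \<le> a" and b: "b \<le> 2 * a + 2 * d" and k: "6 \<le> k" for a b k
    proof -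
      have "d / real k \<le> d" using k nn mult_left_mono[of 1 "real k" d] by (simp add: field_simps)
      then have "b / real k \<le> 2 * N + 2 * d"
        using a divide_right_mono[OF b, of "real k"] by (simp add: add_divide_distrib)
      then have "(a / real k) * (b / real k) \<le> (a / real k) * (2 * N + 2 * d)"
        using a by (intro mult_left_mono) auto
      also have "\<dots> \<le> N * (2 * N + 2 * d)" using a N0 nn by (intro mult_right_mono) auto
      finally show ?thesis by (simp add: power2_eq_square algebra_simps)
    qed
    have "?Ns * ?Nr / (real n)\<^sup>2 \<le> 2 * N\<^sup>2 + 2 * (N * d)"
      using one[of ?Ns n ?Nr] xN nn n frob_sq_le_diff[of r s] by (simp add: d)
    moreover have "?Nr * ?Ns / (real m)\<^sup>2 \<le> 2 * N\<^sup>2 + 2 * (N * d)"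
      using one[of ?Nr m ?Ns] xN nn m frob_sq_le_diff[of s r] frob_sq_minus[of s r] by (simp add: d)
    moreover have "?x\<^sup>2 + ?y\<^sup>2 \<le> N\<^sup>2" using nn(4,5) mult_nonneg_nonneg[OF nn(4,5)] unfolding N power2_sum by linarith
    ultimately show ?thesis using N0 by (intro add_mono mult_left_mono) (auto simp: mult.commute)
  qed
  also have "\<dots> \<le> 100000000 * (N\<^sup>2 + N * d)"
    using mult_nonneg_nonneg[of N d] nn by (simp add: N)
  finally show ?thesis .
qed

end

subsection \<open>A single entry of the sample covariance\<close>

text \<open>The estimate of one entry, free of probability. The last six inequalities describe the
  typical behaviour of the sample sums, with \<open>b\<close> the slack granted to Chebyshev's
  inequality; \<open>s\<close> and \<open>t\<close> stand for the variances of the two coordinates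
  and \<open>\<theta>\<close> for the variance of their product. The condition
  \<open>1000 b^2 \<le> n\<close> makes the effect of the estimated means small against
  \<open>\<theta>\<close>.\<close>

context
  fixes z :: "nat \<Rightarrow> nat \<Rightarrow> real" and n i j :: nat and \<sigma> \<theta> b s t :: real
  assumes n: "1000 * b\<^sup>2 \<le> real n" and b: "1 \<le> b" and st: "0 < s" "0 < t" "s * t \<le> \<theta>"
    and sum_x: "(\<Sum>k<n. z k i)\<^sup>2 \<le> b * real n * s" and sum_y: "(\<Sum>k<n. z k j)\<^sup>2 \<le> b * real n * t"
    and sum_xx: "(\<Sum>k<n. (z k i)\<^sup>2) \<le> b * real n * s" and sum_yy: "(\<Sum>k<n. (z k j)\<^sup>2) \<le> b * real n * t"
    and sum_xy: "(\<Sum>k<n. z k i * z k j - \<sigma>)\<^sup>2 \<le> b * real n * \<theta>"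
    and sum_sq: "(\<Sum>k<n. (z k i * z k j - \<sigma>)\<^sup>2 - \<theta>)\<^sup>2 \<le> (real n * \<theta> / 10)\<^sup>2"
begin

lemma n_pos: "0 < real n" and b_le_n: "b \<le> real n" and theta_pos: "0 < \<theta>" and b_sq_n: "b\<^sup>2 / real n \<le> 1 / 1000"
proof -
  have "b * 1 \<le> b * b" using b by (intro mult_left_mono) auto
  then have "b \<le> b\<^sup>2" by (simp add: power2_eq_square)
  then show "0 < real n" "b \<le> real n" using n b zero_le_power2[of b] by linarith+
  show "b\<^sup>2 / real n \<le> 1 / 1000" using n \<open>0 < real n\<close> by (simp add: field_simps)
  show "0 < \<theta>" using st mult_pos_pos[of s t] by linarith
qed

abbreviation "mx \<equiv> sample_mean n z i"
abbreviation "my \<equiv> sample_mean n z j"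
abbreviation "sh \<equiv> sigma_hat n z i j"
abbreviation "th \<equiv> theta_hat n z i j"

lemma sample_mean_sq_i: "mx\<^sup>2 \<le> b * s / real n" and sample_mean_sq_j: "my\<^sup>2 \<le> b * t / real n"
  using sum_x sum_y n_pos by (simp_all add: sample_mean_def power_divide field_simps power2_eq_square)

text \<open>One factor \<open>b / n\<close> is at most 1 and is given away, so the bound for the
  mean correction is the same as the bound for the main error.\<close>

lemma sample_mean_prod_sq: "(mx * my)\<^sup>2 \<le> b * \<theta> / real n"
proof -
  have "(mx * my)\<^sup>2 \<le> (b * s / real n) * (b * t / real n)"
    unfolding power_mult_distrib using b st n_pos by (intro mult_mono sample_mean_sq_i sample_mean_sq_j) auto
  also have "\<dots> = b / real n * (b / real n * (s * t))" by simp
  also have "\<dots> \<le> b / real n * (1 * \<theta>)"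
    using b n_pos b_le_n st by (intro mult_left_mono mult_mono) auto
  finally show ?thesis by simp
qed

lemma abs_le_sqrtI: "u\<^sup>2 \<le> v \<Longrightarrow> \<bar>u\<bar> \<le> sqrt v" for u v :: real
  using real_sqrt_le_mono[of "u\<^sup>2" v] by simp

lemma sigma_hat_error: "sh - \<sigma> = (\<Sum>k<n. z k i * z k j - \<sigma>) / real n - mx * my"
proof -
  have "(\<Sum>k<n. z k i) = real n * mx" "(\<Sum>k<n. z k j) = real n * my" using n_pos by (simp_all add: sample_mean_def)
  then have "(\<Sum>k<n. (z k i - mx) * (z k j - my)) = (\<Sum>k<n. z k i * z k j) - real n * mx * my"
    by (simp add: algebra_simps sum.distrib sum_subtractf sum_distrib_left[symmetric] sum_distrib_right[symmetric])
  then show ?thesis using n_pos by (simp add: sigma_hat_def sum_subtractf field_simps)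
qed

lemma mean_product_error_sq: "((\<Sum>k<n. z k i * z k j - \<sigma>) / real n)\<^sup>2 \<le> b * \<theta> / real n"
  using sum_xy n_pos by (simp add: power_divide field_simps power2_eq_square)

lemma sigma_hat_close: "\<bar>sh - \<sigma>\<bar> \<le> 2 * sqrt (b * \<theta> / real n)"
  unfolding sigma_hat_error using abs_le_sqrtI[OF mean_product_error_sq] abs_le_sqrtI[OF sample_mean_prod_sq] by linarith

text \<open>These are the cross terms left when the products are centred at the sample means. Each
  squared mean brings \<open>b / n\<close> and each sum of squares \<open>b n\<close>, so per
  observation a fraction \<open>4 b^2 / n \<le> 1 / 250\<close> of \<open>\<theta>\<close> is
  reached.\<close>

lemma sum_remainder_le: "(\<Sum>k<n. (mx * z k j + my * z k i)\<^sup>2) \<le> real n * (\<theta> / 250)"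
proof -
  have "(\<Sum>k<n. (mx * z k j + my * z k i)\<^sup>2) \<le> (\<Sum>k<n. 2 * mx\<^sup>2 * (z k j)\<^sup>2 + 2 * my\<^sup>2 * (z k i)\<^sup>2)"
  proof (rule sum_mono)
    fix k
    show "(mx * z k j + my * z k i)\<^sup>2 \<le> 2 * mx\<^sup>2 * (z k j)\<^sup>2 + 2 * my\<^sup>2 * (z k i)\<^sup>2"
      using sum_squares_bound[of "mx * z k j" "my * z k i"] by (simp add: power2_sum power_mult_distrib mult_ac)
  qed
  also have "\<dots> = 2 * mx\<^sup>2 * (\<Sum>k<n. (z k j)\<^sup>2) + 2 * my\<^sup>2 * (\<Sum>k<n. (z k i)\<^sup>2)"
    by (simp add: sum.distrib sum_distrib_left)
  also have "\<dots> \<le> 2 * (b * s / real n) * (b * real n * t) + 2 * (b * t / real n) * (b * real n * s)"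
    using b st n_pos by (intro add_mono mult_mono mult_left_mono sample_mean_sq_i sample_mean_sq_j sum_xx sum_yy sum_nonneg) auto
  also have "\<dots> = real n * (4 * (b\<^sup>2 / real n) * (s * t))" using n_pos by (simp add: field_simps power2_eq_square)
  also have "\<dots> \<le> real n * (4 * (1 / 1000) * \<theta>)"
    using n_pos st b_sq_n theta_pos by (intro mult_left_mono mult_mono) auto
  finally show ?thesis by simp
qed

lemma sum_error_sq_bounds: "9 / 10 * (real n * \<theta>) \<le> (\<Sum>k<n. (z k i * z k j - \<sigma>)\<^sup>2)" "(\<Sum>k<n. (z k i * z k j - \<sigma>)\<^sup>2) \<le> 11 / 10 * (real n * \<theta>)"
proof -
  have "\<bar>\<Sum>k<n. (z k i * z k j - \<sigma>)\<^sup>2 - \<theta>\<bar> \<le> real n * \<theta> / 10"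
    using sum_sq theta_pos by (simp add: power2_le_iff_abs_le)
  then have "\<bar>(\<Sum>k<n. (z k i * z k j - \<sigma>)\<^sup>2) - real n * \<theta>\<bar> \<le> real n * \<theta> / 10"
    by (simp add: sum_subtractf)
  then show "9 / 10 * (real n * \<theta>) \<le> (\<Sum>k<n. (z k i * z k j - \<sigma>)\<^sup>2)" "(\<Sum>k<n. (z k i * z k j - \<sigma>)\<^sup>2) \<le> 11 / 10 * (real n * \<theta>)"
    by linarith+
qed

text \<open>The mean minimises the sum of squared deviations, so \<open>sh\<close> may be replaced
  by any constant. With \<open>\<sigma> + mx my\<close> the deviations are those about
  \<open>\<sigma>\<close> minus the cross terms, which gives
  \<open>(11/8 + 1/50) \<theta>\<close>.\<close>

lemma theta_hat_le: "th \<le> 2 * \<theta>"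
proof -
  let ?z = "\<lambda>k. (z k i - mx) * (z k j - my)" and ?c = "\<sigma> + mx * my"
  have m: "(\<Sum>k<n. ?z k) = real n * sh" using n_pos by (simp add: sigma_hat_def)
  have "(\<Sum>k<n. (?z k - ?c)\<^sup>2) = (\<Sum>k<n. (?z k - sh)\<^sup>2 + 2 * (sh - ?c) * (?z k - sh) + (sh - ?c)\<^sup>2)"
    by (intro sum.cong refl) (simp add: power2_eq_square algebra_simps)
  also have "\<dots> = (\<Sum>k<n. (?z k - sh)\<^sup>2) + 2 * (sh - ?c) * (\<Sum>k<n. ?z k - sh) + real n * (sh - ?c)\<^sup>2"
    by (simp only: sum.distrib sum_distrib_left[symmetric]) simp
  also have "(\<Sum>k<n. ?z k - sh) = 0" using m by (simp add: sum_subtractf)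
  finally have "(\<Sum>k<n. (?z k - sh)\<^sup>2) \<le> (\<Sum>k<n. (?z k - ?c)\<^sup>2)" using n_pos by simp
  also have "\<dots> \<le> (\<Sum>k<n. 5 / 4 * (z k i * z k j - \<sigma>)\<^sup>2 + 5 * (mx * z k j + my * z k i)\<^sup>2)"
  proof (rule sum_mono)
    fix k
    \<comment> \<open>The weights 5/4 and 5 keep the factor of the main term close to 1, because the
      total has to stay below 2.\<close>
    have *: "(u - v)\<^sup>2 \<le> 5 / 4 * u\<^sup>2 + 5 * v\<^sup>2" for u v :: real
      using zero_le_power2[of "u / 2 + 2 * v"] by (simp add: power2_eq_square algebra_simps)
    have "?z k - ?c = (z k i * z k j - \<sigma>) - (mx * z k j + my * z k i)" by (simp add: algebra_simps)
    then show "(?z k - ?c)\<^sup>2 \<le> 5 / 4 * (z k i * z k j - \<sigma>)\<^sup>2 + 5 * (mx * z k j + my * z k i)\<^sup>2" by (simp only: *)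
  qed
  also have "\<dots> \<le> 5 / 4 * (11 / 10 * (real n * \<theta>)) + 5 * (real n * (\<theta> / 250))"
    unfolding sum.distrib sum_distrib_left[symmetric] by (intro add_mono mult_left_mono sum_error_sq_bounds sum_remainder_le) auto
  also have "\<dots> \<le> real n * (2 * \<theta>)" using n_pos theta_pos by simp
  finally show ?thesis unfolding theta_hat_def using n_pos by (simp add: field_simps)
qed

text \<open>If \<open>th\<close> were not positive, the squared deviations about
  \<open>\<sigma>\<close> would consist of terms that are small against \<open>n \<theta>\<close>.
  Positivity guards the division in \<open>M_stat\<close>, where a zero denominator would make the
  entry \<open>0\<close>.\<close>

lemma theta_hat_pos: "0 < th"
proof -
  let ?z = "\<lambda>k. (z k i - mx) * (z k j - my)" and ?t = "sh - \<sigma> - mx * my"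
  have "?t\<^sup>2 \<le> 9 * (b * \<theta> / real n)"
  proof -
    have "\<bar>?t\<bar> \<le> 3 * sqrt (b * \<theta> / real n)"
      unfolding sigma_hat_error using abs_le_sqrtI[OF mean_product_error_sq] abs_le_sqrtI[OF sample_mean_prod_sq] by linarith
    then have "\<bar>?t\<bar>\<^sup>2 \<le> (3 * sqrt (b * \<theta> / real n))\<^sup>2" by (intro power_mono) auto
    then show ?thesis using b theta_pos n_pos by (simp add: power_mult_distrib)
  qed
  also have "\<dots> \<le> 9 * (1 / 1000 * \<theta>)"
  proof -
    have "b / real n \<le> b\<^sup>2 / real n" using b n_pos by (intro divide_right_mono self_le_power) auto
    then have "b / real n \<le> 1 / 1000" using b_sq_n by linarith
    then have "b / real n * \<theta> \<le> 1 / 1000 * \<theta>" using theta_pos by (intro mult_right_mono) auto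
    then show ?thesis by simp
  qed
  finally have t: "?t\<^sup>2 \<le> 9 * (1 / 1000 * \<theta>)" .
  have "9 / 10 * (real n * \<theta>) \<le> (\<Sum>k<n. 3 * (?z k - sh)\<^sup>2 + 3 * (mx * z k j + my * z k i)\<^sup>2 + 3 * ?t\<^sup>2)"
  proof (rule order_trans[OF sum_error_sq_bounds(1)], rule sum_mono)
    fix k
    have *: "(u + v + w)\<^sup>2 \<le> 3 * u\<^sup>2 + 3 * v\<^sup>2 + 3 * w\<^sup>2" for u v w :: real
      using sum_squares_bound[of u v] sum_squares_bound[of u w] sum_squares_bound[of v w]
      by (simp add: power2_eq_square algebra_simps)
    have "z k i * z k j - \<sigma> = (?z k - sh) + (mx * z k j + my * z k i) + ?t" by (simp add: algebra_simps)
    then show "(z k i * z k j - \<sigma>)\<^sup>2 \<le> 3 * (?z k - sh)\<^sup>2 + 3 * (mx * z k j + my * z k i)\<^sup>2 + 3 * ?t\<^sup>2" by (simp only: *)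
  qed
  also have "\<dots> = 3 * (real n * th) + 3 * (\<Sum>k<n. (mx * z k j + my * z k i)\<^sup>2) + real n * (3 * ?t\<^sup>2)"
    unfolding sum.distrib sum_distrib_left[symmetric] theta_hat_def using n_pos by simp
  also have "\<dots> \<le> 3 * (real n * th) + 3 * (real n * (\<theta> / 250)) + real n * (3 * (9 * (1 / 1000 * \<theta>)))"
    using n_pos t by (intro add_mono mult_left_mono sum_remainder_le) auto
  finally have "9 / 10 * (real n * \<theta>) \<le> 3 * (real n * th) + 12 / 1000 * (real n * \<theta>) + 27 / 1000 * (real n * \<theta>)" by simp
  moreover have "0 < real n * \<theta>" using n_pos theta_pos by simp
  ultimately have "0 < real n * th" by linarith
  then show ?thesis using n_pos by (simp add: zero_less_mult_iff)
qed

end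

section \<open>The probability that one entry is well estimated\<close>

context independent_vectors
begin

text \<open>Markov's inequality with a union bound. Measurability is part of the result because the
  event reappears as the good event \<open>G\<close> of later lemmas.\<close>

lemma markov_all:
  assumes T: "finite T" and f: "\<And>t. t \<in> T \<Longrightarrow> rv J (f t)" and nn: "\<And>t \<omega>. t \<in> T \<Longrightarrow> 0 \<le> f t \<omega>"
    and e: "\<And>t. t \<in> T \<Longrightarrow> expectation (f t) \<le> e t" and c: "\<And>t. t \<in> T \<Longrightarrow> 0 < c t"
  shows "{\<omega> \<in> space M. \<forall>t\<in>T. f t \<omega> \<le> c t} \<in> events"
    and "1 - (\<Sum>t\<in>T. e t / c t) \<le> prob {\<omega> \<in> space M. \<forall>t\<in>T. f t \<omega> \<le> c t}"
proof -
  have meas: "{\<omega> \<in> space M. c t < f t \<omega>} \<in> events" if "t \<in> T" for t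
  proof -
    have [measurable]: "f t \<in> borel_measurable M" using f[OF that] by (rule rv_measurable)
    show ?thesis by measurable
  qed
  let ?B = "\<Union>t\<in>T. {\<omega> \<in> space M. c t < f t \<omega>}"
  have B: "?B \<in> events" using T meas by (intro sets.finite_UN) auto
  have eq: "{\<omega> \<in> space M. \<forall>t\<in>T. f t \<omega> \<le> c t} = space M - ?B" by (auto simp: not_less)
  show "{\<omega> \<in> space M. \<forall>t\<in>T. f t \<omega> \<le> c t} \<in> events" unfolding eq using B by auto
  have "prob ?B \<le> (\<Sum>t\<in>T. prob {\<omega> \<in> space M. c t < f t \<omega>})"
    using T meas by (intro finite_measure_subadditive_finite) auto
  also have "\<dots> \<le> (\<Sum>t\<in>T. e t / c t)"
    by (intro sum_mono markov[OF f nn e c])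
  finally show "1 - (\<Sum>t\<in>T. e t / c t) \<le> prob {\<omega> \<in> space M. \<forall>t\<in>T. f t \<omega> \<le> c t}"
    unfolding eq prob_compl[OF B] by simp
qed

end

context gaussian_vectors
begin

text \<open>Distinct indices give independent centred summands, so only the diagonal remains. The
  function \<open>h\<close> takes the index in the family, which lets \<open>rv {u}\<close> state on
  what the summand depends.\<close>

lemma m2_sum_iid:
  assumes e: "sample e n s" and h: "\<And>u. u \<in> I \<Longrightarrow> rv {u} (h u)" and mean: "\<And>k. k < n \<Longrightarrow> expectation (h (e k)) = 0"
    and V: "\<And>k. k < n \<Longrightarrow> m2 (h (e k)) \<le> V" and V0: "0 \<le> V"
  shows "m2 (\<lambda>\<omega>. \<Sum>k<n. h (e k) \<omega>) \<le> real n * V"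
proof -
  have "m2 (\<lambda>\<omega>. \<Sum>k<n. h (e k) \<omega>) \<le> real n * 1 * V"
    unfolding m2_def
  proof (rule second_moment_sum_le[where J = I and B = "\<lambda>k. {k}"])
    fix k assume k: "k \<in> {..<n}"
    then have kI: "e k \<in> I" using sample_in[OF e] by auto
    show "rv I (h (e k))" using rv_mono[OF h[OF kI]] kI by simp
    show "expectation (\<lambda>\<omega>. (h (e k) \<omega>)\<^sup>2) \<le> V" using V[of k] k by (simp add: m2_def)
    fix l assume l: "l \<in> {..<n}" "l \<notin> {k}"
    then have lI: "e l \<in> I" using sample_in[OF e] by auto
    have "{e k} \<inter> {e l} = {}" using sample_neq[OF e, of k l] k l by auto
    from expectation_mult[OF h[OF kI] h[OF lI] this] mean[of k] k
    show "expectation (\<lambda>\<omega>. h (e k) \<omega> * h (e l) \<omega>) = 0" by simp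
  qed (use V0 in auto)
  then show ?thesis by simp
qed

text \<open>The six deterministic conditions hold together outside an event of probability at most
  \<open>90 / b\<close>: five of them fail with probability at most \<open>1 / b\<close> each, the
  last with at most \<open>84800 / n \<le> 84.8 / b\<close>.\<close>

lemma entry_estimates:
  assumes e: "sample e n s" and ij: "i < p" "j < p" and pos: "0 < s i i" "0 < s j j"
    and b: "1 \<le> b" and n: "1000 * b\<^sup>2 \<le> real n" and \<theta>: "\<theta> = s i i * s j j + (s i j)\<^sup>2"
  obtains G where "G \<in> events" "1 - 90 / b \<le> prob G"
    "\<And>\<omega>. \<omega> \<in> G \<Longrightarrow> \<bar>sigma_hat n (\<lambda>k. Z (e k) \<omega>) i j - s i j\<bar> \<le> 2 * sqrt (b * \<theta> / real n)"
    "\<And>\<omega>. \<omega> \<in> G \<Longrightarrow> 0 < theta_hat n (\<lambda>k. Z (e k) \<omega>) i j"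
    "\<And>\<omega>. \<omega> \<in> G \<Longrightarrow> theta_hat n (\<lambda>k. Z (e k) \<omega>) i j \<le> 2 * \<theta>"
proof -
  let ?x = "\<lambda>k \<omega>. Z (e k) \<omega> i" and ?y = "\<lambda>k \<omega>. Z (e k) \<omega> j" and ?w = "\<lambda>u \<omega>. Z u \<omega> i * Z u \<omega> j - s i j"
  have bb: "b \<le> b\<^sup>2" using b by (intro self_le_power) auto
  then have n0: "0 < real n" using n b by linarith
  have \<theta>0: "0 < \<theta>" and st: "s i i * s j j \<le> \<theta>" and s\<theta>: "(s i j)\<^sup>2 \<le> \<theta>" using pos by (simp_all add: \<theta> add_pos_nonneg)
  note I = sample_in[OF e] and Se = sample_S[OF e]
  have rvz: "rv {u} (\<lambda>\<omega>. Z u \<omega> a)" if "u \<in> I" "a < p" for u a using that by (intro rv_coord) auto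
  have rvw: "rv {u} (?w u)" if "u \<in> I" for u using that ij by (intro rv_diff rv_mult rvz rv_const) auto
  have var: "expectation (\<lambda>\<omega>. (Z (e k) \<omega> a)\<^sup>2) = s a a" if "k < n" "a < p" for k a
    using cov[of "e k" a a] that I Se by (simp add: power2_eq_square)
  have Wmom: "expectation (\<lambda>\<omega>. (Z (e k) \<omega> i * Z (e k) \<omega> j)\<^sup>2) = \<theta> + (s i j)\<^sup>2" if "k < n" for k
  proof -
    have sym: "s j i = s i j" using cov[of "e k" i j] cov[of "e k" j i] that I Se ij by (simp add: mult.commute)
    show ?thesis using fourth[of "e k" i j i j] that I Se ij by (simp add: power2_eq_square \<theta> sym)
  qed
  have w_mean: "expectation (?w (e k)) = 0" if "k < n" for k
    using cov[of "e k" i j] that I Se ij rv_integrable[OF rv_mult[OF rvz[of "e k" i] rvz[of "e k" j]]] by (simp add: prob_space)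
  have w_var: "expectation (\<lambda>\<omega>. (?w (e k) \<omega>)\<^sup>2) = \<theta>" if k: "k < n" for k
  proof -
    have r: "rv {e k} (\<lambda>\<omega>. Z (e k) \<omega> i * Z (e k) \<omega> j)" using I k ij by (intro rv_mult rvz) auto
    have "expectation (\<lambda>\<omega>. (?w (e k) \<omega>)\<^sup>2) = expectation (\<lambda>\<omega>. (Z (e k) \<omega> i * Z (e k) \<omega> j)\<^sup>2
        - 2 * s i j * (Z (e k) \<omega> i * Z (e k) \<omega> j) + (s i j)\<^sup>2)"
      by (intro Bochner_Integration.integral_cong refl) (simp add: power2_diff mult_ac)
    also have "\<dots> = \<theta>"
      using rv_integrable[OF r] rv_powers[OF r, of 2] Wmom[OF k] cov[of "e k" i j] k I Se ij
      by (simp add: prob_space power2_eq_square)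
    finally show ?thesis .
  qed
  have w_fourth: "m2 (\<lambda>\<omega>. (?w (e k) \<omega>)\<^sup>2 - \<theta>) \<le> 848 * \<theta>\<^sup>2" if k: "k < n" for k
  proof -
    \<comment> \<open>The ratio \<open>?q\<close> balances the two eighth moments: after
      \<open>u v \<le> (u^2 + v^2) / 2\<close> both give \<open>105 (s i i * s j j)^2\<close>. The
      total 848 is \<open>8 * 105 + 8\<close>.\<close>
    let ?a = "\<lambda>\<omega>. Z (e k) \<omega> i" and ?c = "\<lambda>\<omega>. Z (e k) \<omega> j" and ?q = "s j j / s i i"
    have ek: "e k \<in> I" using I k by simp
    have q: "0 < ?q" using pos by simp
    have i8: "integrable M (\<lambda>\<omega>. ?a \<omega> ^ 8)" "integrable M (\<lambda>\<omega>. ?c \<omega> ^ 8)" using moments[OF ek] ij by auto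
    have i2: "integrable M (\<lambda>\<omega>. (?w (e k) \<omega>)\<^sup>2)" "integrable M (\<lambda>\<omega>. ((?w (e k) \<omega>)\<^sup>2)\<^sup>2)"
      using rv_powers[OF rvw[OF ek], of 2] rv_powers[OF rv_power[OF rvw[OF ek]], of 2 2] by auto
    have "m2 (\<lambda>\<omega>. (?w (e k) \<omega>)\<^sup>2 - \<theta>) = expectation (\<lambda>\<omega>. ((?w (e k) \<omega>)\<^sup>2)\<^sup>2 - 2 * \<theta> * (?w (e k) \<omega>)\<^sup>2 + \<theta>\<^sup>2)"
      unfolding m2_def by (intro Bochner_Integration.integral_cong refl) (simp add: power2_diff mult_ac)
    also have "\<dots> = expectation (\<lambda>\<omega>. ((?w (e k) \<omega>)\<^sup>2)\<^sup>2) - \<theta>\<^sup>2"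
      using i2 w_var[OF k] by (simp add: prob_space power2_eq_square)
    also have "\<dots> \<le> expectation (\<lambda>\<omega>. ((?w (e k) \<omega>)\<^sup>2)\<^sup>2)" by simp
    also have "\<dots> \<le> expectation (\<lambda>\<omega>. 4 * (?q\<^sup>2 * ?a \<omega> ^ 8 + (1 / ?q)\<^sup>2 * ?c \<omega> ^ 8) + 8 * \<theta>\<^sup>2)"
    proof (rule integral_mono[OF i2(2)])
      show "integrable M (\<lambda>\<omega>. 4 * (?q\<^sup>2 * ?a \<omega> ^ 8 + (1 / ?q)\<^sup>2 * ?c \<omega> ^ 8) + 8 * \<theta>\<^sup>2)"
        using i8 by (intro Bochner_Integration.integrable_add integrable_mult_right integrable_const)
      fix \<omega>
      let ?u = "?a \<omega> * ?c \<omega>"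
      have sq: "(v + w)\<^sup>2 \<le> 2 * v\<^sup>2 + 2 * w\<^sup>2" for v w :: real
        using sum_squares_bound[of v w] by (simp add: power2_sum)
      have "(?w (e k) \<omega>)\<^sup>2 \<le> 2 * ?u\<^sup>2 + 2 * (s i j)\<^sup>2" using sq[of ?u "- s i j"] by simp
      then have "((?w (e k) \<omega>)\<^sup>2)\<^sup>2 \<le> (2 * ?u\<^sup>2 + 2 * (s i j)\<^sup>2)\<^sup>2" by (intro power_mono) auto
      also have "\<dots> \<le> 2 * (2 * ?u\<^sup>2)\<^sup>2 + 2 * (2 * (s i j)\<^sup>2)\<^sup>2" by (rule sq)
      also have "\<dots> = 8 * (?u\<^sup>2)\<^sup>2 + 8 * ((s i j)\<^sup>2)\<^sup>2" by (simp add: power_mult_distrib)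
      also have "((s i j)\<^sup>2)\<^sup>2 \<le> \<theta>\<^sup>2" using s\<theta> by (intro power_mono) auto
      also have "(?u\<^sup>2)\<^sup>2 = (?q * ?a \<omega> ^ 4) * (1 / ?q * ?c \<omega> ^ 4)"
        using pos by (simp add: power_mult_distrib power_mult[symmetric] mult_ac)
      also have "\<dots> \<le> ((?q * ?a \<omega> ^ 4)\<^sup>2 + (1 / ?q * ?c \<omega> ^ 4)\<^sup>2) / 2" by (rule le_half_sum_squares)
      also have "\<dots> = (?q\<^sup>2 * ?a \<omega> ^ 8 + (1 / ?q)\<^sup>2 * ?c \<omega> ^ 8) / 2"
        by (simp add: power_mult_distrib power_divide power_mult[symmetric])
      finally show "((?w (e k) \<omega>)\<^sup>2)\<^sup>2 \<le> 4 * (?q\<^sup>2 * ?a \<omega> ^ 8 + (1 / ?q)\<^sup>2 * ?c \<omega> ^ 8) + 8 * \<theta>\<^sup>2" by linarith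
    qed
    also have "\<dots> = 4 * (?q\<^sup>2 * (105 * s i i ^ 4) + (1 / ?q)\<^sup>2 * (105 * s j j ^ 4)) + 8 * \<theta>\<^sup>2"
      using i8 eighth[OF ek ij(1)] eighth[OF ek ij(2)] Se[OF k]
      by (simp only: Bochner_Integration.integral_add Bochner_Integration.integrable_add integrable_mult_right
        Bochner_Integration.integral_mult_right_zero integrable_const lebesgue_integral_const prob_space scaleR_one)
    also have "\<dots> = 840 * (s i i * s j j)\<^sup>2 + 8 * \<theta>\<^sup>2"
      using pos by (simp add: field_simps power2_eq_square power4_eq_xxxx)
    also have "(s i i * s j j)\<^sup>2 \<le> \<theta>\<^sup>2" using st pos by (intro power_mono) auto
    finally show ?thesis by simp
  qed
  \<comment> \<open>\<open>f\<close> lists the six quantities in the order of the deterministic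
    conditions, \<open>E\<close> bounds their expectations, and \<open>c\<close> holds the
    thresholds.\<close>
  define f where "f = (\<lambda>t::nat. if t = 0 then (\<lambda>\<omega>. (\<Sum>k<n. ?x k \<omega>)\<^sup>2) else if t = 1 then (\<lambda>\<omega>. (\<Sum>k<n. ?y k \<omega>)\<^sup>2)
    else if t = 2 then (\<lambda>\<omega>. \<Sum>k<n. (?x k \<omega>)\<^sup>2) else if t = 3 then (\<lambda>\<omega>. \<Sum>k<n. (?y k \<omega>)\<^sup>2)
    else if t = 4 then (\<lambda>\<omega>. (\<Sum>k<n. ?w (e k) \<omega>)\<^sup>2) else (\<lambda>\<omega>. (\<Sum>k<n. (?w (e k) \<omega>)\<^sup>2 - \<theta>)\<^sup>2))"
  define E where "E = (\<lambda>t::nat. if t = 0 then real n * s i i else if t = 1 then real n * s j j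
    else if t = 2 then real n * s i i else if t = 3 then real n * s j j else if t = 4 then real n * \<theta> else real n * (848 * \<theta>\<^sup>2))"
  define c where "c = (\<lambda>t::nat. if t = 0 then b * real n * s i i else if t = 1 then b * real n * s j j
    else if t = 2 then b * real n * s i i else if t = 3 then b * real n * s j j else if t = 4 then b * real n * \<theta> else (real n * \<theta> / 10)\<^sup>2)"
  let ?T = "{0, 1, 2, 3, 4, 5::nat}"
  have rvI: "rv I g" if "rv {e k} g" "k < n" for g k using rv_mono[OF that(1)] I[OF that(2)] by simp
  have rvzI: "rv I (\<lambda>\<omega>. Z (e k) \<omega> a)" if "k < n" "a < p" for k a using rvI[OF rvz] I that by blast
  have rvwI: "rv I (?w (e k))" if "k < n" for k using rvI[OF rvw] I that by blast
  have rvf: "rv I (f t)" for t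
    unfolding f_def using ij by (auto intro!: rv_power rv_sum rvzI rv_diff[OF rv_power rv_const] rvwI)
  have "rv I (f t)" "\<And>\<omega>. 0 \<le> f t \<omega>" "expectation (f t) \<le> E t" "0 < c t" if "t \<in> ?T" for t
  proof -
    show "rv I (f t)" by (rule rvf)
    show "0 \<le> f t \<omega>" for \<omega> by (auto simp: f_def intro!: sum_nonneg)
    show "0 < c t" using n0 pos \<theta>0 b by (auto simp: c_def)
    have 1: "m2 (\<lambda>\<omega>. \<Sum>k<n. Z (e k) \<omega> a) \<le> real n * s a a" if "a < p" "0 < s a a" for a
      using that by (intro m2_sum_iid[OF e, where h = "\<lambda>u \<omega>. Z u \<omega> a"]) (auto simp: rvz mean I m2_def var)
    have 2: "expectation (\<lambda>\<omega>. \<Sum>k<n. (Z (e k) \<omega> a)\<^sup>2) = real n * s a a" if "a < p" for a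
      using that rv_powers[OF rvz[OF I]] by (simp add: var)
    have 3: "m2 (\<lambda>\<omega>. \<Sum>k<n. ?w (e k) \<omega>) \<le> real n * \<theta>"
      using \<theta>0 by (intro m2_sum_iid[OF e, where h = ?w]) (auto simp: rvw w_mean m2_def w_var)
    have "expectation (\<lambda>\<omega>. (?w (e k) \<omega>)\<^sup>2 - \<theta>) = 0" if "k < n" for k
      using w_var[OF that] rv_powers[OF rvw[OF I[OF that]], of 2] by (simp add: prob_space)
    then have 4: "m2 (\<lambda>\<omega>. \<Sum>k<n. (?w (e k) \<omega>)\<^sup>2 - \<theta>) \<le> real n * (848 * \<theta>\<^sup>2)"
      by (intro m2_sum_iid[OF e, where h = "\<lambda>u \<omega>. (?w u \<omega>)\<^sup>2 - \<theta>"] w_fourth rv_diff rv_power rvw rv_const) auto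
    show "expectation (f t) \<le> E t"
      using that 1[OF ij(1) pos(1)] 1[OF ij(2) pos(2)] 2[OF ij(1)] 2[OF ij(2)] 3 4
      by (auto simp: f_def E_def m2_def)
  qed
  note G = markov_all[of ?T I f E c, OF _ this]
  show thesis
  proof (rule that)
    let ?G = "{\<omega> \<in> space M. \<forall>t\<in>?T. f t \<omega> \<le> c t}"
    show "?G \<in> events" by (rule G(1)) auto
    have "(\<Sum>t\<in>?T. E t / c t) = 5 / b + 84800 / real n"
      using n0 pos \<theta>0 b by (simp add: E_def c_def field_simps power2_eq_square)
    also have "84800 / real n \<le> 84800 / (1000 * b)"
      using n0 b bb n by (intro divide_left_mono mult_pos_pos) auto
    also have "5 / b + 84800 / (1000 * b) \<le> 90 / b" using b by (simp add: field_simps)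
    finally have "1 - 90 / b \<le> 1 - (\<Sum>t\<in>?T. E t / c t)" by simp
    also have "\<dots> \<le> prob ?G" by (rule G(2)) auto
    finally show "1 - 90 / b \<le> prob ?G" .
    fix \<omega> assume "\<omega> \<in> ?G"
    then have g: "(\<Sum>k<n. ?x k \<omega>)\<^sup>2 \<le> b * real n * s i i" "(\<Sum>k<n. ?y k \<omega>)\<^sup>2 \<le> b * real n * s j j"
      "(\<Sum>k<n. (?x k \<omega>)\<^sup>2) \<le> b * real n * s i i" "(\<Sum>k<n. (?y k \<omega>)\<^sup>2) \<le> b * real n * s j j"
      "(\<Sum>k<n. ?x k \<omega> * ?y k \<omega> - s i j)\<^sup>2 \<le> b * real n * \<theta>"
      "(\<Sum>k<n. (?x k \<omega> * ?y k \<omega> - s i j)\<^sup>2 - \<theta>)\<^sup>2 \<le> (real n * \<theta> / 10)\<^sup>2"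
      by (simp_all add: f_def c_def)
    note facts = n b pos st g
    show "\<bar>sigma_hat n (\<lambda>k. Z (e k) \<omega>) i j - s i j\<bar> \<le> 2 * sqrt (b * \<theta> / real n)"
      by (rule sigma_hat_close[OF facts])
    show "0 < theta_hat n (\<lambda>k. Z (e k) \<omega>) i j" by (rule theta_hat_pos[OF facts])
    show "theta_hat n (\<lambda>k. Z (e k) \<omega>) i j \<le> 2 * \<theta>" by (rule theta_hat_le[OF facts])
  qed
qed

section \<open>The standardised quadratic form statistic\<close>

lemma rv_A_stat:
  assumes e: "sample e n s" and n: "2 \<le> n"
  shows "rv I (\<lambda>\<omega>. A_stat p n (\<lambda>u. Z (e u) \<omega>))"
  unfolding A_stat_expand[OF e n]
  by (intro rv_add rv_cmult rv_const rv_A_rest[OF e] rv_stats(1)[OF e e]) auto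

lemma rv_T_stat:
  assumes e: "sample e n s" and f: "sample f m r" and n: "2 \<le> n" "2 \<le> m"
  shows "rv I (\<lambda>\<omega>. T_stat p n m (\<lambda>u. Z (e u) \<omega>) (\<lambda>v. Z (f v) \<omega>))"
proof -
  have "0 < n" "0 < m" using n by auto
  note C = C_stat_expand[OF e f this]
  show ?thesis unfolding T_stat_def C
    by (intro rv_add rv_diff rv_cmult rv_const rv_A_stat[OF e n(1)] rv_A_stat[OF f n(2)] rv_C_rest[OF e f]
      rv_stats(1)[OF e f] rv_stats(1)[OF f e]) auto
qed

text \<open>Each statistic is allowed an error of half its target. Then \<open>T_stat\<close> is at
  least \<open>d / 2\<close> and \<open>sigma0_hat\<close> lies between \<open>0\<close> and
  \<open>3 N\<close>, so the ratio is at least \<open>d / (6 N)\<close>. The constants in the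
  probability are those of the second moment bounds times 4.\<close>

lemma ratio_large:
  assumes e: "sample e n s" and f: "sample f m r" and ef: "\<And>u v. u < n \<Longrightarrow> v < m \<Longrightarrow> e u \<noteq> f v"
    and n: "6 \<le> n" and m: "6 \<le> m"
    and d: "d = frob_sq p (\<lambda>a b. s a b - r a b)" and N: "N = frob_sq p s / real n + frob_sq p r / real m"
    and pos: "0 < d" "0 < frob_sq p s" "0 < frob_sq p r"
  obtains G where "G \<in> events"
    "1 - (400000000 * ((N / d)\<^sup>2 + N / d) + 40000000 / real n + 40000000 / real m) \<le> prob G"
    "\<And>\<omega>. \<omega> \<in> G \<Longrightarrow> d / (6 * N) \<le> T_stat p n m (\<lambda>u. Z (e u) \<omega>) (\<lambda>v. Z (f v) \<omega>)
       / sigma0_hat p n m (\<lambda>u. Z (e u) \<omega>) (\<lambda>v. Z (f v) \<omega>)"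
proof -
  let ?T = "\<lambda>\<omega>. T_stat p n m (\<lambda>u. Z (e u) \<omega>) (\<lambda>v. Z (f v) \<omega>)"
  let ?A = "\<lambda>\<omega>. A_stat p n (\<lambda>u. Z (e u) \<omega>)" and ?B = "\<lambda>\<omega>. A_stat p m (\<lambda>v. Z (f v) \<omega>)"
  let ?Ns = "frob_sq p s" and ?Nr = "frob_sq p r"
  have n0: "0 < real n" "0 < real m" "2 \<le> n" "2 \<le> m" using n m by auto
  define g where "g = (\<lambda>t::nat. if t = 0 then (\<lambda>\<omega>. (?T \<omega> - d)\<^sup>2) else if t = 1 then (\<lambda>\<omega>. (?A \<omega> - ?Ns)\<^sup>2) else (\<lambda>\<omega>. (?B \<omega> - ?Nr)\<^sup>2))"
  define E where "E = (\<lambda>t::nat. if t = 0 then 100000000 * (N\<^sup>2 + N * d) else if t = 1 then 10000000 * ?Ns\<^sup>2 / real n else 10000000 * ?Nr\<^sup>2 / real m)"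
  define c where "c = (\<lambda>t::nat. if t = 0 then (d / 2)\<^sup>2 else if t = 1 then (?Ns / 2)\<^sup>2 else (?Nr / 2)\<^sup>2)"
  let ?S = "{0, 1, 2::nat}"
  have "rv I (g t)" "\<And>\<omega>. 0 \<le> g t \<omega>" "expectation (g t) \<le> E t" "0 < c t" if "t \<in> ?S" for t
  proof -
    show "rv I (g t)" unfolding g_def using n0
      by (auto intro!: rv_power rv_diff rv_const rv_T_stat[OF e f] rv_A_stat[OF e] rv_A_stat[OF f])
    show "0 \<le> g t \<omega>" for \<omega> by (simp add: g_def)
    show "expectation (g t) \<le> E t"
      using m2_T_stat[OF e f ef n m d N] m2_A_stat[OF e n] m2_A_stat[OF f m] by (simp add: g_def E_def m2_def)
    show "0 < c t" using pos by (simp add: c_def)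
  qed
  note G = markov_all[of ?S I g E c, OF _ this]
  show thesis
  proof (rule that)
    let ?G = "{\<omega> \<in> space M. \<forall>t\<in>?S. g t \<omega> \<le> c t}"
    show "?G \<in> events" by (rule G(1)) auto
    have "(\<Sum>t\<in>?S. E t / c t) = 400000000 * ((N / d)\<^sup>2 + N / d) + 40000000 / real n + 40000000 / real m"
      using pos n0 by (simp add: E_def c_def field_simps power2_eq_square)
    with G(2) show "1 - (400000000 * ((N / d)\<^sup>2 + N / d) + 40000000 / real n + 40000000 / real m) \<le> prob ?G" by simp
    fix \<omega> assume "\<omega> \<in> ?G"
    then have *: "(?T \<omega> - d)\<^sup>2 \<le> (d / 2)\<^sup>2" "(?A \<omega> - ?Ns)\<^sup>2 \<le> (?Ns / 2)\<^sup>2" "(?B \<omega> - ?Nr)\<^sup>2 \<le> (?Nr / 2)\<^sup>2"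
      by (simp_all add: g_def c_def)
    have T: "d / 2 \<le> ?T \<omega>" and A: "?Ns / 2 \<le> ?A \<omega>" "?A \<omega> \<le> 3 / 2 * ?Ns" and B: "?Nr / 2 \<le> ?B \<omega>" "?B \<omega> \<le> 3 / 2 * ?Nr"
      using * pos by (simp_all only: abs_le_square_iff[symmetric] abs_le_iff) (linarith | simp add: abs_if)+
    let ?h = "sigma0_hat p n m (\<lambda>u. Z (e u) \<omega>) (\<lambda>v. Z (f v) \<omega>)"
    have "2 / real n * ?A \<omega> \<le> 2 / real n * (3 / 2 * ?Ns)" "2 / real m * ?B \<omega> \<le> 2 / real m * (3 / 2 * ?Nr)"
      using A B n0 by (intro mult_left_mono; simp)+
    then have h: "?h \<le> 3 * N" by (simp add: sigma0_hat_def N)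
    have h0: "0 < ?h" unfolding sigma0_hat_def using A B pos n0 by (intro add_pos_pos mult_pos_pos) auto
    have "d / (6 * N) = (d / 2) / (3 * N)" by simp
    also have "\<dots> \<le> (d / 2) / ?h" using pos h h0 by (intro divide_left_mono) auto
    also have "\<dots> \<le> ?T \<omega> / ?h" using T h0 by (intro divide_right_mono) auto
    finally show "d / (6 * N) \<le> ?T \<omega> / ?h" .
  qed
qed

end

subsection \<open>Power of the combined test\<close>

text \<open>Strictness matters because \<open>ln 0 = 0\<close>: a vanishing \<open>p_T\<close> would
  contribute nothing to \<open>F_stat\<close>. It holds since the density is positive on
  \<open>(x, x + 1)\<close>.\<close>

lemma std_normal_cdf_less_1: "cdf std_normal_distribution x < 1"
proof -
  interpret N: real_distribution std_normal_distribution by (rule real_dist_normal_dist)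
  have "{x<..} \<notin> null_sets std_normal_distribution"
  proof
    assume "{x<..} \<in> null_sets std_normal_distribution"
    then have "AE y in lborel. y \<in> {x<..} \<longrightarrow> ennreal (std_normal_density y) = 0"
      by (subst (asm) null_sets_density_iff) simp_all
    then have "AE y in lborel. y \<notin> {x<..}"
    proof (rule eventually_mono)
      fix y assume *: "y \<in> {x<..} \<longrightarrow> ennreal (std_normal_density y) = 0"
      have "0 < std_normal_density y" by (rule normal_density_pos) simp
      then have "ennreal (std_normal_density y) \<noteq> 0" by (simp add: ennreal_eq_0_iff)
      with * show "y \<notin> {x<..}" by blast
    qed
    then have "{x<..} \<in> null_sets lborel" by (subst AE_iff_null_sets) auto
    then have "emeasure lborel {x<..} = 0" by auto
    moreover have "emeasure lborel {x<..<x + 1} \<le> emeasure lborel {x<..}" by (intro emeasure_mono) auto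
    ultimately show False by simp
  qed
  then have "N.prob {x<..} \<noteq> 0" by (auto simp: N.emeasure_eq_measure null_sets_def)
  moreover have "N.prob {..x} = 1 - N.prob {x<..}"
  proof -
    have "space std_normal_distribution - {x<..} = {..x}" by auto
    then show ?thesis using N.prob_compl[of "{x<..}"] by simp
  qed
  ultimately show ?thesis by (simp add: cdf_def less_le)
qed

lemma gumbel_cdf_bounds: "0 < gumbel_cdf x" "gumbel_cdf x < 1"
  by (simp_all add: gumbel_cdf_def)

lemma neg_two_ln_ge: "0 < y \<Longrightarrow> y < exp (- c / 2) \<Longrightarrow> c \<le> - 2 * ln y" for y c :: real
  using ln_less_cancel_iff[of y "exp (- c / 2)"] by simp

text \<open>One summand reaches \<open>c\<close> because its p-value is small, and the other is
  non-negative because a p-value is at most \<open>1\<close>. The threshold \<open>L\<close> depends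
  on \<open>c\<close> only, which makes it usable along sequences of dimensions.\<close>

lemma F_stat_ge:
  obtains L where "\<And>p n1 n2 x y. L \<le> T_stat p n1 n2 x y / sigma0_hat p n1 n2 x y \<Longrightarrow> c \<le> F_stat p n1 n2 x y"
    and "\<And>p n1 n2 x y. L \<le> M_stat p n1 n2 x y - 4 * ln (real p) + ln (ln (real p)) \<Longrightarrow> c \<le> F_stat p n1 n2 x y"
proof -
  interpret N: real_distribution std_normal_distribution by (rule real_dist_normal_dist)
  let ?\<Phi> = "cdf std_normal_distribution"
  have "\<forall>\<^sub>F x in at_top. 1 - exp (- c / 2) < ?\<Phi> x"
    using order_tendstoD(1)[OF N.cdf_lim_at_top_prob, of "1 - exp (- c / 2)"] by simp
  then obtain L1 where L1: "\<And>x. L1 \<le> x \<Longrightarrow> 1 - exp (- c / 2) < ?\<Phi> x"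
    by (auto simp: eventually_at_top_linorder)
  have "(gumbel_cdf \<longlongrightarrow> 1) at_top" unfolding gumbel_cdf_def by real_asymp
  from order_tendstoD(1)[OF this, of "1 - exp (- c / 2)"]
  obtain L2 where L2: "\<And>x. L2 \<le> x \<Longrightarrow> 1 - exp (- c / 2) < gumbel_cdf x"
    by (auto simp: eventually_at_top_linorder)
  have nn: "0 \<le> - 2 * ln (1 - ?\<Phi> x)" "0 \<le> - 2 * ln (1 - gumbel_cdf x)" for x
    using std_normal_cdf_less_1[of x] N.cdf_nonneg[of x] gumbel_cdf_bounds[of x] by (simp_all add: ln_le_zero_iff)
  show thesis
  proof (rule that[of "max L1 L2"])
    fix p n1 n2 x y
    assume "max L1 L2 \<le> T_stat p n1 n2 x y / sigma0_hat p n1 n2 x y"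
    then have "c \<le> - 2 * ln (p_T p n1 n2 x y)"
      unfolding p_T_def using L1 std_normal_cdf_less_1 by (intro neg_two_ln_ge) (auto simp: algebra_simps)
    then show "c \<le> F_stat p n1 n2 x y" using nn(2) unfolding F_stat_def p_M_def by (smt (verit))
  next
    fix p n1 n2 x y
    assume "max L1 L2 \<le> M_stat p n1 n2 x y - 4 * ln (real p) + ln (ln (real p))"
    then have "1 - exp (- c / 2) < gumbel_cdf (M_stat p n1 n2 x y - 4 * ln (real p) + ln (ln (real p)))"
      by (intro L2) simp
    then have "c \<le> - 2 * ln (p_M p n1 n2 x y)"
      unfolding p_M_def using gumbel_cdf_bounds by (intro neg_two_ln_ge) (simp, linarith)
    then show "c \<le> F_stat p n1 n2 x y" using nn(1) unfolding F_stat_def p_T_def by (smt (verit))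
  qed
qed

text \<open>Turns the set inside \<open>Max\<close> into the image of a fixed finite index set, the
  form in which a maximum of measurable functions is measurable.\<close>

lemma image_upper_triangle:
  "(\<lambda>t. g (fst t) (snd t)) ` {(i, j). i \<le> j \<and> j < p} = {g i j | i j. i \<le> j \<and> j < (p::nat)}"
  by force

lemma finite_upper_triangle: "finite {(i, j). i \<le> j \<and> j < (p::nat)}"
  by (rule finite_subset[of _ "{..<p} \<times> {..<p}"]) auto

lemma finite_image_upper_triangle: "finite {g i j | i j. i \<le> j \<and> j < (p::nat)}"
  unfolding image_upper_triangle[symmetric] by (intro finite_imageI finite_upper_triangle)

section \<open>Measurability of the combined statistic and size of the maximum\<close>

context gaussian_vectors
begin

lemma rv_sample_mean:
  assumes e: "sample e n s" and "i < p" shows "rv I (\<lambda>\<omega>. sample_mean n (\<lambda>u. Z (e u) \<omega>) i)"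
  unfolding sample_mean_def using assms sample_in[OF e] by (intro rv_cmult rv_sum rv_coord) auto

lemma rv_sigma_hat:
  assumes e: "sample e n s" and "i < p" "j < p" shows "rv I (\<lambda>\<omega>. sigma_hat n (\<lambda>u. Z (e u) \<omega>) i j)"
  unfolding sigma_hat_def using assms sample_in[OF e]
  by (intro rv_cmult rv_sum rv_mult rv_diff rv_coord rv_sample_mean[OF e]) auto

lemma rv_theta_hat:
  assumes e: "sample e n s" and "i < p" "j < p" shows "rv I (\<lambda>\<omega>. theta_hat n (\<lambda>u. Z (e u) \<omega>) i j)"
  unfolding theta_hat_def using assms sample_in[OF e]
  by (intro rv_cmult rv_sum rv_power rv_mult rv_diff rv_coord rv_sample_mean[OF e] rv_sigma_hat[OF e]) auto

text \<open>The probability of a good event is compared with that of \<open>c \<le> F_stat\<close>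
  by monotonicity, and a non-measurable set would have measure \<open>0\<close>.\<close>

lemma F_stat_measurable:
  assumes e: "sample e n s" and f: "sample f m r" and n: "2 \<le> n" "2 \<le> m"
  shows "(\<lambda>\<omega>. F_stat p n m (\<lambda>u. Z (e u) \<omega>) (\<lambda>v. Z (f v) \<omega>)) \<in> borel_measurable M"
proof -
  interpret N: real_distribution std_normal_distribution by (rule real_dist_normal_dist)
  have cdf [measurable]: "cdf std_normal_distribution \<in> borel_measurable borel"
    by (intro borel_measurable_mono monoI N.cdf_nondecreasing)
  have gumbel [measurable]: "gumbel_cdf \<in> borel_measurable borel"
    unfolding gumbel_cdf_def[abs_def] by measurable
  have T [measurable]: "(\<lambda>\<omega>. T_stat p n m (\<lambda>u. Z (e u) \<omega>) (\<lambda>v. Z (f v) \<omega>)) \<in> borel_measurable M"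
    by (rule rv_measurable[OF rv_T_stat[OF e f n]])
  have [measurable]: "(\<lambda>\<omega>. A_stat p n (\<lambda>u. Z (e u) \<omega>)) \<in> borel_measurable M" "(\<lambda>\<omega>. A_stat p m (\<lambda>u. Z (f u) \<omega>)) \<in> borel_measurable M"
    using rv_measurable[OF rv_A_stat[OF e n(1)]] rv_measurable[OF rv_A_stat[OF f n(2)]] by auto
  have "(\<lambda>\<omega>. Max ((\<lambda>t. (\<lambda>\<omega>. (sigma_hat n (\<lambda>u. Z (e u) \<omega>) (fst t) (snd t) - sigma_hat m (\<lambda>v. Z (f v) \<omega>) (fst t) (snd t))\<^sup>2 /
      (theta_hat n (\<lambda>u. Z (e u) \<omega>) (fst t) (snd t) / real n + theta_hat m (\<lambda>v. Z (f v) \<omega>) (fst t) (snd t) / real m)) \<omega>)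
      ` {(i, j). i \<le> j \<and> j < p})) \<in> borel_measurable M"
  proof (rule borel_measurable_Max)
    show "finite {(i, j). i \<le> j \<and> j < p}" by (rule finite_upper_triangle)
    fix t assume "t \<in> {(i, j). i \<le> j \<and> j < p}"
    then have t: "fst t < p" "snd t < p" by auto
    note [measurable] = rv_measurable[OF rv_sigma_hat[OF e t]] rv_measurable[OF rv_sigma_hat[OF f t]]
      rv_measurable[OF rv_theta_hat[OF e t]] rv_measurable[OF rv_theta_hat[OF f t]]
    show "(\<lambda>\<omega>. (sigma_hat n (\<lambda>u. Z (e u) \<omega>) (fst t) (snd t) - sigma_hat m (\<lambda>v. Z (f v) \<omega>) (fst t) (snd t))\<^sup>2 /
      (theta_hat n (\<lambda>u. Z (e u) \<omega>) (fst t) (snd t) / real n + theta_hat m (\<lambda>v. Z (f v) \<omega>) (fst t) (snd t) / real m)) \<in> borel_measurable M"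
      by measurable
  qed
  also have "(\<lambda>\<omega>. Max ((\<lambda>t. (\<lambda>\<omega>. (sigma_hat n (\<lambda>u. Z (e u) \<omega>) (fst t) (snd t) - sigma_hat m (\<lambda>v. Z (f v) \<omega>) (fst t) (snd t))\<^sup>2 /
      (theta_hat n (\<lambda>u. Z (e u) \<omega>) (fst t) (snd t) / real n + theta_hat m (\<lambda>v. Z (f v) \<omega>) (fst t) (snd t) / real m)) \<omega>)
      ` {(i, j). i \<le> j \<and> j < p})) = (\<lambda>\<omega>. M_stat p n m (\<lambda>u. Z (e u) \<omega>) (\<lambda>v. Z (f v) \<omega>))"
    unfolding M_stat_def by (intro ext arg_cong[where f = Max] image_upper_triangle)
  finally have [measurable]: "(\<lambda>\<omega>. M_stat p n m (\<lambda>u. Z (e u) \<omega>) (\<lambda>v. Z (f v) \<omega>)) \<in> borel_measurable M" .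
  show ?thesis unfolding F_stat_def p_T_def p_M_def sigma0_hat_def by measurable
qed

text \<open>Any entry bounds the maximum from below. Of the signal \<open>4 sqrt (ln p)\<close>, in
  standard deviations, the two errors use up at most \<open>4 sqrt b \<le> sqrt (ln p)\<close>. The
  remaining \<open>3 sqrt (ln p)\<close> is squared and divided by a variance estimate of at most
  twice its target.\<close>

lemma M_stat_large:
  assumes e: "sample e n s" and f: "sample f m r" and ij: "i \<le> j" "j < p"
    and pos: "0 < s i i" "0 < s j j" "0 < r i i" "0 < r j j"
    and b: "1 \<le> b" and n: "1000 * b\<^sup>2 \<le> real n" and m: "1000 * b\<^sup>2 \<le> real m" and lp: "16 * b \<le> ln (real p)"
    and \<theta>1: "\<theta>1 = s i i * s j j + (s i j)\<^sup>2" and \<theta>2: "\<theta>2 = r i i * r j j + (r i j)\<^sup>2"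
    and large: "4 * sqrt (ln (real p)) \<le> \<bar>s i j - r i j\<bar> / sqrt (\<theta>1 / real n + \<theta>2 / real m)"
  obtains G where "G \<in> events" "1 - 180 / b \<le> prob G"
    "\<And>\<omega>. \<omega> \<in> G \<Longrightarrow> 9 / 2 * ln (real p) \<le> M_stat p n m (\<lambda>u. Z (e u) \<omega>) (\<lambda>v. Z (f v) \<omega>)"
proof -
  have ip: "i < p" using ij by simp
  obtain G1 where G1: "G1 \<in> events" "1 - 90 / b \<le> prob G1"
    "\<And>\<omega>. \<omega> \<in> G1 \<Longrightarrow> \<bar>sigma_hat n (\<lambda>k. Z (e k) \<omega>) i j - s i j\<bar> \<le> 2 * sqrt (b * \<theta>1 / real n)"
    "\<And>\<omega>. \<omega> \<in> G1 \<Longrightarrow> 0 < theta_hat n (\<lambda>k. Z (e k) \<omega>) i j"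
    "\<And>\<omega>. \<omega> \<in> G1 \<Longrightarrow> theta_hat n (\<lambda>k. Z (e k) \<omega>) i j \<le> 2 * \<theta>1"
    using entry_estimates[OF e ip ij(2) pos(1,2) b n \<theta>1] by blast
  obtain G2 where G2: "G2 \<in> events" "1 - 90 / b \<le> prob G2"
    "\<And>\<omega>. \<omega> \<in> G2 \<Longrightarrow> \<bar>sigma_hat m (\<lambda>k. Z (f k) \<omega>) i j - r i j\<bar> \<le> 2 * sqrt (b * \<theta>2 / real m)"
    "\<And>\<omega>. \<omega> \<in> G2 \<Longrightarrow> 0 < theta_hat m (\<lambda>k. Z (f k) \<omega>) i j"
    "\<And>\<omega>. \<omega> \<in> G2 \<Longrightarrow> theta_hat m (\<lambda>k. Z (f k) \<omega>) i j \<le> 2 * \<theta>2"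
    using entry_estimates[OF f ip ij(2) pos(3,4) b m \<theta>2] by blast
  have "1 * 1 \<le> b\<^sup>2" using b by simp
  then have n0: "0 < real n" "0 < real m" using n m by linarith+
  have \<theta>0: "0 < \<theta>1" "0 < \<theta>2" using pos by (simp_all add: \<theta>1 \<theta>2 add_pos_nonneg)
  define \<tau> where "\<tau> = \<theta>1 / real n + \<theta>2 / real m"
  have \<tau>: "0 < \<tau>" "\<theta>1 / real n \<le> \<tau>" "\<theta>2 / real m \<le> \<tau>" using n0 \<theta>0 by (simp_all add: \<tau>_def add_pos_pos)
  have l0: "0 \<le> ln (real p)" using lp b by linarith
  show thesis
  proof (rule that)
    show "G1 \<inter> G2 \<in> events" using G1 G2 by auto
    have "prob (space M - G1 \<inter> G2) \<le> prob ((space M - G1) \<union> (space M - G2))"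
      using G1(1) G2(1) by (intro finite_measure_mono) auto
    also have "\<dots> \<le> prob (space M - G1) + prob (space M - G2)"
      using G1(1) G2(1) by (intro measure_Un_le) auto
    finally show "1 - 180 / b \<le> prob (G1 \<inter> G2)"
      using G1(1,2) G2(1,2) prob_compl[of G1] prob_compl[of G2] prob_compl[of "G1 \<inter> G2"] by (simp add: sets.Int)
    fix \<omega> assume \<omega>: "\<omega> \<in> G1 \<inter> G2"
    let ?s = "sigma_hat n (\<lambda>k. Z (e k) \<omega>) i j" and ?r = "sigma_hat m (\<lambda>k. Z (f k) \<omega>) i j"
    let ?t = "theta_hat n (\<lambda>k. Z (e k) \<omega>) i j / real n + theta_hat m (\<lambda>k. Z (f k) \<omega>) i j / real m"
    have t: "0 < ?t" "?t \<le> 2 * \<tau>"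
    proof -
      show "0 < ?t" using G1(4) G2(4) \<omega> n0 by (intro add_pos_pos divide_pos_pos) auto
      have "?t \<le> 2 * \<theta>1 / real n + 2 * \<theta>2 / real m"
        using G1(5) G2(5) \<omega> by (intro add_mono divide_right_mono) auto
      then show "?t \<le> 2 * \<tau>" by (simp add: \<tau>_def)
    qed
    \<comment> \<open>The 16 in the condition on \<open>b\<close> is the square of 4, the total
      error of the two samples in units of \<open>sqrt b\<close>.\<close>
    have sb: "4 * sqrt b \<le> sqrt (ln (real p))"
      using real_sqrt_le_mono[OF lp] by (simp add: real_sqrt_mult)
    have "sqrt (b * \<theta>1 / real n) \<le> sqrt b * sqrt \<tau>" "sqrt (b * \<theta>2 / real m) \<le> sqrt b * sqrt \<tau>"
      unfolding real_sqrt_mult[symmetric] using \<tau>(2,3) b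
      by (auto simp: times_divide_eq_right[symmetric] simp del: times_divide_eq_right intro!: mult_left_mono)
    then have "\<bar>?s - s i j\<bar> \<le> 2 * (sqrt b * sqrt \<tau>)" "\<bar>?r - r i j\<bar> \<le> 2 * (sqrt b * sqrt \<tau>)"
      using G1(3)[of \<omega>] G2(3)[of \<omega>] \<omega> by auto
    moreover have "4 * sqrt (ln (real p)) * sqrt \<tau> \<le> \<bar>s i j - r i j\<bar>"
      using large \<tau>(1) by (simp add: \<tau>_def pos_le_divide_eq)
    moreover have "4 * sqrt b * sqrt \<tau> \<le> sqrt (ln (real p)) * sqrt \<tau>"
      using sb \<tau> by (intro mult_right_mono) auto
    ultimately have "3 * (sqrt (ln (real p)) * sqrt \<tau>) \<le> \<bar>?s - ?r\<bar>" by linarith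
    then have "(3 * (sqrt (ln (real p)) * sqrt \<tau>))\<^sup>2 \<le> \<bar>?s - ?r\<bar>\<^sup>2" using l0 \<tau> by (intro power_mono) auto
    then have "9 * (ln (real p) * \<tau>) \<le> (?s - ?r)\<^sup>2" using l0 \<tau> by (simp add: power_mult_distrib)
    then have "9 * (ln (real p) * \<tau>) / ?t \<le> (?s - ?r)\<^sup>2 / ?t" using t by (intro divide_right_mono) auto
    moreover have "9 * (ln (real p) * \<tau>) / (2 * \<tau>) \<le> 9 * (ln (real p) * \<tau>) / ?t"
      using t l0 \<tau> by (intro divide_left_mono) auto
    moreover have "9 * (ln (real p) * \<tau>) / (2 * \<tau>) = 9 / 2 * ln (real p)" using \<tau> by simp
    ultimately have "9 / 2 * ln (real p) \<le> (?s - ?r)\<^sup>2 / ?t" by linarith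
    also have "\<dots> \<le> M_stat p n m (\<lambda>u. Z (e u) \<omega>) (\<lambda>v. Z (f v) \<omega>)"
      unfolding M_stat_def
    by (rule Max_ge[OF finite_image_upper_triangle]) (use ij in blast)
    finally show "9 / 2 * ln (real p) \<le> M_stat p n m (\<lambda>u. Z (e u) \<omega>) (\<lambda>v. Z (f v) \<omega>)" .
  qed
qed

end

section \<open>From the stated laws to the Gaussian family\<close>

lemma gaussian_vectorsI:
  assumes P1: "pos_definite p S1" and P2: "pos_definite p S2"
    and N1: "is_mvnormal p S1 \<mu>1" and N2: "is_mvnormal p S2 \<mu>2"
    and X: "iid_samples M p n1 n2 \<mu>1 \<mu>2 X Y"
  shows "gaussian_vectors M ({..<n1} <+> {..<n2}) (case_sum X Y) p
    (case_sum (\<lambda>_ a b. S1 $$ (a, b)) (\<lambda>_ a b. S2 $$ (a, b)))"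
proof -
  let ?I = "{..<n1} <+> {..<n2}" and ?Z = "case_sum X Y"
  let ?S = "case_sum (\<lambda>_ a b. S1 $$ (a, b)) (\<lambda>_ a b. S2 $$ (a, b)) :: nat + nat \<Rightarrow> nat \<Rightarrow> nat \<Rightarrow> real"
  interpret prob_space M using X by (simp add: iid_samples_def)
  have indep: "indep_vars (\<lambda>_. vec_space p) ?Z ?I" using X by (simp add: iid_samples_def)
  have meas: "?Z u \<in> measurable M (vec_space p)" if "u \<in> ?I" for u
    using indep that by (simp add: indep_vars_def)
  \<comment> \<open>Both samples in one statement, so that the moments are transferred through
    \<open>distr\<close> once and not for each sample.\<close>
  have law: "\<exists>Q \<mu>. pos_definite p Q \<and> is_mvnormal p Q \<mu> \<and> distr M (vec_space p) (?Z u) = \<mu> \<and> (\<forall>a b. ?S u a b = Q $$ (a, b))"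
    if "u \<in> ?I" for u
    using that X P1 P2 N1 N2 by (cases u) (auto simp: iid_samples_def)
  have coord: "(\<lambda>x. x a) \<in> borel_measurable (vec_space p)" if "a < p" for a using that by simp
  have "integrable M (\<lambda>\<omega>. ?Z u \<omega> a ^ k) \<and> expectation (\<lambda>\<omega>. ?Z u \<omega> a) = 0 \<and> expectation (\<lambda>\<omega>. ?Z u \<omega> a ^ 8) = 105 * ?S u a a ^ 4
     \<and> (\<forall>b<p. expectation (\<lambda>\<omega>. ?Z u \<omega> a * ?Z u \<omega> b) = ?S u a b)
     \<and> (\<forall>b<p. \<forall>c<p. \<forall>d<p. expectation (\<lambda>\<omega>. ?Z u \<omega> a * ?Z u \<omega> b * (?Z u \<omega> c * ?Z u \<omega> d)) =
        ?S u a b * ?S u c d + ?S u a c * ?S u b d + ?S u a d * ?S u b c)" if u: "u \<in> ?I" and a: "a < p" for u a k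
  proof -
    obtain Q \<mu> where Q: "pos_definite p Q" "is_mvnormal p Q \<mu>" "distr M (vec_space p) (?Z u) = \<mu>" "\<And>a b. ?S u a b = Q $$ (a, b)"
      using law[OF u] by auto
    have tr: "expectation (\<lambda>\<omega>. g (?Z u \<omega>)) = (\<integral>x. g x \<partial>\<mu>)" if "g \<in> borel_measurable (vec_space p)" for g :: "(nat \<Rightarrow> real) \<Rightarrow> real"
      unfolding Q(3)[symmetric] by (rule integral_distr[OF meas[OF u] that, symmetric])
    have tri: "integrable \<mu> g \<longleftrightarrow> integrable M (\<lambda>\<omega>. g (?Z u \<omega>))" if "g \<in> borel_measurable (vec_space p)" for g :: "(nat \<Rightarrow> real) \<Rightarrow> real"
      unfolding Q(3)[symmetric] by (rule integrable_distr_eq[OF meas[OF u] that])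
    note mom = mvnormal_moments[OF Q(2,1) a]
    have "integrable M (\<lambda>\<omega>. ?Z u \<omega> a ^ k)"
      using mom(1)[of k] tri[OF borel_measurable_power[OF coord[OF a]]] by simp
    moreover have "expectation (\<lambda>\<omega>. ?Z u \<omega> a) = 0" using mom(2) tr[OF coord[OF a]] by simp
    moreover have "expectation (\<lambda>\<omega>. ?Z u \<omega> a ^ 8) = 105 * ?S u a a ^ 4"
      using mom(3) tr[OF borel_measurable_power[OF coord[OF a]]] Q(4) by simp
    moreover have "expectation (\<lambda>\<omega>. ?Z u \<omega> a * ?Z u \<omega> b) = ?S u a b" if "b < p" for b
      using mom(4)[OF that] tr[OF borel_measurable_times[OF coord[OF a] coord[OF that]]] Q(4) by simp
    moreover have "expectation (\<lambda>\<omega>. ?Z u \<omega> a * ?Z u \<omega> b * (?Z u \<omega> c * ?Z u \<omega> d)) =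
        ?S u a b * ?S u c d + ?S u a c * ?S u b d + ?S u a d * ?S u b c" if "b < p" "c < p" "d < p" for b c d
      using mom(5)[OF that] tr[OF borel_measurable_times[OF borel_measurable_times[OF coord[OF a] coord[OF that(1)]]
        borel_measurable_times[OF coord[OF that(2)] coord[OF that(3)]]]] Q(4) by simp
    ultimately show ?thesis by blast
  qed
  then show ?thesis by unfold_locales (use indep in auto)
qed

text \<open>With repeated indices the Wick formula gives the product of the variances plus twice the
  squared covariance, from which the squared mean is subtracted. This identifies
  \<open>theta\<close> with the \<open>\<theta>\<close> of the entry estimates.\<close>

lemma theta_eq:
  assumes N: "is_mvnormal p S \<mu>" and P: "pos_definite p S" and ij: "i < p" "j < p"
  shows "theta \<mu> i j = S $$ (i, i) * S $$ (j, j) + (S $$ (i, j))\<^sup>2"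
proof -
  interpret prob_space \<mu> using N by (simp add: is_mvnormal_def)
  have sets: "sets \<mu> = sets (vec_space p)" using N by (simp add: is_mvnormal_def)
  have meas: "(\<lambda>x. x a) \<in> borel_measurable \<mu>" if "a < p" for a
    using that by (simp add: measurable_cong_sets[OF sets refl])
  have int: "integrable \<mu> (\<lambda>x. (x i * x j) ^ m)" for m
    using ij by (intro integrable_mult_of_powers meas mvnormal_moments(1)[OF N P])
  have "variance (\<lambda>x. x i * x j) = expectation (\<lambda>x. (x i * x j)\<^sup>2) - (expectation (\<lambda>x. x i * x j))\<^sup>2"
    using int[of 1] int[of 2] by (intro variance_eq) auto
  also have "expectation (\<lambda>x. (x i * x j)\<^sup>2) = expectation (\<lambda>x. x i * x j * (x i * x j))"
    by (simp add: power2_eq_square)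
  finally show ?thesis
    using mvnormal_moments(4)[OF N P ij(1) ij(2)] mvnormal_moments(5)[OF N P ij(1) ij(2) ij(1) ij(2)] pos_definite_sym[OF P ij]
    by (simp add: theta_def power2_eq_square)
qed

text \<open>Translates the traces of the dense class into the norm in which the moment bounds are
  stated.\<close>

lemma mtrace_square:
  assumes A: "A \<in> carrier_mat p p" and sym: "\<And>a b. a < p \<Longrightarrow> b < p \<Longrightarrow> A $$ (a, b) = A $$ (b, a)"
  shows "mtrace (A * A) = frob_sq p (\<lambda>a b. A $$ (a, b))"
proof -
  have "mtrace (A * A) = (\<Sum>i<p. \<Sum>j<p. A $$ (i, j) * A $$ (j, i))"
    using A by (auto simp: mtrace_def scalar_prod_def lessThan_atLeast0 intro!: sum.cong)
  also have "\<dots> = (\<Sum>i<p. \<Sum>j<p. (A $$ (i, j))\<^sup>2)"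
    using sym by (intro sum.cong refl) (auto simp: power2_eq_square)
  finally show ?thesis by (simp add: frob_sq_def sum.cartesian_product)
qed

lemma frob_sq_pos: "i < p \<Longrightarrow> j < p \<Longrightarrow> s i j \<noteq> 0 \<Longrightarrow> 0 < frob_sq p s"
  unfolding frob_sq_def by (rule sum_pos2[of _ "(i, j)"]) auto

lemma sample_case_sum:
  assumes "gaussian_vectors M ({..<n1} <+> {..<n2}) (case_sum X Y) p (case_sum (\<lambda>_. s) (\<lambda>_. r))"
  shows "gaussian_vectors.sample ({..<n1} <+> {..<n2}) (case_sum (\<lambda>_. s) (\<lambda>_. r)) Inl n1 s"
    and "gaussian_vectors.sample ({..<n1} <+> {..<n2}) (case_sum (\<lambda>_. s) (\<lambda>_. r)) Inr n2 r"
proof -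
  interpret gaussian_vectors M "{..<n1} <+> {..<n2}" "case_sum X Y" p "case_sum (\<lambda>_. s) (\<lambda>_. r)" by fact
  show "sample Inl n1 s" "sample Inr n2 r" by (auto simp: sample_def)
qed

section \<open>Power at a fixed index, and the limit\<close>

lemma power_dense:
  assumes P1: "pos_definite p S1" and P2: "pos_definite p S2"
    and N1: "is_mvnormal p S1 \<mu>1" and N2: "is_mvnormal p S2 \<mu>2"
    and X: "iid_samples M p n1 n2 \<mu>1 \<mu>2 X Y" and n: "6 \<le> n1" "6 \<le> n2" and p: "0 < p" and neq: "S1 \<noteq> S2"
    and small: "1 / real n1 * mtrace (S1 * S1) + 1 / real n2 * mtrace (S2 * S2) \<le> \<rho> * mtrace ((S1 - S2) * (S1 - S2))"
    and \<rho>: "0 < \<rho>" "\<rho> \<le> 1" "L \<le> 1 / (6 * \<rho>)"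
    and L: "\<And>x y. L \<le> T_stat p n1 n2 x y / sigma0_hat p n1 n2 x y \<Longrightarrow> c \<le> F_stat p n1 n2 x y"
  shows "1 - (800000000 * \<rho> + 40000000 / real n1 + 40000000 / real n2)
    \<le> measure M {\<omega> \<in> space M. c \<le> F_stat p n1 n2 (\<lambda>u. X u \<omega>) (\<lambda>v. Y v \<omega>)}"
proof -
  define s where "s = (\<lambda>a b. S1 $$ (a, b))"
  define r where "r = (\<lambda>a b. S2 $$ (a, b))"
  have gs: "gaussian_vectors M ({..<n1} <+> {..<n2}) (case_sum X Y) p (case_sum (\<lambda>_. s) (\<lambda>_. r))"
    unfolding s_def r_def by (rule gaussian_vectorsI[OF P1 P2 N1 N2 X])
  interpret gaussian_vectors M "{..<n1} <+> {..<n2}" "case_sum X Y" p "case_sum (\<lambda>_. s) (\<lambda>_. r)" by (rule gs)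
  note e = sample_case_sum(1)[OF gs] and f = sample_case_sum(2)[OF gs]
  have carr: "S1 \<in> carrier_mat p p" "S2 \<in> carrier_mat p p" using P1 P2 by (auto simp: pos_definite_def)
  define d where "d = frob_sq p (\<lambda>a b. s a b - r a b)"
  define N where "N = frob_sq p s / real n1 + frob_sq p r / real n2"
  have "mtrace ((S1 - S2) * (S1 - S2)) = frob_sq p (\<lambda>a b. (S1 - S2) $$ (a, b))"
    using carr pos_definite_sym[OF P1] pos_definite_sym[OF P2] by (intro mtrace_square) auto
  also have "\<dots> = d"
    unfolding d_def frob_sq_def using carr by (intro sum.cong) (auto simp: s_def r_def)
  finally have "N \<le> \<rho> * d"
    using small mtrace_square[OF carr(1) pos_definite_sym[OF P1]] mtrace_square[OF carr(2) pos_definite_sym[OF P2]]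
    by (simp add: N_def s_def r_def)
  \<comment> \<open>The alternative enters here: an entry in which the matrices differ makes
    \<open>d\<close> positive, so that division by \<open>d\<close> is legitimate.\<close>
  obtain i j where ij: "i < p" "j < p" "s i j \<noteq> r i j"
  proof -
    have "\<exists>i<p. \<exists>j<p. S1 $$ (i, j) \<noteq> S2 $$ (i, j)"
    proof (rule ccontr)
      assume "\<not> ?thesis"
      then have "S1 = S2" using carr by (intro eq_matI) auto
      with neq show False by simp
    qed
    then show ?thesis using that by (auto simp: s_def r_def)
  qed
  have d0: "0 < d" unfolding d_def by (rule frob_sq_pos[OF ij(1,2)]) (use ij in simp)
  have s0: "0 < frob_sq p s" "0 < frob_sq p r"
    using frob_sq_pos[OF p p, of s] frob_sq_pos[OF p p, of r] pos_definite_diag[OF P1 p] pos_definite_diag[OF P2 p] by (auto simp: s_def r_def)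
  have N0: "0 < N" using s0 n by (simp add: N_def add_pos_pos)
  have ratio: "N / d \<le> \<rho>" using \<open>N \<le> \<rho> * d\<close> d0 by (simp add: pos_divide_le_eq)
  obtain G where G: "G \<in> events"
    "1 - (400000000 * ((N / d)\<^sup>2 + N / d) + 40000000 / real n1 + 40000000 / real n2) \<le> prob G"
    "\<And>\<omega>. \<omega> \<in> G \<Longrightarrow> d / (6 * N) \<le> T_stat p n1 n2 (\<lambda>u. case_sum X Y (Inl u) \<omega>) (\<lambda>v. case_sum X Y (Inr v) \<omega>)
       / sigma0_hat p n1 n2 (\<lambda>u. case_sum X Y (Inl u) \<omega>) (\<lambda>v. case_sum X Y (Inr v) \<omega>)"
    using ratio_large[OF e f _ n d_def N_def d0 s0] by blast
  have "L \<le> d / (6 * N)"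
  proof -
    have "1 / (6 * \<rho>) \<le> 1 / (6 * (N / d))" using ratio N0 d0 \<rho> by (intro divide_left_mono) auto
    then show ?thesis using \<rho>(3) by simp
  qed
  then have sub: "G \<subseteq> {\<omega> \<in> space M. c \<le> F_stat p n1 n2 (\<lambda>u. X u \<omega>) (\<lambda>v. Y v \<omega>)}"
    using G(3) sets.sets_into_space[OF G(1)] L by fastforce
  \<comment> \<open>\<open>N / d \<le> 1\<close> bounds the square by the first power, which doubles
    the constant.\<close>
  have "(N / d)\<^sup>2 + N / d \<le> 2 * \<rho>"
  proof -
    have "N / d \<le> 1" "0 \<le> N / d" using ratio \<rho> N0 d0 by (linarith, simp)
    then have "(N / d)\<^sup>2 \<le> N / d * 1" unfolding power2_eq_square by (intro mult_left_mono)
    then show ?thesis using ratio by linarith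
  qed
  from mult_left_mono[OF this, of 400000000]
  have "400000000 * ((N / d)\<^sup>2 + N / d) \<le> 800000000 * \<rho>" by simp
  then have "1 - (800000000 * \<rho> + 40000000 / real n1 + 40000000 / real n2)
      \<le> 1 - (400000000 * ((N / d)\<^sup>2 + N / d) + 40000000 / real n1 + 40000000 / real n2)"
    by (intro diff_mono add_mono order_refl)
  also note G(2)
  also have "prob G \<le> prob {\<omega> \<in> space M. c \<le> F_stat p n1 n2 (\<lambda>u. X u \<omega>) (\<lambda>v. Y v \<omega>)}"
  proof (rule finite_measure_mono[OF sub])
    have [measurable]: "(\<lambda>\<omega>. F_stat p n1 n2 (\<lambda>u. X u \<omega>) (\<lambda>v. Y v \<omega>)) \<in> borel_measurable M"
      using F_stat_measurable[OF e f] n by simp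
    show "{\<omega> \<in> space M. c \<le> F_stat p n1 n2 (\<lambda>u. X u \<omega>) (\<lambda>v. Y v \<omega>)} \<in> events" by measurable
  qed
  finally show ?thesis .
qed

text \<open>The maximum defining the sparse class runs over a finite non-empty set and is attained
  at an entry. Its bound \<open>9 / 2 ln p\<close> exceeds the centring \<open>4 ln p\<close> by the
  \<open>ln p / 2\<close> in the condition on \<open>L\<close>.\<close>

lemma power_sparse:
  assumes P1: "pos_definite p S1" and P2: "pos_definite p S2"
    and N1: "is_mvnormal p S1 \<mu>1" and N2: "is_mvnormal p S2 \<mu>2"
    and X: "iid_samples M p n1 n2 \<mu>1 \<mu>2 X Y" and sparse: "(S1, S2) \<in> G_sparse p n1 n2 \<mu>1 \<mu>2"
    and b: "1 \<le> b" and n: "1000 * b\<^sup>2 \<le> real n1" "1000 * b\<^sup>2 \<le> real n2" and lp: "16 * b \<le> ln (real p)"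
    and Lp: "L \<le> ln (real p) / 2 + ln (ln (real p))"
    and L: "\<And>x y. L \<le> M_stat p n1 n2 x y - 4 * ln (real p) + ln (ln (real p)) \<Longrightarrow> c \<le> F_stat p n1 n2 x y"
  shows "1 - 180 / b \<le> measure M {\<omega> \<in> space M. c \<le> F_stat p n1 n2 (\<lambda>u. X u \<omega>) (\<lambda>v. Y v \<omega>)}"
proof -
  define s where "s = (\<lambda>a b. S1 $$ (a, b))"
  define r where "r = (\<lambda>a b. S2 $$ (a, b))"
  have gs: "gaussian_vectors M ({..<n1} <+> {..<n2}) (case_sum X Y) p (case_sum (\<lambda>_. s) (\<lambda>_. r))"
    unfolding s_def r_def by (rule gaussian_vectorsI[OF P1 P2 N1 N2 X])
  interpret gaussian_vectors M "{..<n1} <+> {..<n2}" "case_sum X Y" p "case_sum (\<lambda>_. s) (\<lambda>_. r)" by (rule gs)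
  note e = sample_case_sum(1)[OF gs] and f = sample_case_sum(2)[OF gs]
  have "0 < p" using lp b by (cases p) auto
  define g where "g i j = \<bar>S1 $$ (i, j) - S2 $$ (i, j)\<bar> / sqrt (theta \<mu>1 i j / real n1 + theta \<mu>2 i j / real n2)" for i j
  let ?A = "{g i j | i j. i \<le> j \<and> j < p}"
  have "finite ?A" by (rule finite_image_upper_triangle)
  moreover have "?A \<noteq> {}" using \<open>0 < p\<close> by auto
  ultimately have "Max ?A \<in> ?A" by (rule Max_in)
  then obtain i j where ij: "i \<le> j" "j < p" and "Max ?A = g i j" by auto
  moreover have "4 * sqrt (ln (real p)) \<le> Max ?A" using sparse by (simp add: G_sparse_def g_def)
  ultimately have "4 * sqrt (ln (real p)) \<le> \<bar>s i j - r i j\<bar> / sqrt (theta \<mu>1 i j / real n1 + theta \<mu>2 i j / real n2)"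
    by (simp add: s_def r_def g_def)
  moreover have ip: "i < p" using ij by simp
  moreover have "theta \<mu>1 i j = s i i * s j j + (s i j)\<^sup>2" "theta \<mu>2 i j = r i i * r j j + (r i j)\<^sup>2"
    using theta_eq[OF N1 P1 ip ij(2)] theta_eq[OF N2 P2 ip ij(2)] by (simp_all add: s_def r_def)
  moreover have "0 < s i i" "0 < s j j" "0 < r i i" "0 < r j j"
    using pos_definite_diag[OF P1] pos_definite_diag[OF P2] ip ij by (simp_all add: s_def r_def)
  ultimately obtain G where G: "G \<in> events" "1 - 180 / b \<le> prob G"
    "\<And>\<omega>. \<omega> \<in> G \<Longrightarrow> 9 / 2 * ln (real p) \<le> M_stat p n1 n2 (\<lambda>u. case_sum X Y (Inl u) \<omega>) (\<lambda>v. case_sum X Y (Inr v) \<omega>)"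
    using M_stat_large[OF e f ij _ _ _ _ b n lp] by blast
  have sub: "G \<subseteq> {\<omega> \<in> space M. c \<le> F_stat p n1 n2 (\<lambda>u. X u \<omega>) (\<lambda>v. Y v \<omega>)}"
  proof safe
    fix \<omega> assume \<omega>: "\<omega> \<in> G"
    then show "\<omega> \<in> space M" using sets.sets_into_space[OF G(1)] by auto
    show "c \<le> F_stat p n1 n2 (\<lambda>u. X u \<omega>) (\<lambda>v. Y v \<omega>)"
      using G(3)[OF \<omega>] Lp by (intro L) simp
  qed
  have "1 * 1 \<le> b\<^sup>2" using b by simp
  then have n2: "2 \<le> n1" "2 \<le> n2" using n by linarith+
  note G(2)
  also have "prob G \<le> prob {\<omega> \<in> space M. c \<le> F_stat p n1 n2 (\<lambda>u. X u \<omega>) (\<lambda>v. Y v \<omega>)}"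
  proof (rule finite_measure_mono[OF sub])
    have [measurable]: "(\<lambda>\<omega>. F_stat p n1 n2 (\<lambda>u. X u \<omega>) (\<lambda>v. Y v \<omega>)) \<in> borel_measurable M"
      using F_stat_measurable[OF e f n2] by simp
    show "{\<omega> \<in> space M. c \<le> F_stat p n1 n2 (\<lambda>u. X u \<omega>) (\<lambda>v. Y v \<omega>)} \<in> events" by measurable
  qed
  finally show ?thesis .
qed

theorem theorem3:
  fixes p n1 n2 :: "nat \<Rightarrow> nat"
    and S1 S2 :: "nat \<Rightarrow> real mat"
    and \<mu>1 \<mu>2 :: "nat \<Rightarrow> (nat \<Rightarrow> real) measure"
    and M :: "nat \<Rightarrow> 'a measure"
    and X Y :: "nat \<Rightarrow> nat \<Rightarrow> 'a \<Rightarrow> nat \<Rightarrow> real"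
    and \<alpha> :: real
  assumes n1_lim: "filterlim n1 at_top sequentially"
    and n2_lim: "filterlim n2 at_top sequentially"
    and p_lim: "filterlim p at_top sequentially"
    and pd1: "\<And>k. pos_definite (p k) (S1 k)"
    and pd2: "\<And>k. pos_definite (p k) (S2 k)"
    and normal1: "\<And>k. is_mvnormal (p k) (S1 k) (\<mu>1 k)"
    and normal2: "\<And>k. is_mvnormal (p k) (S2 k) (\<mu>2 k)"
    and samples: "\<And>k. iid_samples (M k) (p k) (n1 k) (n2 k) (\<mu>1 k) (\<mu>2 k) (X k) (Y k)"
    and assm1: "assumption1 p n1 n2 S1 S2"
    and assm2: "assumption2 p S1 S2"
    and log_p: "(\<lambda>k. ln (real (p k))) \<in> o(\<lambda>k. real (n1 k + n2 k) powr (1 / 5))"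
    and alpha: "0 < \<alpha>" "\<alpha> < 1"
    and alternative: "\<And>k. S1 k \<noteq> S2 k"
    and classes: "dense_or_sparse p n1 n2 \<mu>1 \<mu>2 (\<lambda>k. (S1 k, S2 k))"
  shows "(\<lambda>k. measure (M k) {\<omega> \<in> space (M k).
            F_stat (p k) (n1 k) (n2 k) (\<lambda>u. X k u \<omega>) (\<lambda>v. Y k v \<omega>)
              \<ge> upper_quantile (chi_squared 4) \<alpha>}) \<longlonglongrightarrow> 1"
proof -
  define c where "c = upper_quantile (chi_squared 4) \<alpha>"
  obtain L where L: "\<And>p n1 n2 x y. L \<le> T_stat p n1 n2 x y / sigma0_hat p n1 n2 x y \<Longrightarrow> c \<le> F_stat p n1 n2 x y"
    "\<And>p n1 n2 x y. L \<le> M_stat p n1 n2 x y - 4 * ln (real p) + ln (ln (real p)) \<Longrightarrow> c \<le> F_stat p n1 n2 x y"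
    using F_stat_ge by blast
  \<comment> \<open>Either \<open>D\<close> or its complement may be finite: each half of the
    argument is an eventual implication restricted to its own side.\<close>
  obtain D where dense: "(\<lambda>k. (S1 k, S2 k)) \<in> G_dense (inf sequentially (principal D)) p n1 n2"
    and sparse: "\<And>k. k \<notin> D \<Longrightarrow> (S1 k, S2 k) \<in> G_sparse (p k) (n1 k) (n2 k) (\<mu>1 k) (\<mu>2 k)"
    using classes by (auto simp: dense_or_sparse_def)
  let ?P = "\<lambda>k. measure (M k) {\<omega> \<in> space (M k). c \<le> F_stat (p k) (n1 k) (n2 k) (\<lambda>u. X k u \<omega>) (\<lambda>v. Y k v \<omega>)}"
  have rn: "filterlim (\<lambda>k. real (n1 k)) at_top sequentially" "filterlim (\<lambda>k. real (n2 k)) at_top sequentially"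
    "filterlim (\<lambda>k. real (p k)) at_top sequentially"
    using n1_lim n2_lim p_lim by (auto intro: filterlim_compose[OF filterlim_real_sequentially])
  have le1: "?P k \<le> 1" for k
  proof -
    interpret prob_space "M k" using samples[of k] by (simp add: iid_samples_def)
    show ?thesis by (rule prob_le_1)
  qed
  have lower: "\<forall>\<^sub>F k in sequentially. 1 - \<epsilon> < ?P k" if \<epsilon>: "0 < \<epsilon>" for \<epsilon>
  proof -
    \<comment> \<open>\<open>L\<close> may be zero or negative, and a positive number is needed as a
      divisor.\<close>
    define l where "l = max L 1"
    have l: "0 < l" "L \<le> l" by (simp_all add: l_def)
    \<comment> \<open>The bound 1 serves the squared ratio, the second makes
      \<open>800000000 \<rho>\<close> at most \<open>\<epsilon> / 4\<close>, and the third yields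
      \<open>L \<le> 1 / (6 \<rho>)\<close>.\<close>
    define \<rho> where "\<rho> = min 1 (min (\<epsilon> / 3200000000) (1 / (6 * l)))"
    have \<rho>: "0 < \<rho>" "\<rho> \<le> 1" "\<rho> \<le> \<epsilon> / 3200000000" and \<rho>L: "\<rho> \<le> 1 / (6 * l)"
      using \<epsilon> l by (auto simp: \<rho>_def)
    have "l \<le> 1 / (6 * \<rho>)" using \<rho>L \<rho>(1) l(1) by (simp add: field_simps)
    then have \<rho>L': "L \<le> 1 / (6 * \<rho>)" using l(2) by linarith
    have large: "\<forall>\<^sub>F k in sequentially. 6 \<le> n1 k \<and> 6 \<le> n2 k \<and> 0 < p k"
      using n1_lim n2_lim p_lim by (auto simp: filterlim_at_top eventually_conj_iff intro: eventually_mono[where P = "\<lambda>k. 1 \<le> p k"])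
    \<comment> \<open>Makes each of the terms \<open>40000000 / n1\<close> and
      \<open>40000000 / n2\<close> smaller than \<open>\<epsilon> / 4\<close>; with the share of
      \<open>\<rho>\<close> the total stays below \<open>\<epsilon>\<close>.\<close>
    have n_large: "\<forall>\<^sub>F k in sequentially. 160000000 / \<epsilon> < real (n1 k) \<and> 160000000 / \<epsilon> < real (n2 k)"
      using rn by (auto simp: filterlim_at_top_dense eventually_conj_iff)
    have "(\<lambda>k. 1 / real (n1 k) * mtrace (S1 k * S1 k) + 1 / real (n2 k) * mtrace (S2 k * S2 k))
      \<in> o[inf sequentially (principal D)](\<lambda>k. mtrace ((S1 k - S2 k) * (S1 k - S2 k)))"
      using dense by (simp add: G_dense_def)
    \<comment> \<open>The asymptotic condition is used at the single constant \<open>\<rho>\<close>,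
      and the restriction of the filter to \<open>D\<close> becomes an implication.\<close>
    from landau_o.smallD[OF this \<rho>(1)]
    have "\<forall>\<^sub>F k in sequentially. k \<in> D \<longrightarrow> norm (1 / real (n1 k) * mtrace (S1 k * S1 k) + 1 / real (n2 k) * mtrace (S2 k * S2 k))
        \<le> \<rho> * norm (mtrace ((S1 k - S2 k) * (S1 k - S2 k)))"
      by (simp add: eventually_inf_principal)
    with large n_large have ev_dense: "\<forall>\<^sub>F k in sequentially. k \<in> D \<longrightarrow> 1 - \<epsilon> < ?P k"
    proof eventually_elim
      case (elim k)
      show ?case
      proof
        assume "k \<in> D"
        have carr: "S1 k \<in> carrier_mat (p k) (p k)" "S2 k \<in> carrier_mat (p k) (p k)"
          using pd1[of k] pd2[of k] by (auto simp: pos_definite_def)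
        \<comment> \<open>As a Frobenius norm the trace is non-negative, which removes the norm from
          the asymptotic bound.\<close>
        have "mtrace ((S1 k - S2 k) * (S1 k - S2 k)) = frob_sq (p k) (\<lambda>a b. (S1 k - S2 k) $$ (a, b))"
          using carr pos_definite_sym[OF pd1[of k]] pos_definite_sym[OF pd2[of k]] by (intro mtrace_square) auto
        then have "0 \<le> mtrace ((S1 k - S2 k) * (S1 k - S2 k))" by (simp add: frob_sq_nonneg)
        then have small: "1 / real (n1 k) * mtrace (S1 k * S1 k) + 1 / real (n2 k) * mtrace (S2 k * S2 k)
          \<le> \<rho> * mtrace ((S1 k - S2 k) * (S1 k - S2 k))"
          using elim \<open>k \<in> D\<close> by (auto simp: abs_le_iff)
        have "1 - (800000000 * \<rho> + 40000000 / real (n1 k) + 40000000 / real (n2 k)) \<le> ?P k"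
          using power_dense[OF pd1 pd2 normal1 normal2 samples _ _ _ alternative small \<rho>(1,2) \<rho>L' L(1)] elim by simp
        moreover have "40000000 / real (n1 k) < \<epsilon> / 4" "40000000 / real (n2 k) < \<epsilon> / 4"
          using elim \<epsilon> by (simp_all add: field_simps)
        ultimately show "1 - \<epsilon> < ?P k" using \<rho>(3) \<epsilon> by linarith
      qed
    qed
    \<comment> \<open>\<open>b\<close> stays fixed while \<open>k\<close> grows:
      \<open>180 / b \<le> \<epsilon> / 2\<close>, and the conditions relating \<open>b\<close> to
      the sample sizes and to \<open>p\<close> hold eventually.\<close>
    define b where "b = max 1 (360 / \<epsilon>)"
    have b: "1 \<le> b" by (simp add: b_def)
    have b\<epsilon>: "180 / b < \<epsilon>"
    proof -
      have "180 / b \<le> 180 / (360 / \<epsilon>)" using \<epsilon> by (intro divide_left_mono) (auto simp: b_def)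
      then show ?thesis using \<epsilon> by simp
    qed
    \<comment> \<open>The second function is \<open>9 / 2 ln x - 4 ln x + ln (ln x)\<close>, the
      argument of the Gumbel distribution function at the lower bound for
      \<open>M_stat\<close>.\<close>
    have "filterlim (\<lambda>x::real. ln x) at_top at_top" "filterlim (\<lambda>x::real. ln x / 2 + ln (ln x)) at_top at_top"
      by real_asymp+
    from this[THEN filterlim_compose, OF rn(3)]
    have "\<forall>\<^sub>F k in sequentially. 16 * b \<le> ln (real (p k))" "\<forall>\<^sub>F k in sequentially. L \<le> ln (real (p k)) / 2 + ln (ln (real (p k)))"
      by (auto simp: filterlim_at_top)
    moreover have "\<forall>\<^sub>F k in sequentially. 1000 * b\<^sup>2 \<le> real (n1 k)" "\<forall>\<^sub>F k in sequentially. 1000 * b\<^sup>2 \<le> real (n2 k)"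
      using rn by (auto simp: filterlim_at_top)
    ultimately have ev_sparse: "\<forall>\<^sub>F k in sequentially. k \<notin> D \<longrightarrow> 1 - \<epsilon> < ?P k"
    proof eventually_elim
      case (elim k)
      show ?case
      proof
        assume "k \<notin> D"
        then have "1 - 180 / b \<le> ?P k"
          using power_sparse[OF pd1 pd2 normal1 normal2 samples sparse b _ _ _ _ L(2)] elim by simp
        then show "1 - \<epsilon> < ?P k" using b\<epsilon> by linarith
      qed
    qed
    from ev_dense ev_sparse show ?thesis by eventually_elim blast
  qed
  have "?P \<longlonglongrightarrow> 1"
  proof (rule order_tendstoI)
    fix a :: real assume "a < 1"
    then show "\<forall>\<^sub>F k in sequentially. a < ?P k" using lower[of "1 - a"] by simp
  next
    fix a :: real assume "1 < a"
    then show "\<forall>\<^sub>F k in sequentially. ?P k < a" using le1 by (auto intro!: always_eventually intro: le_less_trans)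
  qed
  then show ?thesis by (simp add: c_def)
qed

end
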